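(* In the regression setting described in the context, assume that the set of assumptions (SA) holds. Let $r\in(2,+\infty)$ and let $V\in\{2,\dots,n-1\}$ satisfy $1<V\le r$. Let $\widehat{m}_{\mathrm{penVF}}$ be the model selected by $V$-fold penalization, $$\widehat{m}_{\mathrm{penVF}}\in\arg\min_{m\in\mathcal{M}_n}\left\{P_n(\gamma(\widehat{s}_m))+\mathrm{pen}_{\mathrm{VF}}(m)\right\},\qquad \mathrm{pen}_{\mathrm{VF}}(m)=\frac{V-1}{V}\sum_{j=1}^V\left[P_n\gamma\big(\widehat{s}_m^{(-j)}\big)-P_n^{(-j)}\gamma\big(\widehat{s}_m^{(-j)}\big)\right].$$ Then there exist a constant $L>0$ and an integer $n_0$, both depending only on the constants in (SA) and on $r$, such that for all $n\ge n_0$, with probability at least $1-Ln^{-2}$, $$\ell\left(s_*,\widehat{s}_{\widehat{m}_{\mathrm{penVF}}}\right)\le\left(1+\frac{L}{\sqrt{\ln n}}\right)\inf_{m\in\mathcal{M}_n}\left\{\ell\left(s_*,\widehat{s}_m\right)\right\}+L\frac{(\ln n)^3}{n}.$$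
   Context: Setting. $(X_i,Y_i)$, $i=1,\dots,n$, are i.i.d. with law $P$ on $\mathcal{X}\times\mathbb{R}$, $\mathcal{X}\subset\mathbb{R}^d$, with the same law as $(X,Y)$, and $Y=s_*(X)+\sigma(X)\varepsilon$, where $s_*\in L_2(P^X)$ ($P^X$ the law of $X$), $\mathbb{E}[\varepsilon|X]=0$, $\mathbb{E}[\varepsilon^2|X]=1$ and $\sigma:\mathcal{X}\to\mathbb{R}_+$. $\|\cdot\|_2$ is the norm of $L_2(P^X)$ and $\|\cdot\|_\infty$ the sup-norm. $\gamma(s)(x,y)=(y-s(x))^2$, $Pf=\mathbb{E}[f(X,Y)]$, $P_n=n^{-1}\sum_{i=1}^n\delta_{(X_i,Y_i)}$. $\mathcal{M}_n$ is a finite collection of models; each model $m\in\mathcal{M}_n$ is a linear subspace of $L_2(P^X)$ of finite dimension $D_m$. $s_m$ is the orthogonal projection of $s_*$ onto $m$ in $L_2(P^X)$, and $\widehat{s}_m\in\arg\min_{s\in m}P_n(\gamma(s))$. $\ell(s_*,s)=P(\gamma(s)-\gamma(s_* ))=\|s-s_*\|_2^2$. $V$-fold notation. $(B_j)_{1\le j\le V}$ is a (deterministic) partition of $\{1,\dots,n\}$, assumed regular: $\mathrm{Card}(B_j)=n/V$ for all $j$. $P_n^{(-j)}=\frac1{n-\mathrm{Card}(B_j)}\sum_{i\notin B_j}\delta_{(X_i,Y_i)}$, and $\widehat{s}_m^{(-j)}\in\arg\min_{s\in m}P_n^{(-j)}(\gamma(s))$. Assumptions (SA): (P1) $\mathrm{Card}(\mathcal{M}_n)\le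 c_{\mathcal{M}}n^{\alpha_{\mathcal{M}}}$ for constants $c_{\mathcal{M}},\alpha_{\mathcal{M}}>0$. (Auslb) There exist $r_{\mathcal{M}},A_c>0$ such that for every $m\in\mathcal{M}_n$ there exist $b_m\in\mathbb{N}\setminus\{0\}$, a partition $(\Pi_i)_{i=1}^{b_m}$ of $\{1,\dots,D_m\}$, constants $0<A_1\le\dots\le A_{b_m}<\infty$ and an orthonormal basis $(\varphi_k)_{k=1}^{D_m}$ of $(m,\|\cdot\|_2)$ with $\sum_{i=1}^{b_m}\sqrt{A_i}\le r_{\mathcal{M}}\sqrt{D_m}$; $\|\varphi_k\|_\infty\le r_{\mathcal{M}}\sqrt{A_i}$ for all $i$ and $k\in\Pi_i$; and, for all $i,j$, $\max_{k\in\Pi_i}\mathrm{Card}(\Pi_{j|k})\le A_c\max\{A_jA_i^{-1},1\}$, where $\Pi_{j|k}=\{l\in\Pi_j:\mathrm{supp}(\varphi_k)\cap\mathrm{supp}(\varphi_l)\neq\emptyset\}$. (P2) There is $A_{\mathcal{M},+}>0$ such that for every $m\in\mathcal{M}_n$, $1\le D_m\le\max\{D_m,b_m^2A_{b_m}\}\le A_{\mathcal{M},+}n(\ln n)^{-2}$. (P3) There exist $m_0,m_1\in\mathcal{M}_n$ and constants $c_{\mathrm{rich}},A_{\mathrm{rich}}>0$ such that $D_{m_0}\in[\sqrt n,c_{\mathrm{rich}}\sqrt n]$ and $D_{m_1}\ge A_{\mathrm{rich}}n(\ln n)^{-2}$. (Ab) There is $A<\infty$ with $|Y_i|\le A$ (a.s.)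 and $\|s_m\|_\infty\le A$ for all $m\in\mathcal{M}_n$. (An) $\sigma(X_i)\ge\sigma_{\min}>0$ a.s. (Ap$_u$) There exist $\beta_+,C_+>0$ such that $\ell(s_*,s_m)\le C_+D_m^{-\beta_+}$ for all $m\in\mathcal{M}_n$. The "constants in (SA)" are $c_{\mathcal{M}},\alpha_{\mathcal{M}},r_{\mathcal{M}},A_c,A_{\mathcal{M},+},c_{\mathrm{rich}},A_{\mathrm{rich}},A,\sigma_{\min},\beta_+,C_+$; they do not depend on $n$. *)

theory Defs
  imports "HOL-Probability.Probability" "HOL-Library.Function_Algebras"
begin

section \<open>Real vector space structure on real-valued functions\<close>

text \<open>
  With this instance, \<open>subspace\<close>, \<open>span\<close> and \<open>dim\<close> are available for sets of functions.
\<close>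

instantiation "fun" :: (type, real_vector) real_vector
begin

definition scaleR_fun_def: "scaleR c f = (\<lambda>x. scaleR c (f x))"

instance
  by standard (auto simp: scaleR_fun_def fun_eq_iff scaleR_add_right scaleR_add_left)

end

section \<open>The regression setting\<close>

text \<open>
  The constants required from the setting must not depend on the dimension \<open>d\<close> of the covariate
  space. A dimension given by a type could not be quantified after those constants, so a point of
  \<open>R^d\<close> is an extensional function on \<open>{..<d}\<close>, and the Borel sigma-algebra of \<open>R^d\<close> is
  the product sigma-algebra. For the same reason the i.i.d. sample is taken on its canonical
  probability space \<open>P^n\<close> instead of an abstract one of arbitrary type.
\<close>

type_synonym point = "nat \<Rightarrow> real"
type_synonym obs = "point \<times> real"
type_synonym predictor = "point \<Rightarrow> real"
type_synonym model = "predictor set"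
type_synonym sample = "nat \<Rightarrow> obs"

definition covariate_space :: "nat \<Rightarrow> point set \<Rightarrow> point measure" where
  "covariate_space d \<X> = restrict_space (PiM {..<d} (\<lambda>_. borel)) \<X>"

definition covariate_law :: "nat \<Rightarrow> point set \<Rightarrow> obs measure \<Rightarrow> point measure" where
  "covariate_law d \<X> P = distr P (covariate_space d \<X>) fst"

text \<open>Square integrable functions, as functions rather than as classes modulo null sets.\<close>

definition L2_space :: "point measure \<Rightarrow> predictor set" where
  "L2_space \<mu> = {f \<in> borel_measurable \<mu>. integrable \<mu> (\<lambda>x. (f x)\<^sup>2)}"

text \<open>The sigma-algebra generated by the covariate \<open>X = fst\<close> on the space of \<open>(X,Y)\<close>.\<close>

definition covariate_algebra :: "nat \<Rightarrow> point set \<Rightarrow> obs measure \<Rightarrow> obs measure" where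
  "covariate_algebra d \<X> P = vimage_algebra (space P) fst (covariate_space d \<X>)"

text \<open>
  The generic pair \<open>(X,Y)\<close> is \<open>(fst, snd)\<close> on the probability space \<open>P\<close>. The noise is a random
  variable on that same space: this is no restriction, because under (An) the identity
  \<open>Y = s_*(X) + \<sigma>(X) \<epsilon>\<close> makes \<open>\<epsilon>\<close> almost surely a function of \<open>(X,Y)\<close>.
\<close>

definition regression_setting ::
  "nat \<Rightarrow> point set \<Rightarrow> obs measure \<Rightarrow> predictor \<Rightarrow> (point \<Rightarrow> real) \<Rightarrow> (obs \<Rightarrow> real) \<Rightarrow> bool" where
  "regression_setting d \<X> P s\<^sub>0 \<sigma> \<epsilon> \<longleftrightarrow>
     \<X> \<subseteq> (\<Pi>\<^sub>E i\<in>{..<d}. UNIV) \<and>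
     prob_space P \<and>
     sets P = sets (covariate_space d \<X> \<Otimes>\<^sub>M (borel :: real measure)) \<and>
     s\<^sub>0 \<in> L2_space (covariate_law d \<X> P) \<and>
     \<sigma> \<in> borel_measurable (covariate_space d \<X>) \<and>
     (\<forall>x\<in>\<X>. 0 \<le> \<sigma> x) \<and>
     \<epsilon> \<in> borel_measurable P \<and>
     (AE z in P. snd z = s\<^sub>0 (fst z) + \<sigma> (fst z) * \<epsilon> z) \<and>
     (AE z in P. real_cond_exp P (covariate_algebra d \<X> P) \<epsilon> z = 0) \<and>
     (AE z in P. real_cond_exp P (covariate_algebra d \<X> P) (\<lambda>w. (\<epsilon> w)\<^sup>2) z = 1)"

definition contrast :: "predictor \<Rightarrow> obs \<Rightarrow> real" where
  "contrast s = (\<lambda>(x, y). (y - s x)\<^sup>2)"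

definition excess_risk :: "obs measure \<Rightarrow> predictor \<Rightarrow> predictor \<Rightarrow> real" where
  "excess_risk P s\<^sub>0 s = (\<integral>z. contrast s z - contrast s\<^sub>0 z \<partial>P)"

definition sup_norm_on :: "point set \<Rightarrow> predictor \<Rightarrow> ennreal" where
  "sup_norm_on \<X> f = (SUP x\<in>\<X>. ennreal \<bar>f x\<bar>)"

text \<open>
  The support is not closed, so that the indicators of two adjacent cells of a partition have
  disjoint supports. Taking closures would only make the hypothesis (Auslb) more restrictive.
\<close>

definition supp_on :: "point set \<Rightarrow> predictor \<Rightarrow> point set" where
  "supp_on \<X> f = {x \<in> \<X>. f x \<noteq> 0}"

section \<open>Models and projections\<close>

definition is_model :: "point measure \<Rightarrow> model \<Rightarrow> bool" where
  "is_model \<mu> m \<longleftrightarrow> subspace m \<and> m \<subseteq> L2_space \<mu> \<and> (\<exists>S. finite S \<and> span S = m)"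

definition orthonormal_basis :: "point measure \<Rightarrow> model \<Rightarrow> (nat \<Rightarrow> predictor) \<Rightarrow> bool" where
  "orthonormal_basis \<mu> m \<phi> \<longleftrightarrow>
     span (\<phi> ` {1..dim m}) = m \<and>
     (\<forall>k\<in>{1..dim m}. \<forall>l\<in>{1..dim m}. (\<integral>x. \<phi> k x * \<phi> l x \<partial>\<mu>) = (if k = l then 1 else 0))"

text \<open>
  For a model with an orthonormal basis in the above sense the projection exists and is unique as a
  function, since no nonzero element of the model vanishes almost everywhere.
\<close>

definition orth_proj :: "point measure \<Rightarrow> model \<Rightarrow> predictor \<Rightarrow> predictor" where
  "orth_proj \<mu> m s = (SOME t. t \<in> m \<and> (\<forall>u\<in>m. (\<integral>x. (s x - t x) * u x \<partial>\<mu>) = 0))"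

definition indexed_partition :: "'i set \<Rightarrow> ('i \<Rightarrow> 'a set) \<Rightarrow> 'a set \<Rightarrow> bool" where
  "indexed_partition I F S \<longleftrightarrow> inj_on F I \<and> partition_on S (F ` I)"

section \<open>The set of assumptions (SA)\<close>

record SA_constants =
  c_M :: real
  alpha_M :: real
  r_M :: real
  A_c :: real
  A_Mplus :: real
  c_rich :: real
  A_rich :: real
  A_bd :: real
  sigma_min :: real
  beta_plus :: real
  C_plus :: real

definition SA_P1 :: "SA_constants \<Rightarrow> nat \<Rightarrow> model set \<Rightarrow> bool" where
  "SA_P1 K n \<M> \<longleftrightarrow> c_M K > 0 \<and> alpha_M K > 0 \<and> real (card \<M>) \<le> c_M K * real n powr alpha_M K"

definition SA_Auslb ::
  "SA_constants \<Rightarrow> point set \<Rightarrow> point measure \<Rightarrow> model \<Rightarrow> nat \<Rightarrow> (nat \<Rightarrow> nat set) \<Rightarrow> (nat \<Rightarrow> real)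
     \<Rightarrow> (nat \<Rightarrow> predictor) \<Rightarrow> bool" where
  "SA_Auslb K \<X> \<mu> m b G A \<phi> \<longleftrightarrow>
     r_M K > 0 \<and> A_c K > 0 \<and>
     b \<noteq> 0 \<and>
     indexed_partition {1..b} G {1..dim m} \<and>
     (\<forall>i\<in>{1..b}. 0 < A i) \<and> mono_on {1..b} A \<and>
     orthonormal_basis \<mu> m \<phi> \<and>
     (\<Sum>i=1..b. sqrt (A i)) \<le> r_M K * sqrt (real (dim m)) \<and>
     (\<forall>i\<in>{1..b}. \<forall>k\<in>G i. sup_norm_on \<X> (\<phi> k) \<le> ennreal (r_M K * sqrt (A i))) \<and>
     (\<forall>i\<in>{1..b}. \<forall>j\<in>{1..b}. \<forall>k\<in>G i.
        real (card {l \<in> G j. supp_on \<X> (\<phi> k) \<inter> supp_on \<X> (\<phi> l) \<noteq> {}})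
          \<le> A_c K * max (A j / A i) 1)"

definition SA_P2 :: "SA_constants \<Rightarrow> nat \<Rightarrow> model \<Rightarrow> nat \<Rightarrow> (nat \<Rightarrow> real) \<Rightarrow> bool" where
  "SA_P2 K n m b A \<longleftrightarrow>
     A_Mplus K > 0 \<and>
     1 \<le> dim m \<and>
     max (real (dim m)) ((real b)\<^sup>2 * A b) \<le> A_Mplus K * real n / (ln (real n))\<^sup>2"

definition SA_P3 :: "SA_constants \<Rightarrow> nat \<Rightarrow> model set \<Rightarrow> bool" where
  "SA_P3 K n \<M> \<longleftrightarrow>
     c_rich K > 0 \<and> A_rich K > 0 \<and>
     (\<exists>m0\<in>\<M>. \<exists>m1\<in>\<M>.
        sqrt (real n) \<le> real (dim m0) \<and> real (dim m0) \<le> c_rich K * sqrt (real n) \<and>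
        real (dim m1) \<ge> A_rich K * real n / (ln (real n))\<^sup>2)"

definition SA_Ab ::
  "SA_constants \<Rightarrow> point set \<Rightarrow> obs measure \<Rightarrow> point measure \<Rightarrow> predictor \<Rightarrow> model set \<Rightarrow> bool" where
  "SA_Ab K \<X> P \<mu> s\<^sub>0 \<M> \<longleftrightarrow>
     (AE z in P. \<bar>snd z\<bar> \<le> A_bd K) \<and>
     (\<forall>m\<in>\<M>. sup_norm_on \<X> (orth_proj \<mu> m s\<^sub>0) \<le> ennreal (A_bd K))"

definition SA_An :: "SA_constants \<Rightarrow> obs measure \<Rightarrow> (point \<Rightarrow> real) \<Rightarrow> bool" where
  "SA_An K P \<sigma> \<longleftrightarrow> sigma_min K > 0 \<and> (AE z in P. \<sigma> (fst z) \<ge> sigma_min K)"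

definition SA_Apu ::
  "SA_constants \<Rightarrow> obs measure \<Rightarrow> point measure \<Rightarrow> predictor \<Rightarrow> model set \<Rightarrow> bool" where
  "SA_Apu K P \<mu> s\<^sub>0 \<M> \<longleftrightarrow>
     beta_plus K > 0 \<and> C_plus K > 0 \<and>
     (\<forall>m\<in>\<M>. excess_risk P s\<^sub>0 (orth_proj \<mu> m s\<^sub>0) \<le> C_plus K * real (dim m) powr (- beta_plus K))"

text \<open>(P2) refers to the quantities \<open>b_m\<close> and \<open>A_{b_m}\<close> provided by (Auslb).\<close>

definition SA ::
  "SA_constants \<Rightarrow> nat \<Rightarrow> nat \<Rightarrow> point set \<Rightarrow> obs measure \<Rightarrow> predictor \<Rightarrow> (point \<Rightarrow> real)
     \<Rightarrow> model set \<Rightarrow> bool" where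
  "SA K n d \<X> P s\<^sub>0 \<sigma> \<M> \<longleftrightarrow>
     (let \<mu> = covariate_law d \<X> P in
        SA_P1 K n \<M> \<and>
        (\<forall>m\<in>\<M>. \<exists>b G A \<phi>. SA_Auslb K \<X> \<mu> m b G A \<phi> \<and> SA_P2 K n m b A) \<and>
        SA_P3 K n \<M> \<and>
        SA_Ab K \<X> P \<mu> s\<^sub>0 \<M> \<and>
        SA_An K P \<sigma> \<and>
        SA_Apu K P \<mu> s\<^sub>0 \<M>)"

section \<open>Empirical risks and V-fold penalization\<close>

definition sample_space :: "nat \<Rightarrow> obs measure \<Rightarrow> sample measure" where
  "sample_space n P = PiM {1..n} (\<lambda>_. P)"

text \<open>
  The empirical measure of the subsample indexed by \<open>I\<close>: \<open>P_n\<close> is the case \<open>I = {1..n}\<close>, and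
  \<open>P_n^(-j)\<close> the case \<open>I = {1..n} - B j\<close>.
\<close>

definition emp_mean :: "nat set \<Rightarrow> sample \<Rightarrow> (obs \<Rightarrow> real) \<Rightarrow> real" where
  "emp_mean I \<omega> f = (\<Sum>i\<in>I. f (\<omega> i)) / real (card I)"

definition is_least_squares :: "nat set \<Rightarrow> sample \<Rightarrow> model \<Rightarrow> predictor \<Rightarrow> bool" where
  "is_least_squares I \<omega> m t \<longleftrightarrow> is_arg_min (\<lambda>s. emp_mean I \<omega> (contrast s)) (\<lambda>s. s \<in> m) t"

definition regular_partition :: "nat \<Rightarrow> nat \<Rightarrow> (nat \<Rightarrow> nat set) \<Rightarrow> bool" where
  "regular_partition n V B \<longleftrightarrow>
     indexed_partition {1..V} B {1..n} \<and> (\<forall>j\<in>{1..V}. real (card (B j)) = real n / real V)"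

text \<open>The argument \<open>t j\<close> is the estimator trained without the block \<open>B j\<close>.\<close>

definition pen_VF :: "nat \<Rightarrow> nat \<Rightarrow> (nat \<Rightarrow> nat set) \<Rightarrow> sample \<Rightarrow> (nat \<Rightarrow> predictor) \<Rightarrow> real" where
  "pen_VF n V B \<omega> t =
     (real V - 1) / real V *
       (\<Sum>j=1..V. emp_mean {1..n} \<omega> (contrast (t j)) - emp_mean ({1..n} - B j) \<omega> (contrast (t j)))"

text \<open>
  The estimators are arbitrary selections of minimizers, not assumed measurable in the sample.
  Hence \<open>with probability at least p\<close> asks for a measurable event of probability at least \<open>p\<close> on
  which the property holds; for a measurable property this is the usual meaning.
\<close>

definition with_prob_at_least :: "'a measure \<Rightarrow> real \<Rightarrow> ('a \<Rightarrow> bool) \<Rightarrow> bool" where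
  "with_prob_at_least M p Q \<longleftrightarrow> (\<exists>E\<in>sets M. measure M E \<ge> p \<and> (\<forall>\<omega>\<in>E. Q \<omega>))"

end

theory Submission
  imports Defs
begin

text \<open>
  Fix a model with localized orthonormal basis \<open>\<phi>\<close>, let \<open>\<xi>\<close> be the residual of its
  projection \<open>s_m\<close>, and for a subsample \<open>I\<close> let \<open>v_I\<close> be the vector of empirical means of
  \<open>\<xi> \<phi>_k\<close> and \<open>G_I\<close> the empirical Gram matrix minus the identity. A least squares estimator
  has coefficients \<open>\<beta>\<close> relative to \<open>s_m\<close> with \<open>(1 + G_I) \<beta> = v_I\<close>. Bernstein's inequality
  for the entries and Schur's test with weights \<open>A_i\<close> to the power \<open>-1/2\<close> give
  \<open>\<parallel>G_I\<parallel> = O(1 / sqrt (ln n))\<close>; this is where \<open>b^2 A_b \<le> C n / (ln n)^2\<close> enters. The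
  squared norm of \<open>v_I\<close> is a diagonal sum plus a degenerate U-statistic, which is a martingale;
  an exponential inequality for martingales with bounded steps shows that it is close to
  \<open>\<C> / |I|\<close> with \<open>\<C> = \<Sum>k. E (\<xi> \<phi>_k)^2\<close>, which is of the order of the dimension.
  Since \<open>v\<close> of the full sample is a convex combination of those of a block and of its complement,
  the scalar products in the V-fold penalty reduce to such norms, and the penalty is close to
  \<open>2 \<C> / n\<close>. Hence both the excess risk and the criterion (up to a common shift) of every model
  are \<open>l(s_0, s_m) + \<C> / n\<close>, up to a relative error \<open>O(1 / sqrt (ln n))\<close> and an additive
  \<open>O((ln n)^3 / n)\<close>.
\<close>

section \<open>Concentration\<close>

text \<open>Why \<open>2 * \<C> / n\<close> is the right penalty: the minimal empirical risk of a
  model lies about \<open>\<C> / n\<close> below that of its projection, the risk of the estimator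
  about as much above it. A fold contributes about \<open>2 * \<C> / (n * (V - 1))\<close>, apart
  from terms that cancel over the folds, and the prefactor \<open>(V - 1) / V\<close> of the sum of
  \<open>V\<close> folds restores \<open>2 * \<C> / n\<close>. The shape of the error comes from the
  off-diagonal part of the squared score norm, which fluctuates by \<open>sqrt D * ln n / n\<close>.
  The arithmetic-geometric mean inequality splits this into \<open>D / (n * sqrt (ln n))\<close> and
  \<open>(ln n)^3 / n\<close>; the first part is a relative error because the noise level bounds
  \<open>\<C>\<close> from below by a multiple of \<open>D\<close>. Since the estimators are
  arbitrary minimizers, probability enters only through empirical vectors and matrices; on the
  resulting event the bounds hold for every minimizer at once. A single number
  \<open>\<kappa>\<close> dominates all constants, and its powers are not optimized.\<close>

lemma with_prob_at_least_mono:
  assumes "with_prob_at_least M p Q" "p' \<le> p" "\<And>\<omega>. \<omega> \<in> space M \<Longrightarrow> Q \<omega> \<Longrightarrow> Q' \<omega>"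
  shows "with_prob_at_least M p' Q'"
proof -
  obtain E where E: "E \<in> sets M" "p \<le> measure M E" "\<forall>\<omega>\<in>E. Q \<omega>"
    using assms(1) unfolding with_prob_at_least_def by auto
  have "\<forall>\<omega>\<in>E. Q' \<omega>" using E sets.sets_into_space[OF E(1)] assms(3) by auto
  then show ?thesis unfolding with_prob_at_least_def using E assms(2) by (intro bexI[of _ E]) auto
qed

text \<open>Only the measurable witnesses inside the two properties are intersected, so the union
  bound applies to properties that need not be measurable themselves.\<close>

lemma (in prob_space) with_prob_at_least_conj:
  assumes "with_prob_at_least M (1 - p) Q" "with_prob_at_least M (1 - p') Q'"
  shows "with_prob_at_least M (1 - (p + p')) (\<lambda>\<omega>. Q \<omega> \<and> Q' \<omega>)"
proof -
  obtain E where E: "E \<in> sets M" "1 - p \<le> prob E" "\<forall>\<omega>\<in>E. Q \<omega>"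
    using assms(1) unfolding with_prob_at_least_def by auto
  obtain F where F: "F \<in> sets M" "1 - p' \<le> prob F" "\<forall>\<omega>\<in>F. Q' \<omega>"
    using assms(2) unfolding with_prob_at_least_def by auto
  have "prob (E \<union> F) = prob E + prob (F - E)" using E F by (intro finite_measure_Union') auto
  moreover have "prob F = prob (E \<inter> F) + prob (F - E)"
    using E F by (subst finite_measure_Union[symmetric]) (auto intro!: arg_cong[where f=prob])
  moreover have "prob (E \<union> F) \<le> 1" by simp
  ultimately have "1 - (p + p') \<le> prob (E \<inter> F)" using E F by linarith
  then show ?thesis unfolding with_prob_at_least_def using E F by (intro bexI[of _ "E \<inter> F"]) auto
qed

lemma (in prob_space) with_prob_at_least_ball:
  assumes "finite S" "\<And>i. i \<in> S \<Longrightarrow> with_prob_at_least M (1 - p) (Q i)"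
  shows "with_prob_at_least M (1 - real (card S) * p) (\<lambda>\<omega>. \<forall>i\<in>S. Q i \<omega>)"
  using assms
proof (induction S)
  case empty
  show ?case unfolding with_prob_at_least_def
    by (intro bexI[of _ "space M"]) (auto simp: prob_space)
next
  case (insert i S)
  have "with_prob_at_least M (1 - (p + real (card S) * p)) (\<lambda>\<omega>. Q i \<omega> \<and> (\<forall>i\<in>S. Q i \<omega>))"
    using insert by (intro with_prob_at_least_conj) auto
  then show ?case using insert(1,2) by (simp add: algebra_simps)
qed

section \<open>Exponential inequality for martingales with bounded steps\<close>

lemma exp_le_one_plus_plus_square:
  fixes x :: real
  assumes "\<bar>x\<bar> \<le> 1"
  shows "exp x \<le> 1 + x + x\<^sup>2"
proof (cases "0 \<le> x")
  case True
  then show ?thesis using exp_bound[of x] assms by auto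
next
  case False
  define y where "y = - x"
  have y: "0 < y" "y \<le> 1" using False assms by (auto simp: y_def)
  have l: "1 + y + y\<^sup>2 / 2 \<le> exp y" using exp_lower_Taylor_quadratic[of y] y by simp
  \<comment> \<open>For \<open>x = - y\<close> the claim amounts to
    \<open>1 \<le> exp y * (1 - y + y\<^sup>2)\<close>, and the quadratic Taylor polynomial of
    \<open>exp y\<close> is already large enough.\<close>
  have "1 \<le> (1 + y + y\<^sup>2 / 2) * (1 - y + y\<^sup>2)"
  proof -
    have "(1 + y + y\<^sup>2 / 2) * (1 - y + y\<^sup>2) = 1 + y\<^sup>2 / 2 + y ^ 3 / 2 + y ^ 4 / 2"
      by (simp add: field_simps power2_eq_square power3_eq_cube power4_eq_xxxx)
    then show ?thesis using y by simp
  qed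
  also have "\<dots> \<le> exp y * (1 - y + y\<^sup>2)"
    using l y by (intro mult_right_mono) auto
  finally have "exp (- y) \<le> 1 - y + y\<^sup>2" by (simp add: exp_minus field_simps)
  then show ?thesis by (simp add: y_def)
qed

text \<open>Bernstein's moment bound in a form without denominator: under
  \<open>\<theta> * b \<le> 1\<close> the exponential is dominated by a quadratic polynomial, whose
  linear term integrates to zero. The integral takes values in \<open>ennreal\<close> so that it can
  be iterated coordinate by coordinate.\<close>

lemma (in prob_space) nn_integral_exp_centered_le:
  fixes f :: "'a \<Rightarrow> real"
  assumes [measurable]: "f \<in> borel_measurable M"
    and "expectation f = 0" "AE x in M. \<bar>f x\<bar> \<le> b" "expectation (\<lambda>x. (f x)\<^sup>2) \<le> w"
    and "0 \<le> \<theta>" "\<theta> * b \<le> 1"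
  shows "(\<integral>\<^sup>+x. ennreal (exp (\<theta> * f x)) \<partial>M) \<le> ennreal (exp (\<theta>\<^sup>2 * w))"
proof -
  have i1: "integrable M f" by (rule integrable_const_bound[of _ b]) (use assms in auto)
  have i2: "integrable M (\<lambda>x. (f x)\<^sup>2)"
  proof (rule integrable_const_bound[of _ "b\<^sup>2"])
    show "AE x in M. norm ((f x)\<^sup>2) \<le> b\<^sup>2"
      using assms(3) by eventually_elim (auto simp: abs_le_square_iff[symmetric])
  qed simp
  have "(\<integral>\<^sup>+x. ennreal (exp (\<theta> * f x)) \<partial>M) \<le> (\<integral>\<^sup>+x. ennreal (1 + \<theta> * f x + \<theta>\<^sup>2 * (f x)\<^sup>2) \<partial>M)"
  proof (rule nn_integral_mono_AE)
    show "AE x in M. ennreal (exp (\<theta> * f x)) \<le> ennreal (1 + \<theta> * f x + \<theta>\<^sup>2 * (f x)\<^sup>2)"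
      using assms(3)
    proof eventually_elim
      case (elim x)
      have "\<bar>\<theta> * f x\<bar> \<le> \<theta> * b" using elim assms(5) by (simp add: abs_mult mult_left_mono)
      then show ?case using exp_le_one_plus_plus_square[of "\<theta> * f x"] assms(6)
        by (intro ennreal_leI) (auto simp: power_mult_distrib)
    qed
  qed
  also have "\<dots> = ennreal (\<integral>x. 1 + \<theta> * f x + \<theta>\<^sup>2 * (f x)\<^sup>2 \<partial>M)"
  proof (rule nn_integral_eq_integral)
    show "integrable M (\<lambda>x. 1 + \<theta> * f x + \<theta>\<^sup>2 * (f x)\<^sup>2)" using i1 i2 by auto
    have "0 \<le> 1 + \<theta> * f x + \<theta>\<^sup>2 * (f x)\<^sup>2" for x
    proof -
      have "1 + \<theta> * f x + \<theta>\<^sup>2 * (f x)\<^sup>2 = (1/2 + \<theta> * f x)\<^sup>2 + 3/4"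
        by (simp add: power2_eq_square algebra_simps)
      then show ?thesis by simp
    qed
    then show "AE x in M. 0 \<le> 1 + \<theta> * f x + \<theta>\<^sup>2 * (f x)\<^sup>2" by simp
  qed
  also have "(\<integral>x. 1 + \<theta> * f x + \<theta>\<^sup>2 * (f x)\<^sup>2 \<partial>M) = 1 + \<theta>\<^sup>2 * expectation (\<lambda>x. (f x)\<^sup>2)"
    using i1 i2 assms(2) by (simp add: prob_space)
  also have "\<dots> \<le> 1 + \<theta>\<^sup>2 * w" using assms(4) by (simp add: mult_left_mono)
  also have "\<dots> \<le> exp (\<theta>\<^sup>2 * w)" by (rule exp_ge_add_one_self)
  finally show ?thesis by (simp add: ennreal_leI)
qed

text \<open>The step \<open>d i\<close> receives the past as a point of the product over
  \<open>{1..<i}\<close>, so conditional expectations given the past are plain integrals over one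
  coordinate. The rate \<open>\<theta>\<close> is a parameter because each application balances
  \<open>\<theta> * n * w\<close> against \<open>t / \<theta>\<close> in its own way.\<close>

locale bounded_martingale = prob_space P for P :: "'z measure" +
  fixes n :: nat and d :: "nat \<Rightarrow> (nat \<Rightarrow> 'z) \<Rightarrow> 'z \<Rightarrow> real" and b w \<theta> :: real
  assumes measurable_step: "\<And>i. i \<in> {1..n} \<Longrightarrow>
      (\<lambda>(\<omega>, z). d i \<omega> z) \<in> borel_measurable (PiM {1..<i} (\<lambda>_. P) \<Otimes>\<^sub>M P)"
    and centered: "\<And>i \<omega>. i \<in> {1..n} \<Longrightarrow> \<omega> \<in> space (PiM {1..<i} (\<lambda>_. P)) \<Longrightarrow> (\<integral>z. d i \<omega> z \<partial>P) = 0"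
    and step_bound: "\<And>i \<omega>. i \<in> {1..n} \<Longrightarrow> \<omega> \<in> space (PiM {1..<i} (\<lambda>_. P)) \<Longrightarrow> AE z in P. \<bar>d i \<omega> z\<bar> \<le> b"
    and variance_bound: "\<And>i \<omega>. i \<in> {1..n} \<Longrightarrow> \<omega> \<in> space (PiM {1..<i} (\<lambda>_. P)) \<Longrightarrow>
      (\<integral>z. (d i \<omega> z)\<^sup>2 \<partial>P) \<le> w"
    and rate: "0 < \<theta>" "\<theta> * b \<le> 1"
begin

definition msum :: "nat \<Rightarrow> (nat \<Rightarrow> 'z) \<Rightarrow> real" where
  "msum k \<omega> = (\<Sum>i=1..k. d i (restrict \<omega> {1..<i}) (\<omega> i))"

lemma measurable_msum:
  assumes "k \<le> n"
  shows "msum k \<in> borel_measurable (PiM {1..k} (\<lambda>_. P))"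
  unfolding msum_def
proof (rule borel_measurable_sum)
  fix i assume i: "i \<in> {1..k}"
  have "(\<lambda>\<omega>. (restrict \<omega> {1..<i}, \<omega> i)) \<in> PiM {1..k} (\<lambda>_. P) \<rightarrow>\<^sub>M PiM {1..<i} (\<lambda>_. P) \<Otimes>\<^sub>M P"
    using i by (intro measurable_Pair measurable_restrict_subset measurable_component_singleton) auto
  from measurable_compose[OF this measurable_step[of i]]
  show "(\<lambda>\<omega>. d i (restrict \<omega> {1..<i}) (\<omega> i)) \<in> borel_measurable (PiM {1..k} (\<lambda>_. P))"
    using i assms by auto
qed

text \<open>The last coordinate is integrated first: the earlier steps do not depend on it, and for
  a fixed past the last factor integrates to at most
  \<open>exp (\<theta>\<^sup>2 * w)\<close>.\<close>

lemma nn_integral_exp_msum_le: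
  assumes "k \<le> n"
  shows "(\<integral>\<^sup>+\<omega>. ennreal (exp (\<theta> * msum k \<omega>)) \<partial>PiM {1..k} (\<lambda>_. P)) \<le> ennreal (exp (\<theta>\<^sup>2 * (real k * w)))"
  using assms
proof (induction k)
  case 0
  have "emeasure (PiM {} (\<lambda>_::nat. P)) (space (PiM {} (\<lambda>_. P))) = 1"
    by (rule prob_space.emeasure_space_1[OF prob_space_PiM]) (rule prob_space_axioms)
  then show ?case by (simp add: msum_def)
next
  case (Suc k)
  interpret pp: product_prob_space "\<lambda>_::nat. P" by unfold_locales
  have ins: "{1..Suc k} = insert (Suc k) {1..k}" by auto
  have ivl: "{1..<Suc k} = {1..k}" by auto
  have [measurable]: "msum k \<in> borel_measurable (PiM {1..k} (\<lambda>_. P))"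
    using Suc by (intro measurable_msum) auto
  have [measurable]: "msum (Suc k) \<in> borel_measurable (PiM (insert (Suc k) {1..k}) (\<lambda>_. P))"
    using measurable_msum[OF Suc.prems] unfolding ins .
  have mS: "(\<lambda>x. ennreal (exp (\<theta> * msum (Suc k) x))) \<in> borel_measurable (PiM (insert (Suc k) {1..k}) (\<lambda>_. P))"
    by measurable
  have "(\<integral>\<^sup>+x. ennreal (exp (\<theta> * msum (Suc k) x)) \<partial>PiM {1..Suc k} (\<lambda>_. P))
     = (\<integral>\<^sup>+x. (\<integral>\<^sup>+z. ennreal (exp (\<theta> * msum (Suc k) (x(Suc k := z)))) \<partial>P) \<partial>PiM {1..k} (\<lambda>_. P))"
    unfolding ins
    by (rule pp.product_nn_integral_insert[OF _ _ mS]) auto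
  also have "\<dots> \<le> (\<integral>\<^sup>+x. ennreal (exp (\<theta> * msum k x)) * ennreal (exp (\<theta>\<^sup>2 * w)) \<partial>PiM {1..k} (\<lambda>_. P))"
  proof (rule nn_integral_mono)
    fix x assume x: "x \<in> space (PiM {1..k} (\<lambda>_. P))"
    have r: "restrict (x(Suc k := z)) {1..<Suc k} = x" for z
      using x by (auto simp: space_PiM fun_eq_iff restrict_def PiE_def extensional_def)
    have e: "msum (Suc k) (x(Suc k := z)) = msum k x + d (Suc k) x z" for z
    proof -
      have "msum (Suc k) (x(Suc k := z)) =
        (\<Sum>i=1..k. d i (restrict (x(Suc k := z)) {1..<i}) ((x(Suc k := z)) i)) + d (Suc k) x z"
        unfolding msum_def using r by (simp del: fun_upd_apply add: fun_upd_same)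
      also have "(\<Sum>i=1..k. d i (restrict (x(Suc k := z)) {1..<i}) ((x(Suc k := z)) i)) = msum k x"
        unfolding msum_def
      proof (rule sum.cong)
        fix i assume i: "i \<in> {1..k}"
        have "restrict (x(Suc k := z)) {1..<i} = restrict x {1..<i}"
          using i by (auto simp: restrict_def fun_eq_iff)
        then show "d i (restrict (x(Suc k := z)) {1..<i}) ((x(Suc k := z)) i) = d i (restrict x {1..<i}) (x i)"
          using i by auto
      qed simp
      finally show ?thesis .
    qed
    have x': "x \<in> space (PiM {1..<Suc k} (\<lambda>_. P))" using x ivl by simp
    have k: "Suc k \<in> {1..n}" using Suc.prems by auto
    have [measurable]: "d (Suc k) x \<in> borel_measurable P"
      using measurable_compose[OF measurable_Pair1'[OF x'] measurable_step[OF k]] by simp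
    have "(\<integral>\<^sup>+z. ennreal (exp (\<theta> * msum (Suc k) (x(Suc k := z)))) \<partial>P)
       = (\<integral>\<^sup>+z. ennreal (exp (\<theta> * msum k x)) * ennreal (exp (\<theta> * d (Suc k) x z)) \<partial>P)"
      by (simp add: e distrib_left exp_add ennreal_mult)
    also have "\<dots> = ennreal (exp (\<theta> * msum k x)) * (\<integral>\<^sup>+z. ennreal (exp (\<theta> * d (Suc k) x z)) \<partial>P)"
      by (rule nn_integral_cmult) measurable
    also have "\<dots> \<le> ennreal (exp (\<theta> * msum k x)) * ennreal (exp (\<theta>\<^sup>2 * w))"
      using centered[OF k x'] step_bound[OF k x'] variance_bound[OF k x'] rate
      by (intro mult_left_mono nn_integral_exp_centered_le[where b=b]) simp_all
    finally show "(\<integral>\<^sup>+z. ennreal (exp (\<theta> * msum (Suc k) (x(Suc k := z)))) \<partial>P)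
        \<le> ennreal (exp (\<theta> * msum k x)) * ennreal (exp (\<theta>\<^sup>2 * w))" .
  qed
  also have "\<dots> = (\<integral>\<^sup>+x. ennreal (exp (\<theta> * msum k x)) \<partial>PiM {1..k} (\<lambda>_. P)) * ennreal (exp (\<theta>\<^sup>2 * w))"
    by (rule nn_integral_multc) measurable
  also have "\<dots> \<le> ennreal (exp (\<theta>\<^sup>2 * (real k * w))) * ennreal (exp (\<theta>\<^sup>2 * w))"
    using Suc by (intro mult_right_mono) auto
  also have "\<dots> = ennreal (exp (\<theta>\<^sup>2 * (real (Suc k) * w)))"
    by (simp add: ennreal_mult[symmetric] exp_add[symmetric] algebra_simps)
  finally show ?case .
qed

lemma msum_upper_tail:
  "with_prob_at_least (PiM {1..n} (\<lambda>_. P)) (1 - exp (- t)) (\<lambda>\<omega>. msum n \<omega> \<le> \<theta> * (real n * w) + t / \<theta>)"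
proof -
  let ?M = "PiM {1..n} (\<lambda>_. P)"
  interpret S: prob_space ?M by (rule prob_space_PiM) (rule prob_space_axioms)
  have [measurable]: "msum n \<in> borel_measurable ?M" by (rule measurable_msum) simp
  \<comment> \<open>The level at which Markov's inequality for
    \<open>exp (\<theta> * msum n \<omega>)\<close> yields exactly \<open>exp (- t)\<close>.\<close>
  define u where "u = \<theta> * (real n * w) + t / \<theta>"
  define F where "F = {\<omega>\<in>space ?M. u < msum n \<omega>}"
  have F[measurable]: "F \<in> sets ?M" unfolding F_def by measurable
  have "ennreal (exp (\<theta> * u)) * emeasure ?M F = (\<integral>\<^sup>+\<omega>. ennreal (exp (\<theta> * u)) * indicator F \<omega> \<partial>?M)"
    by (rule nn_integral_cmult_indicator[symmetric]) measurable
  also have "\<dots> \<le> (\<integral>\<^sup>+\<omega>. ennreal (exp (\<theta> * msum n \<omega>)) \<partial>?M)"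
    using rate by (intro nn_integral_mono) (auto simp: F_def indicator_def intro!: ennreal_leI)
  also have "\<dots> \<le> ennreal (exp (\<theta>\<^sup>2 * (real n * w)))"
    by (rule nn_integral_exp_msum_le) simp
  finally have "exp (\<theta> * u) * S.prob F \<le> exp (\<theta>\<^sup>2 * (real n * w))"
    unfolding S.emeasure_eq_measure by (simp add: ennreal_mult[symmetric])
  moreover have "exp (\<theta>\<^sup>2 * (real n * w)) = exp (\<theta> * u) * exp (- t)"
    using rate by (simp add: u_def exp_add[symmetric] power2_eq_square algebra_simps)
  ultimately have "S.prob F \<le> exp (- t)" by simp
  then have "1 - exp (- t) \<le> S.prob (space ?M - F)" unfolding S.prob_compl[OF F] by simp
  then show ?thesis unfolding with_prob_at_least_def
    using sets.compl_sets[OF F] by (intro bexI[of _ "space ?M - F"]) (auto simp: F_def u_def not_less)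
qed

lemma msum_two_sided:
  "with_prob_at_least (PiM {1..n} (\<lambda>_. P)) (1 - 2 * exp (- t))
     (\<lambda>\<omega>. \<bar>\<Sum>i=1..n. d i (restrict \<omega> {1..<i}) (\<omega> i)\<bar> \<le> \<theta> * (real n * w) + t / \<theta>)"
proof -
  interpret S: prob_space "PiM {1..n} (\<lambda>_. P)" by (rule prob_space_PiM) (rule prob_space_axioms)
  interpret neg: bounded_martingale P n "\<lambda>i \<omega> z. - d i \<omega> z" b w \<theta>
    using measurable_step centered step_bound variance_bound rate
    by unfold_locales (auto simp: case_prod_beta')
  have "neg.msum n = (\<lambda>\<omega>. - msum n \<omega>)"
    by (auto simp: neg.msum_def msum_def sum_negf)
  with S.with_prob_at_least_conj[OF msum_upper_tail[of t] neg.msum_upper_tail[of t]]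
  show ?thesis
    by (elim with_prob_at_least_mono) (auto simp: msum_def abs_le_iff)
qed

end

text \<open>A subsample is treated as a martingale on the full product space whose steps outside
  \<open>I\<close> vanish. All events then live on one space, at the price of \<open>n * w\<close>
  in place of \<open>card I * w\<close>.\<close>

lemma (in prob_space) iid_sum_concentration:
  fixes f :: "'a \<Rightarrow> real"
  assumes [measurable]: "f \<in> borel_measurable M"
    and "expectation f = 0" "AE x in M. \<bar>f x\<bar> \<le> b" "expectation (\<lambda>x. (f x)\<^sup>2) \<le> w"
    and "0 < \<theta>" "\<theta> * b \<le> 1" and "I \<subseteq> {1..n}"
  shows "with_prob_at_least (PiM {1..n} (\<lambda>_. M)) (1 - 2 * exp (- t))
     (\<lambda>\<omega>. \<bar>\<Sum>i\<in>I. f (\<omega> i)\<bar> \<le> \<theta> * (real n * w) + t / \<theta>)"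
proof -
  have b: "0 \<le> b"
  proof -
    have "AE x in M. 0 \<le> b" using assms(3) by eventually_elim auto
    then show ?thesis by simp
  qed
  have w: "0 \<le> w" using assms(4) by (rule order_trans[rotated]) simp
  interpret B: bounded_martingale M n "\<lambda>i \<omega> z. if i \<in> I then f z else 0" b w \<theta>
  proof unfold_locales
    fix i :: nat
    show "(\<lambda>(\<omega>, z). if i \<in> I then f z else 0) \<in> borel_measurable (PiM {1..<i} (\<lambda>_. M) \<Otimes>\<^sub>M M)"
      by measurable
    show "(\<integral>z. (if i \<in> I then f z else 0) \<partial>M) = 0"
      using assms(2) by (cases "i \<in> I") simp_all
    show "AE z in M. \<bar>if i \<in> I then f z else 0\<bar> \<le> b"
      using assms(3) b by (cases "i \<in> I") simp_all
    show "(\<integral>z. (if i \<in> I then f z else 0)\<^sup>2 \<partial>M) \<le> w"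
      using assms(4) w by (cases "i \<in> I") simp_all
  qed (use assms in simp_all)
  have "(\<Sum>i=1..n. if i \<in> I then f (\<omega> i) else 0) = (\<Sum>i\<in>I. f (\<omega> i))" for \<omega>
    using assms(7) by (simp add: sum.If_cases Int_absorb1)
  then show ?thesis using B.msum_two_sided[of t] by simp
qed

section \<open>Strongly localized families\<close>

declare One_nat_def [simp del]

text \<open>Ordering the indices gives the off-diagonal part the form of a martingale: the i-th term
  is linear in \<open>g i\<close> with a coefficient built from earlier indices.\<close>

lemma power2_sum_eq_diag_plus_lower:
  fixes g :: "nat \<Rightarrow> real"
  shows "(\<Sum>i=1..n. g i)\<^sup>2 = (\<Sum>i=1..n. (g i)\<^sup>2) + 2 * (\<Sum>i=1..n. g i * (\<Sum>j=1..<i. g j))"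
proof (induction n)
  case (Suc n)
  have "(\<Sum>i=1..Suc n. g i)\<^sup>2 = (\<Sum>i=1..n. g i)\<^sup>2 + (g (Suc n))\<^sup>2 + 2 * (g (Suc n) * (\<Sum>i=1..n. g i))"
    by (simp add: power2_sum)
  moreover have "{1..<Suc n} = {1..n}" by auto
  moreover have "(\<Sum>i=1..Suc n. (g i)\<^sup>2) = (\<Sum>i=1..n. (g i)\<^sup>2) + (g (Suc n))\<^sup>2" by simp
  moreover have "(\<Sum>i=1..Suc n. g i * (\<Sum>j=1..<i. g j))
      = (\<Sum>i=1..n. g i * (\<Sum>j=1..<i. g j)) + g (Suc n) * (\<Sum>j=1..n. g j)"
    using \<open>{1..<Suc n} = {1..n}\<close> by simp
  ultimately show ?case using Suc by (simp only: distrib_left)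
qed simp

text \<open>Cauchy-Schwarz with \<open>\<bar>h k j\<bar>\<close> split into a factor weighted by
  \<open>s k / s j\<close> and one weighted by the inverse ratio. The first gives a row sum; after
  exchanging the sums, symmetry turns the second into a row sum as well, so one hypothesis covers
  rows and columns.\<close>

lemma schur_test:
  fixes h :: "'i \<Rightarrow> 'i \<Rightarrow> real"
  assumes sym: "\<And>k j. k \<in> S \<Longrightarrow> j \<in> S \<Longrightarrow> h k j = h j k"
    and pos: "\<And>k. k \<in> S \<Longrightarrow> 0 < s k"
    and row: "\<And>k. k \<in> S \<Longrightarrow> (\<Sum>j\<in>S. \<bar>h k j\<bar> * (s k / s j)) \<le> \<delta>"
    and "0 \<le> \<delta>"
  shows "(\<Sum>k\<in>S. (\<Sum>j\<in>S. h k j * \<beta> j)\<^sup>2) \<le> \<delta>\<^sup>2 * (\<Sum>j\<in>S. (\<beta> j)\<^sup>2)"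
proof -
  have "(\<Sum>j\<in>S. h k j * \<beta> j)\<^sup>2 \<le> \<delta> * (\<Sum>j\<in>S. \<bar>h k j\<bar> * (s j / s k) * (\<beta> j)\<^sup>2)" if k: "k \<in> S" for k
  proof -
    define A where "A j = sqrt (\<bar>h k j\<bar> * (s k / s j))" for j
    define B where "B j = sqrt (\<bar>h k j\<bar> * (s j / s k)) * \<bar>\<beta> j\<bar>" for j
    have AB: "A j * B j = \<bar>h k j * \<beta> j\<bar>" if "j \<in> S" for j
      using pos[OF k] pos[OF that] by (simp add: A_def B_def real_sqrt_mult[symmetric] abs_mult)
    have "\<bar>\<Sum>j\<in>S. h k j * \<beta> j\<bar> \<le> (\<Sum>j\<in>S. A j * B j)"
      using AB by (subst sum.cong[OF refl AB]) (auto intro: sum_abs)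
    then have "(\<Sum>j\<in>S. h k j * \<beta> j)\<^sup>2 \<le> (\<Sum>j\<in>S. A j * B j)\<^sup>2"
      by (metis abs_ge_zero power2_abs power_mono)
    also have "\<dots> \<le> (\<Sum>j\<in>S. (A j)\<^sup>2) * (\<Sum>j\<in>S. (B j)\<^sup>2)"
      by (rule Cauchy_Schwarz_ineq_sum)
    also have "(\<Sum>j\<in>S. (A j)\<^sup>2) = (\<Sum>j\<in>S. \<bar>h k j\<bar> * (s k / s j))"
      unfolding A_def using pos[OF k] pos by (intro sum.cong refl real_sqrt_pow2) (simp add: less_imp_le)
    also have "(\<Sum>j\<in>S. (B j)\<^sup>2) = (\<Sum>j\<in>S. \<bar>h k j\<bar> * (s j / s k) * (\<beta> j)\<^sup>2)"
      unfolding B_def power_mult_distrib power2_abs using pos[OF k] pos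
      by (intro sum.cong refl arg_cong2[where f="(*)"] real_sqrt_pow2) (simp add: less_imp_le)
    also have "(\<Sum>j\<in>S. \<bar>h k j\<bar> * (s k / s j)) * \<dots> \<le> \<delta> * \<dots>"
      using pos[OF k] pos by (intro mult_right_mono row k sum_nonneg) (simp add: less_imp_le)
    finally show ?thesis .
  qed
  then have "(\<Sum>k\<in>S. (\<Sum>j\<in>S. h k j * \<beta> j)\<^sup>2) \<le> (\<Sum>k\<in>S. \<delta> * (\<Sum>j\<in>S. \<bar>h k j\<bar> * (s j / s k) * (\<beta> j)\<^sup>2))"
    by (intro sum_mono)
  also have "\<dots> = \<delta> * (\<Sum>j\<in>S. (\<Sum>k\<in>S. \<bar>h j k\<bar> * (s j / s k)) * (\<beta> j)\<^sup>2)"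
    unfolding sum_distrib_left[symmetric] sum_distrib_right
    by (subst sum.swap) (auto simp: sym intro!: arg_cong2[where f="(*)"] sum.cong)
  also have "\<dots> \<le> \<delta> * (\<Sum>j\<in>S. \<delta> * (\<beta> j)\<^sup>2)"
    using \<open>0 \<le> \<delta>\<close> by (intro mult_left_mono sum_mono mult_right_mono row) auto
  also have "\<dots> = \<delta>\<^sup>2 * (\<Sum>j\<in>S. (\<beta> j)\<^sup>2)"
    by (simp add: sum_distrib_left power2_eq_square mult.assoc)
  finally show ?thesis .
qed

text \<open>Here \<open>l\<close> stands for \<open>ln n\<close> and \<open>a k\<close> for the
  constant of the group containing \<open>k\<close>. The groups themselves are gone: what remains of
  them are the bounds on \<open>a\<close>, on single functions, on their absolute sum, and
  \<open>overlap\<close>. The latter is a row sum in Schur's test, with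
  \<open>sqrt (min (a k) (a j))\<close> the scale of the standard deviation of a Gram entry.\<close>

locale localized_family = prob_space P for P :: "'z measure" +
  fixes n :: nat and \<kappa> l :: real and D :: nat
    and \<phi> :: "nat \<Rightarrow> 'z \<Rightarrow> real" and \<xi> :: "'z \<Rightarrow> real" and a :: "nat \<Rightarrow> real"
  assumes kappa: "1 \<le> \<kappa>" and l: "1 \<le> l" "l \<le> real n" and D: "1 \<le> D"
    and phi_measurable[measurable]: "\<And>k. k \<in> {1..D} \<Longrightarrow> \<phi> k \<in> borel_measurable P"
    and xi_measurable[measurable]: "\<xi> \<in> borel_measurable P"
    and a_pos: "\<And>k. k \<in> {1..D} \<Longrightarrow> 0 < a k"
    and a_le: "\<And>k. k \<in> {1..D} \<Longrightarrow> a k \<le> \<kappa> * real n / l\<^sup>2"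
    and phi_bound: "\<And>k z. k \<in> {1..D} \<Longrightarrow> z \<in> space P \<Longrightarrow> \<bar>\<phi> k z\<bar> \<le> \<kappa> * sqrt (a k)"
    and orthonormal: "\<And>k j. k \<in> {1..D} \<Longrightarrow> j \<in> {1..D} \<Longrightarrow>
          (\<integral>z. \<phi> k z * \<phi> j z \<partial>P) = (if k = j then 1 else 0)"
    and xi_bound: "AE z in P. \<bar>\<xi> z\<bar> \<le> 2 * \<kappa>"
    and xi_orth: "\<And>k. k \<in> {1..D} \<Longrightarrow> (\<integral>z. \<xi> z * \<phi> k z \<partial>P) = 0"
    and sum_abs_phi: "\<And>z. z \<in> space P \<Longrightarrow> (\<Sum>k=1..D. \<bar>\<phi> k z\<bar>) \<le> \<kappa> ^ 3 * sqrt (real D)"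
    and overlap: "\<And>k. k \<in> {1..D} \<Longrightarrow>
          (\<Sum>j | j \<in> {1..D} \<and> (\<exists>z\<in>space P. \<phi> k z \<noteq> 0 \<and> \<phi> j z \<noteq> 0).
             sqrt (min (a k) (a j)) * sqrt (a k / a j)) \<le> \<kappa> * (sqrt (\<kappa> * real n) / l)"
begin

lemma n_pos: "0 < real n" using l by linarith

lemma phi_integrable_mult [intro]:
  assumes "k \<in> {1..D}" "j \<in> {1..D}"
  shows "integrable P (\<lambda>z. \<phi> k z * \<phi> j z)"
proof (rule integrable_const_bound)
  show "AE z in P. norm (\<phi> k z * \<phi> j z) \<le> (\<kappa> * sqrt (a k)) * (\<kappa> * sqrt (a j))"
    using assms phi_bound kappa a_pos[OF assms(1)]
    by (intro AE_I2) (auto simp: abs_mult intro!: mult_mono)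
qed (use assms in measurable)

text \<open>The size that partial sums of \<open>\<xi> * \<phi> k\<close> exceed only with small
  probability; it serves as clipping level.\<close>

definition "\<tau> = 4 * \<kappa> ^ 4 * sqrt (real n * l)"

lemma tau_nonneg: "0 \<le> \<tau>" using kappa l by (simp add: \<tau>_def)

lemma xi_bound_space: "AE z in P. z \<in> space P \<and> \<bar>\<xi> z\<bar> \<le> 2 * \<kappa>"
  using xi_bound AE_space by eventually_elim auto

lemma xi_mult_bound:
  assumes "\<And>z. z \<in> space P \<Longrightarrow> \<bar>g z\<bar> \<le> c"
  shows "AE z in P. \<bar>\<xi> z * g z\<bar> \<le> 2 * \<kappa> * c"
  using xi_bound_space
proof eventually_elim
  case (elim z)
  then show ?case using assms[of z] kappa by (auto simp: abs_mult intro!: mult_mono)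
qed

lemma xi_mult_variance:
  assumes "integrable P (\<lambda>z. (g z)\<^sup>2)"
  shows "(\<integral>z. (\<xi> z * g z)\<^sup>2 \<partial>P) \<le> 4 * \<kappa>\<^sup>2 * (\<integral>z. (g z)\<^sup>2 \<partial>P)"
proof -
  have "(\<integral>z. (\<xi> z * g z)\<^sup>2 \<partial>P) \<le> (\<integral>z. 4 * \<kappa>\<^sup>2 * (g z)\<^sup>2 \<partial>P)"
  proof (rule integral_mono_AE')
    show "AE z in P. (\<xi> z * g z)\<^sup>2 \<le> 4 * \<kappa>\<^sup>2 * (g z)\<^sup>2"
      using xi_bound
    proof eventually_elim
      case (elim z)
      have "(\<xi> z)\<^sup>2 \<le> (2 * \<kappa>)\<^sup>2" using elim kappa by (subst abs_le_square_iff[symmetric]) auto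
      then show ?case by (simp add: power_mult_distrib mult_right_mono)
    qed
  qed (use assms in auto)
  then show ?thesis by simp
qed

lemma xi_phi_integrable [intro]: "k \<in> {1..D} \<Longrightarrow> integrable P (\<lambda>z. \<xi> z * \<phi> k z)"
  using xi_mult_bound[of "\<phi> k", OF phi_bound[of k]]
  by (intro integrable_const_bound[of _ "2 * \<kappa> * (\<kappa> * sqrt (a k))"]) auto

text \<open>Parseval's identity. It evaluates the conditional variances of the off-diagonal
  martingale, whose coefficients \<open>c k\<close> are fixed once the past is fixed.\<close>

lemma combination_variance:
  shows "integrable P (\<lambda>z. (\<Sum>k=1..D. \<phi> k z * c k)\<^sup>2)"
    and "(\<integral>z. (\<Sum>k=1..D. \<phi> k z * c k)\<^sup>2 \<partial>P) = (\<Sum>k=1..D. (c k)\<^sup>2)"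
proof -
  have e: "(\<Sum>k=1..D. \<phi> k z * c k)\<^sup>2 = (\<Sum>k=1..D. \<Sum>j=1..D. (\<phi> k z * \<phi> j z) * (c k * c j))" for z
    by (simp add: power2_eq_square sum_product mult.commute mult.left_commute)
  show "integrable P (\<lambda>z. (\<Sum>k=1..D. \<phi> k z * c k)\<^sup>2)"
    unfolding e by (intro Bochner_Integration.integrable_sum integrable_mult_left phi_integrable_mult)
  have "(\<integral>z. (\<Sum>k=1..D. \<phi> k z * c k)\<^sup>2 \<partial>P)
      = (\<Sum>k=1..D. \<Sum>j=1..D. (\<integral>z. (\<phi> k z * \<phi> j z) * (c k * c j) \<partial>P))"
    unfolding e
    by (subst Bochner_Integration.integral_sum,
        intro Bochner_Integration.integrable_sum integrable_mult_left phi_integrable_mult)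
      (auto intro!: sum.cong Bochner_Integration.integral_sum integrable_mult_left phi_integrable_mult
        simp del: integral_mult_left_zero integral_mult_left)
  also have "\<dots> = (\<Sum>k=1..D. \<Sum>j=1..D. (if k = j then c k * c j else 0))"
    using orthonormal by (intro sum.cong refl) auto
  also have "\<dots> = (\<Sum>k=1..D. (c k)\<^sup>2)"
    by (simp add: power2_eq_square)
  finally show "(\<integral>z. (\<Sum>k=1..D. \<phi> k z * c k)\<^sup>2 \<partial>P) = (\<Sum>k=1..D. (c k)\<^sup>2)" .
qed

lemma coordinate_concentration:
  assumes "k \<in> {1..D}" "J \<subseteq> {1..n}" "t \<le> \<kappa> * l"
  shows "with_prob_at_least (PiM {1..n} (\<lambda>_. P)) (1 - 2 * exp (- t))
     (\<lambda>\<omega>. \<bar>\<Sum>i\<in>J. \<xi> (\<omega> i) * \<phi> k (\<omega> i)\<bar> \<le> \<tau>)"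
proof -
  define s where "s = sqrt (real n * l)"
  have s: "0 < s" "s * s = real n * l" using n_pos l by (auto simp: s_def)
  \<comment> \<open>Both the variance term and \<open>t / \<theta>\<close> become multiples of
    \<open>s\<close>. The factor \<open>2 * \<kappa> ^ 3\<close> reduces
    \<open>\<theta> * b \<le> 1\<close> to \<open>s * sqrt (a k) \<le> \<kappa> * n\<close>, which
    follows from the bound on \<open>a k\<close>.\<close>
  define \<theta> where "\<theta> = s / (2 * \<kappa> ^ 3 * real n)"
  have th: "0 < \<theta>" using kappa s n_pos by (simp add: \<theta>_def)
  note [measurable] = phi_measurable[OF assms(1)]
  have "s * sqrt (a k) = sqrt (real n * l * a k)" by (simp add: s_def real_sqrt_mult)
  also have "\<dots> \<le> \<kappa> * real n"
  proof (rule real_le_lsqrt)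
    have "real n * l * a k \<le> real n * l * (\<kappa> * real n / l\<^sup>2)"
      using a_le[OF assms(1)] n_pos l by (intro mult_left_mono) auto
    also have "\<dots> = \<kappa> * (real n)\<^sup>2 / l" using l by (simp add: power2_eq_square)
    also have "\<dots> \<le> \<kappa> * (real n)\<^sup>2" using l kappa by (simp add: divide_le_eq mult_left_le)
    also have "\<dots> \<le> \<kappa>\<^sup>2 * (real n)\<^sup>2" using kappa by (intro mult_right_mono self_le_power) auto
    finally show "real n * l * a k \<le> (\<kappa> * real n)\<^sup>2" by (simp add: power_mult_distrib)
  qed (use kappa in auto)
  finally have sa: "s * sqrt (a k) \<le> \<kappa> * real n" .
  have "with_prob_at_least (PiM {1..n} (\<lambda>_. P)) (1 - 2 * exp (- t))
     (\<lambda>\<omega>. \<bar>\<Sum>i\<in>J. \<xi> (\<omega> i) * \<phi> k (\<omega> i)\<bar> \<le> \<theta> * (real n * (4 * \<kappa>\<^sup>2)) + t / \<theta>)"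
  proof (rule iid_sum_concentration[where f="\<lambda>z. \<xi> z * \<phi> k z"])
    show "(\<integral>z. \<xi> z * \<phi> k z \<partial>P) = 0" by (rule xi_orth) fact
    show "AE z in P. \<bar>\<xi> z * \<phi> k z\<bar> \<le> 2 * \<kappa> * (\<kappa> * sqrt (a k))"
      by (rule xi_mult_bound) (rule phi_bound[OF assms(1)])
    show "(\<integral>z. (\<xi> z * \<phi> k z)\<^sup>2 \<partial>P) \<le> 4 * \<kappa>\<^sup>2"
      using xi_mult_variance[of "\<phi> k"] phi_integrable_mult[OF assms(1,1)] orthonormal[OF assms(1,1)]
      by (simp add: power2_eq_square)
    have "\<theta> * (2 * \<kappa> * (\<kappa> * sqrt (a k))) = (s * sqrt (a k)) / (\<kappa> * real n)"
      using kappa n_pos by (simp add: \<theta>_def field_simps power3_eq_cube)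
    also have "\<dots> \<le> 1" using sa kappa n_pos by simp
    finally show "\<theta> * (2 * \<kappa> * (\<kappa> * sqrt (a k))) \<le> 1" .
  qed (use th assms(2) in auto)
  moreover have "\<theta> * (real n * (4 * \<kappa>\<^sup>2)) + t / \<theta> \<le> \<tau>"
  proof -
    have "\<theta> * (real n * (4 * \<kappa>\<^sup>2)) = 2 * s / \<kappa>"
      using kappa n_pos by (simp add: \<theta>_def field_simps power3_eq_cube power2_eq_square)
    also have "\<dots> \<le> 2 * \<kappa> ^ 4 * s"
    proof -
      have "1 / \<kappa> \<le> 1" using kappa by simp
      also have "1 \<le> \<kappa> ^ 4" using kappa by simp
      finally show ?thesis using s mult_left_mono[of "1 / \<kappa>" "\<kappa> ^ 4" "2 * s"] by (simp add: ac_simps)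
    qed
    finally have 1: "\<theta> * (real n * (4 * \<kappa>\<^sup>2)) \<le> 2 * \<kappa> ^ 4 * s" .
    have "t / \<theta> \<le> \<kappa> * l / \<theta>" using assms(3) th by (simp add: divide_right_mono)
    also have "\<dots> = 2 * \<kappa> ^ 4 * (l * real n) / s"
      using s by (simp add: \<theta>_def field_simps power3_eq_cube power4_eq_xxxx)
    also have "\<dots> = 2 * \<kappa> ^ 4 * s" using s by (simp add: field_simps)
    finally have "t / \<theta> \<le> 2 * \<kappa> ^ 4 * s" .
    moreover have "\<tau> = 4 * \<kappa> ^ 4 * s" by (simp add: \<tau>_def s_def)
    ultimately show ?thesis using 1 by linarith
  qed
  ultimately show ?thesis by (elim with_prob_at_least_mono) auto
qed

section \<open>Squared norm of the score vector: off-diagonal and diagonal part\<close>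

definition clip :: "real \<Rightarrow> real" where "clip x = max (- \<tau>) (min \<tau> x)"

lemma clip_measurable[measurable]: "clip \<in> borel_measurable borel"
  unfolding clip_def by measurable

lemma abs_clip_le: "\<bar>clip x\<bar> \<le> \<tau>" using tau_nonneg by (auto simp: clip_def)

lemma clip_id: "\<bar>x\<bar> \<le> \<tau> \<Longrightarrow> clip x = x" by (auto simp: clip_def)

text \<open>
  Clipping the partial sums keeps the martingale differences bounded everywhere; by
  \<open>coordinate_concentration\<close> it is inactive with high probability.
\<close>

lemma clipped_chaos_concentration:
  assumes "I \<subseteq> {1..n}" "t \<le> \<kappa> * l"
  shows "with_prob_at_least (PiM {1..n} (\<lambda>_. P)) (1 - 2 * exp (- t))
     (\<lambda>\<omega>. \<bar>\<Sum>i\<in>I. \<xi> (\<omega> i) * (\<Sum>k=1..D. \<phi> k (\<omega> i) * clip (\<Sum>j\<in>I \<inter> {1..<i}. \<xi> (\<omega> j) * \<phi> k (\<omega> j)))\<bar>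
        \<le> 16 * \<kappa> ^ 9 * (sqrt (real D) * (real n * l)))"
proof -
  \<comment> \<open>The total variance is of order \<open>D * n^2 * l\<close> by Parseval, so this
    rate brings both terms of the tail bound to the order \<open>sqrt D * n * l\<close>. Since the
    steps are of order \<open>sqrt D * sqrt (n * l)\<close>, the constraint on
    \<open>\<theta>\<close> reduces to \<open>l \<le> n\<close>.\<close>
  define \<theta> where "\<theta> = 1 / (8 * \<kappa> ^ 8 * real n * sqrt (real D))"
  have th: "0 < \<theta>" using kappa n_pos D by (simp add: \<theta>_def)
  define c where "c k i \<omega> = clip (\<Sum>j\<in>I \<inter> {1..<i}. \<xi> (\<omega> j) * \<phi> k (\<omega> j))" for k i \<omega>
  define d where "d i \<omega> z = (if i \<in> I then \<xi> z * (\<Sum>k=1..D. \<phi> k z * c k i \<omega>) else 0)" for i \<omega> z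
  let ?b = "2 * \<kappa> * (\<kappa> ^ 3 * sqrt (real D) * \<tau>)" and ?w = "4 * \<kappa>\<^sup>2 * (real D * \<tau>\<^sup>2)"
  interpret B: bounded_martingale P n d ?b ?w \<theta>
  proof unfold_locales
    fix i :: nat and \<omega>
    assume i: "i \<in> {1..n}"
    have "c k i \<in> borel_measurable (PiM {1..<i} (\<lambda>_. P))" if "k \<in> {1..D}" for k
    proof -
      note [measurable] = phi_measurable[OF that]
      have "(\<lambda>\<omega>. \<Sum>j\<in>I \<inter> {1..<i}. \<xi> (\<omega> j) * \<phi> k (\<omega> j)) \<in> borel_measurable (PiM {1..<i} (\<lambda>_. P))"
      proof (rule borel_measurable_sum)
        fix j assume "j \<in> I \<inter> {1..<i}"
        then have [measurable]: "(\<lambda>\<omega>. \<omega> j) \<in> PiM {1..<i} (\<lambda>_. P) \<rightarrow>\<^sub>M P"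
          by (intro measurable_component_singleton) auto
        show "(\<lambda>\<omega>. \<xi> (\<omega> j) * \<phi> k (\<omega> j)) \<in> borel_measurable (PiM {1..<i} (\<lambda>_. P))"
          by measurable
      qed
      then show ?thesis unfolding c_def by measurable
    qed
    note [measurable] = this phi_measurable
    have "(\<lambda>(\<omega>, z). \<Sum>k=1..D. \<phi> k z * c k i \<omega>) \<in> borel_measurable (PiM {1..<i} (\<lambda>_. P) \<Otimes>\<^sub>M P)"
      unfolding case_prod_beta by (rule borel_measurable_sum) measurable
    then show "(\<lambda>(\<omega>, z). d i \<omega> z) \<in> borel_measurable (PiM {1..<i} (\<lambda>_. P) \<Otimes>\<^sub>M P)"
      unfolding d_def case_prod_beta by measurable
    \<comment> \<open>The coefficients are controlled only one by one, so the bound needs the sum of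
      the \<open>\<bar>\<phi> k z\<bar>\<close>; localization keeps it at the order
      \<open>sqrt D\<close>.\<close>
    have s: "\<bar>\<Sum>k=1..D. \<phi> k z * c k i \<omega>\<bar> \<le> \<kappa> ^ 3 * sqrt (real D) * \<tau>" if "z \<in> space P" for z
    proof -
      have "\<bar>\<Sum>k=1..D. \<phi> k z * c k i \<omega>\<bar> \<le> (\<Sum>k=1..D. \<bar>\<phi> k z * c k i \<omega>\<bar>)" by (rule sum_abs)
      also have "\<dots> \<le> (\<Sum>k=1..D. \<bar>\<phi> k z\<bar> * \<tau>)"
        by (auto simp: abs_mult c_def intro!: sum_mono mult_left_mono abs_clip_le)
      also have "\<dots> \<le> (\<kappa> ^ 3 * sqrt (real D)) * \<tau>"
        unfolding sum_distrib_right[symmetric] using tau_nonneg sum_abs_phi[OF that] by (intro mult_right_mono)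
      finally show ?thesis .
    qed
    have "0 \<le> ?b" using kappa tau_nonneg by auto
    moreover have "AE z in P. \<bar>\<xi> z * (\<Sum>k=1..D. \<phi> k z * c k i \<omega>)\<bar> \<le> ?b"
      by (rule xi_mult_bound) (rule s)
    ultimately show "AE z in P. \<bar>d i \<omega> z\<bar> \<le> ?b" by (cases "i \<in> I") (auto simp: d_def)
    have "(\<integral>z. \<xi> z * (\<Sum>k=1..D. \<phi> k z * c k i \<omega>) \<partial>P) = (\<integral>z. (\<Sum>k=1..D. (\<xi> z * \<phi> k z) * c k i \<omega>) \<partial>P)"
      by (simp add: sum_distrib_left mult.assoc)
    also have "\<dots> = (\<Sum>k=1..D. (\<integral>z. (\<xi> z * \<phi> k z) * c k i \<omega> \<partial>P))"
      by (rule Bochner_Integration.integral_sum) (auto intro!: integrable_mult_left xi_phi_integrable)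
    also have "\<dots> = 0" using xi_orth by (intro sum.neutral) auto
    finally show "(\<integral>z. d i \<omega> z \<partial>P) = 0" by (cases "i \<in> I") (auto simp: d_def)
    have "(\<integral>z. (\<xi> z * (\<Sum>k=1..D. \<phi> k z * c k i \<omega>))\<^sup>2 \<partial>P) \<le> 4 * \<kappa>\<^sup>2 * (\<Sum>k=1..D. (c k i \<omega>)\<^sup>2)"
      using xi_mult_variance[OF combination_variance(1)[of "\<lambda>k. c k i \<omega>"]]
      unfolding combination_variance(2) .
    also have "(\<Sum>k=1..D. (c k i \<omega>)\<^sup>2) \<le> (\<Sum>k=1..D. \<tau>\<^sup>2)"
    proof (rule sum_mono)
      fix k
      show "(c k i \<omega>)\<^sup>2 \<le> \<tau>\<^sup>2"
        using power_mono[OF abs_clip_le abs_ge_zero, of _ 2] by (simp add: c_def)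
    qed
    finally have "(\<integral>z. (\<xi> z * (\<Sum>k=1..D. \<phi> k z * c k i \<omega>))\<^sup>2 \<partial>P) \<le> ?w"
      by (simp add: mult_left_mono)
    moreover have "0 \<le> ?w" by simp
    ultimately show "(\<integral>z. (d i \<omega> z)\<^sup>2 \<partial>P) \<le> ?w" by (cases "i \<in> I") (auto simp: d_def)
  next
    show "0 < \<theta>" by fact
    have "2 * \<kappa> * (\<kappa> ^ 3 * q * (4 * \<kappa> ^ 4 * s)) = 8 * \<kappa> ^ 8 * q * s" for q s
      by (simp add: eval_nat_numeral One_nat_def)
    then have "?b = 8 * \<kappa> ^ 8 * sqrt (real D) * sqrt (real n * l)"
      unfolding \<tau>_def by blast
    moreover have "1 / (8 * \<kappa> ^ 8 * real n * q) * (8 * \<kappa> ^ 8 * q * s) = s / real n" if "0 < q" for q s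
      using kappa n_pos that by simp
    ultimately have "\<theta> * ?b = sqrt (real n * l) / real n"
      unfolding \<theta>_def using D kappa by simp
    also have "\<dots> \<le> sqrt (real n * real n) / real n"
      using l n_pos by (intro divide_right_mono real_sqrt_le_mono mult_left_mono) auto
    finally show "\<theta> * ?b \<le> 1" using n_pos by simp
  qed
  have "\<theta> * (real n * ?w) + t / \<theta> \<le> 16 * \<kappa> ^ 9 * (sqrt (real D) * (real n * l))"
  proof -
    define q where "q = sqrt (real D)"
    have q: "0 < q" "real D = q * q" using D by (auto simp: q_def)
    have "\<tau>\<^sup>2 = 16 * \<kappa> ^ 8 * (real n * l)"
      using l by (simp add: \<tau>_def power_mult_distrib)
    moreover have "N * (4 * \<kappa>\<^sup>2 * (q * q * (16 * \<kappa> ^ 8 * (N * s)))) =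
        (8 * \<kappa> ^ 8 * N * q) * (8 * \<kappa>\<^sup>2 * (q * (N * s)))" for N s
      by (simp add: eval_nat_numeral One_nat_def)
    ultimately have w: "real n * ?w = (8 * \<kappa> ^ 8 * real n * q) * (8 * \<kappa>\<^sup>2 * (q * (real n * l)))"
      by (simp only: q(2))
    have "\<theta> * (real n * ?w) = 8 * \<kappa>\<^sup>2 * (sqrt (real D) * (real n * l))"
      unfolding w \<theta>_def q_def[symmetric] using kappa n_pos q(1) by simp
    also have "\<dots> \<le> 8 * \<kappa> ^ 9 * (sqrt (real D) * (real n * l))"
      using kappa l by (intro mult_right_mono mult_left_mono power_increasing) auto
    finally have 1: "\<theta> * (real n * ?w) \<le> 8 * \<kappa> ^ 9 * (sqrt (real D) * (real n * l))" .
    have "t / \<theta> \<le> \<kappa> * l / \<theta>" using assms(2) th by (simp add: divide_right_mono)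
    also have "\<dots> = 8 * (\<kappa> ^ 8 * \<kappa>) * (sqrt (real D) * (real n * l))"
      by (simp add: \<theta>_def)
    also have "\<kappa> ^ 8 * \<kappa> = \<kappa> ^ 9" by (simp add: eval_nat_numeral One_nat_def)
    finally have "t / \<theta> \<le> 8 * \<kappa> ^ 9 * (sqrt (real D) * (real n * l))" .
    then show ?thesis using 1 by linarith
  qed
  moreover have "(\<Sum>i=1..n. d i (restrict \<omega> {1..<i}) (\<omega> i)) =
      (\<Sum>i\<in>I. \<xi> (\<omega> i) * (\<Sum>k=1..D. \<phi> k (\<omega> i) * c k i \<omega>))" for \<omega>
  proof -
    have "c k i (restrict \<omega> {1..<i}) = c k i \<omega>" for k i
      unfolding c_def by (intro arg_cong[where f=clip] sum.cong) auto
    then show ?thesis using assms(1) by (simp add: d_def sum.If_cases Int_absorb1)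
  qed
  ultimately show ?thesis
    using B.msum_two_sided[of t] unfolding c_def by (elim with_prob_at_least_mono) simp_all
qed

text \<open>This is \<open>\<C>\<close>. Because the \<open>\<xi> * \<phi> k\<close> are centered,
  \<open>noise_energy / card I\<close> is the mean squared norm of the score vector of
  \<open>I\<close>.\<close>

definition "noise_energy = (\<Sum>k=1..D. (\<integral>z. (\<xi> z * \<phi> k z)\<^sup>2 \<partial>P))"

lemma sum_phi_square_le: "z \<in> space P \<Longrightarrow> (\<Sum>k=1..D. (\<phi> k z)\<^sup>2) \<le> \<kappa> ^ 6 * real D"
proof -
  assume z: "z \<in> space P"
  have "(\<Sum>k=1..D. (\<phi> k z)\<^sup>2) = (\<Sum>k=1..D. \<bar>\<phi> k z\<bar> * \<bar>\<phi> k z\<bar>)" by (simp add: power2_eq_square)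
  also have "\<dots> \<le> (\<Sum>k=1..D. \<bar>\<phi> k z\<bar> * (\<Sum>j=1..D. \<bar>\<phi> j z\<bar>))"
    by (intro sum_mono mult_left_mono member_le_sum[where f="\<lambda>j. \<bar>\<phi> j z\<bar>"]) auto
  also have "\<dots> = (\<Sum>j=1..D. \<bar>\<phi> j z\<bar>)\<^sup>2" by (simp add: sum_distrib_right power2_eq_square)
  also have "\<dots> \<le> (\<kappa> ^ 3 * sqrt (real D))\<^sup>2" by (intro power_mono sum_abs_phi z sum_nonneg) auto
  finally show ?thesis by (simp add: power_mult_distrib power_mult[symmetric])
qed

lemma xi_phi_square_integrable: "k \<in> {1..D} \<Longrightarrow> integrable P (\<lambda>z. (\<xi> z * \<phi> k z)\<^sup>2)"
proof -
  assume k: "k \<in> {1..D}"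
  have "AE z in P. \<bar>\<xi> z * \<phi> k z\<bar> \<le> 2 * \<kappa> * (\<kappa> * sqrt (a k))"
    by (rule xi_mult_bound) (rule phi_bound[OF k])
  then have "AE z in P. norm ((\<xi> z * \<phi> k z)\<^sup>2) \<le> (2 * \<kappa> * (\<kappa> * sqrt (a k)))\<^sup>2"
    by eventually_elim (simp add: abs_le_square_iff[symmetric])
  then show ?thesis using k by (intro integrable_const_bound) auto
qed

lemma noise_energy_nonneg: "0 \<le> noise_energy"
  unfolding noise_energy_def by (intro sum_nonneg) auto

lemma diagonal_bounds:
  shows "AE z in P. 0 \<le> (\<Sum>k=1..D. (\<xi> z * \<phi> k z)\<^sup>2) \<and> (\<Sum>k=1..D. (\<xi> z * \<phi> k z)\<^sup>2) \<le> 4 * \<kappa> ^ 8 * real D"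
    and "(\<integral>z. (\<Sum>k=1..D. (\<xi> z * \<phi> k z)\<^sup>2) \<partial>P) = noise_energy"
    and "noise_energy \<le> 4 * \<kappa> ^ 8 * real D"
proof -
  show 1: "AE z in P. 0 \<le> (\<Sum>k=1..D. (\<xi> z * \<phi> k z)\<^sup>2) \<and> (\<Sum>k=1..D. (\<xi> z * \<phi> k z)\<^sup>2) \<le> 4 * \<kappa> ^ 8 * real D"
    using xi_bound_space
  proof eventually_elim
    case (elim z)
    have "(\<Sum>k=1..D. (\<xi> z * \<phi> k z)\<^sup>2) = (\<xi> z)\<^sup>2 * (\<Sum>k=1..D. (\<phi> k z)\<^sup>2)"
      by (simp add: power_mult_distrib sum_distrib_left)
    also have "\<dots> \<le> (2 * \<kappa>)\<^sup>2 * (\<kappa> ^ 6 * real D)"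
    proof (intro mult_mono sum_phi_square_le sum_nonneg)
      show "(\<xi> z)\<^sup>2 \<le> (2 * \<kappa>)\<^sup>2" using elim kappa by (subst abs_le_square_iff[symmetric]) auto
    qed (use elim kappa in auto)
    also have "\<dots> = 4 * \<kappa> ^ 8 * real D" by (simp add: eval_nat_numeral One_nat_def)
    finally show ?case by (auto intro: sum_nonneg)
  qed
  show 2: "(\<integral>z. (\<Sum>k=1..D. (\<xi> z * \<phi> k z)\<^sup>2) \<partial>P) = noise_energy"
    unfolding noise_energy_def using xi_phi_square_integrable
    by (intro Bochner_Integration.integral_sum) auto
  have "(\<integral>z. (\<Sum>k=1..D. (\<xi> z * \<phi> k z)\<^sup>2) \<partial>P) \<le> (\<integral>z. 4 * \<kappa> ^ 8 * real D \<partial>P)"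
    using 1 xi_phi_square_integrable by (intro integral_mono_AE) auto
  then show "noise_energy \<le> 4 * \<kappa> ^ 8 * real D" by (simp add: 2 prob_space)
qed

lemma diagonal_concentration:
  assumes "I \<subseteq> {1..n}" "t \<le> \<kappa> * l"
  shows "with_prob_at_least (PiM {1..n} (\<lambda>_. P)) (1 - 2 * exp (- t))
     (\<lambda>\<omega>. \<bar>(\<Sum>i\<in>I. \<Sum>k=1..D. (\<xi> (\<omega> i) * \<phi> k (\<omega> i))\<^sup>2) - real (card I) * noise_energy\<bar>
        \<le> 8 * \<kappa> ^ 9 * (real D * (sqrt (real n) * l)))"
proof -
  define M where "M = 4 * \<kappa> ^ 8 * real D"
  have M: "0 < M" using kappa D by (simp add: M_def)
  \<comment> \<open>With the variance bounded crudely by \<open>M^2\<close>, this rate makes both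
    terms at most \<open>M * sqrt n\<close>, up to the factor \<open>\<kappa> * l\<close>.\<close>
  define \<theta> where "\<theta> = 1 / (M * sqrt (real n))"
  have th: "0 < \<theta>" using M n_pos by (simp add: \<theta>_def)
  have bd: "AE z in P. \<bar>(\<Sum>k=1..D. (\<xi> z * \<phi> k z)\<^sup>2) - noise_energy\<bar> \<le> M"
    using diagonal_bounds(1)
  proof eventually_elim
    case (elim z)
    then show ?case using diagonal_bounds(3) noise_energy_nonneg
      by (intro abs_leI) (auto simp: M_def)
  qed
  have meas[measurable]: "(\<lambda>z. (\<Sum>k=1..D. (\<xi> z * \<phi> k z)\<^sup>2) - noise_energy) \<in> borel_measurable P"
    by (intro borel_measurable_diff borel_measurable_sum borel_measurable_power borel_measurable_times) auto
  have "with_prob_at_least (PiM {1..n} (\<lambda>_. P)) (1 - 2 * exp (- t))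
     (\<lambda>\<omega>. \<bar>\<Sum>i\<in>I. ((\<Sum>k=1..D. (\<xi> (\<omega> i) * \<phi> k (\<omega> i))\<^sup>2) - noise_energy)\<bar> \<le> \<theta> * (real n * M\<^sup>2) + t / \<theta>)"
  proof (rule iid_sum_concentration[where f="\<lambda>z. (\<Sum>k=1..D. (\<xi> z * \<phi> k z)\<^sup>2) - noise_energy", OF meas _ bd])
    show "(\<integral>z. (\<Sum>k=1..D. (\<xi> z * \<phi> k z)\<^sup>2) - noise_energy \<partial>P) = 0"
      using xi_phi_square_integrable diagonal_bounds(2)
      by (subst Bochner_Integration.integral_diff) (auto simp: prob_space)
    have "(\<integral>z. ((\<Sum>k=1..D. (\<xi> z * \<phi> k z)\<^sup>2) - noise_energy)\<^sup>2 \<partial>P) \<le> (\<integral>z. M\<^sup>2 \<partial>P)"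
    proof (rule integral_mono_AE')
      show "AE z in P. ((\<Sum>k=1..D. (\<xi> z * \<phi> k z)\<^sup>2) - noise_energy)\<^sup>2 \<le> M\<^sup>2"
        using bd
      proof eventually_elim
        case (elim z)
        then show ?case using M by (subst abs_le_square_iff[symmetric]) auto
      qed
    qed auto
    then show "(\<integral>z. ((\<Sum>k=1..D. (\<xi> z * \<phi> k z)\<^sup>2) - noise_energy)\<^sup>2 \<partial>P) \<le> M\<^sup>2"
      by (simp add: prob_space)
    show "\<theta> * M \<le> 1" using M n_pos l by (simp add: \<theta>_def)
  qed (use th assms(1) in auto)
  moreover have "\<theta> * (real n * M\<^sup>2) + t / \<theta> \<le> 8 * \<kappa> ^ 9 * (real D * (sqrt (real n) * l))"
  proof -
    have "\<theta> * (real n * M\<^sup>2) = sqrt (real n) * M"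
      using M n_pos by (simp add: \<theta>_def power2_eq_square real_div_sqrt field_simps)
    also have "\<dots> \<le> (sqrt (real n) * M) * (\<kappa> * l)"
      using M kappa l by (intro mult_left_mono[of 1 "\<kappa> * l", simplified] mult_ge1_I) auto
    finally have "\<theta> * (real n * M\<^sup>2) \<le> (sqrt (real n) * M) * (\<kappa> * l)" .
    moreover have "t / \<theta> \<le> (\<kappa> * l) / \<theta>" using assms(2) th by (intro divide_right_mono) auto
    moreover have "(\<kappa> * l) / \<theta> = (sqrt (real n) * M) * (\<kappa> * l)" by (simp add: \<theta>_def)
    ultimately have "\<theta> * (real n * M\<^sup>2) + t / \<theta> \<le> 2 * ((sqrt (real n) * M) * (\<kappa> * l))" by linarith
    also have "\<dots> = 8 * \<kappa> ^ 9 * (real D * (sqrt (real n) * l))"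
      by (simp add: M_def eval_nat_numeral One_nat_def)
    finally show ?thesis .
  qed
  ultimately show ?thesis by (elim with_prob_at_least_mono) (auto simp: sum_subtractf)
qed

text \<open>The union runs over the \<open>D * n\<close> partial sums on which clipping must be
  inactive and over the two events for chaos and diagonal. The chaos enters twice, since the lower
  triangle is half of the off-diagonal part; hence \<open>32 = 2 * 16\<close>.\<close>

lemma norm_concentration:
  assumes "I \<subseteq> {1..n}" "t \<le> \<kappa> * l"
  shows "with_prob_at_least (PiM {1..n} (\<lambda>_. P)) (1 - (real D * real n + 2) * (2 * exp (- t)))
     (\<lambda>\<omega>. \<bar>(\<Sum>k=1..D. (\<Sum>i\<in>I. \<xi> (\<omega> i) * \<phi> k (\<omega> i))\<^sup>2) - real (card I) * noise_energy\<bar>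
        \<le> 32 * \<kappa> ^ 9 * (sqrt (real D) * (real n * l)) + 8 * \<kappa> ^ 9 * (real D * (sqrt (real n) * l)))"
proof -
  interpret S: prob_space "PiM {1..n} (\<lambda>_. P)" by (rule prob_space_PiM) (rule prob_space_axioms)
  let ?T = "\<lambda>k i \<omega>. (\<Sum>j\<in>I \<inter> {1..<i}. \<xi> (\<omega> j) * \<phi> k (\<omega> j))"
  have "with_prob_at_least (PiM {1..n} (\<lambda>_. P)) (1 - real (card ({1..D} \<times> {1..n})) * (2 * exp (- t)))
     (\<lambda>\<omega>. \<forall>(k,i)\<in>{1..D} \<times> {1..n}. \<bar>?T k i \<omega>\<bar> \<le> \<tau>)"
    using assms by (intro S.with_prob_at_least_ball) (auto intro!: coordinate_concentration)
  from S.with_prob_at_least_conj[OF this S.with_prob_at_least_conj[OF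
    clipped_chaos_concentration[OF assms] diagonal_concentration[OF assms]]]
  show ?thesis
  proof (rule with_prob_at_least_mono, goal_cases)
    case 1
    then show ?case by (simp add: algebra_simps)
  next
    case (2 \<omega>)
    \<comment> \<open>Extension by zero, so that the splitting into diagonal and lower triangle,
      stated for \<open>{1..n}\<close>, applies to the subsample \<open>I\<close>.\<close>
    define g where "g k i = (if i \<in> I then \<xi> (\<omega> i) * \<phi> k (\<omega> i) else 0)" for k i
    have fin: "finite I" using assms(1) finite_subset by blast
    have gT: "(\<Sum>j=1..<i. g k j) = ?T k i \<omega>" for k i
      unfolding g_def by (subst sum.inter_restrict[symmetric]) (auto simp: Int_commute)
    have gI: "(\<Sum>i=1..n. g k i * f i) = (\<Sum>i\<in>I. \<xi> (\<omega> i) * \<phi> k (\<omega> i) * f i)" for k f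
    proof -
      have "g k i * f i = (if i \<in> I then \<xi> (\<omega> i) * \<phi> k (\<omega> i) * f i else 0)" for i
        by (simp add: g_def)
      then show ?thesis using assms(1) by (simp add: sum.If_cases Int_absorb1)
    qed
    have "(\<Sum>k=1..D. (\<Sum>i\<in>I. \<xi> (\<omega> i) * \<phi> k (\<omega> i))\<^sup>2) = (\<Sum>k=1..D. (\<Sum>i=1..n. g k i)\<^sup>2)"
      using gI[of _ "\<lambda>_. 1"] by simp
    also have "\<dots> = (\<Sum>k=1..D. (\<Sum>i=1..n. g k i * g k i)) + 2 * (\<Sum>k=1..D. \<Sum>i=1..n. g k i * (\<Sum>j=1..<i. g k j))"
      by (simp add: power2_sum_eq_diag_plus_lower sum.distrib sum_distrib_left power2_eq_square[of "g _ _"])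
    also have "(\<Sum>k=1..D. (\<Sum>i=1..n. g k i * g k i)) = (\<Sum>i\<in>I. \<Sum>k=1..D. (\<xi> (\<omega> i) * \<phi> k (\<omega> i))\<^sup>2)"
      unfolding gI by (subst sum.swap) (auto simp: g_def power2_eq_square intro!: sum.cong)
    also have "(\<Sum>k=1..D. \<Sum>i=1..n. g k i * (\<Sum>j=1..<i. g k j)) =
        (\<Sum>i\<in>I. \<xi> (\<omega> i) * (\<Sum>k=1..D. \<phi> k (\<omega> i) * clip (?T k i \<omega>)))"
    proof -
      have "(\<Sum>k=1..D. \<Sum>i\<in>I. \<xi> (\<omega> i) * \<phi> k (\<omega> i) * ?T k i \<omega>)
          = (\<Sum>k=1..D. \<Sum>i\<in>I. \<xi> (\<omega> i) * \<phi> k (\<omega> i) * clip (?T k i \<omega>))"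
        using 2 assms(1) by (intro sum.cong refl arg_cong2[where f="(*)"] clip_id[symmetric]) auto
      then show ?thesis unfolding gT gI
        by (simp only: sum_distrib_left mult.assoc sum.swap[of _ I])
    qed
    finally show ?case using 2 by linarith
  qed
qed

text \<open>The variance of \<open>\<phi> k * \<phi> j\<close> is at most the squared sup-norm of
  either function, because the other one has norm one; this yields the minimum of \<open>a k\<close>
  and \<open>a j\<close>. The sup-norm of the product involves both, so the constraint on
  \<open>\<theta>\<close> becomes one on the maximum, which the upper bound on \<open>a\<close>
  provides.\<close>

lemma gram_entry_concentration:
  assumes k: "k \<in> {1..D}" and j: "j \<in> {1..D}" and "I \<subseteq> {1..n}" "t \<le> \<kappa> * l"
  shows "with_prob_at_least (PiM {1..n} (\<lambda>_. P)) (1 - 2 * exp (- t))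
     (\<lambda>\<omega>. \<bar>\<Sum>i\<in>I. (\<phi> k (\<omega> i) * \<phi> j (\<omega> i) - (if k = j then 1 else 0))\<bar>
        \<le> 3 * \<kappa> ^ 4 * (sqrt (real n * l) * sqrt (min (a k) (a j))))"
proof -
  define M where "M = (\<kappa> * sqrt (a k)) * (\<kappa> * sqrt (a j))"
  define p where "p = sqrt (min (a k) (a j))"
  define q where "q = sqrt (max (a k) (a j))"
  define s where "s = sqrt (real n * l)"
  have a: "0 < a k" "0 < a j" using a_pos k j by auto
  have p: "0 < p" using a by (auto simp: p_def)
  have s: "0 < s" "s * s = real n * l" using n_pos l by (auto simp: s_def)
  have Mpq: "M = \<kappa>\<^sup>2 * (p * q)"
    by (cases "a k \<le> a j") (auto simp: M_def p_def q_def min_def max_def power2_eq_square)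
  define \<theta> where "\<theta> = s / (2 * \<kappa> ^ 3 * real n * p)"
  have th: "0 < \<theta>" using kappa s p n_pos by (simp add: \<theta>_def)
  note [measurable] = phi_measurable[OF k] phi_measurable[OF j]
  let ?e = "if k = j then 1 else 0 :: real"
  have bd0: "\<bar>\<phi> k z * \<phi> j z\<bar> \<le> M" if "z \<in> space P" for z
    using phi_bound[OF k that] phi_bound[OF j that] kappa a
    by (auto simp: M_def abs_mult intro!: mult_mono)
  \<comment> \<open>\<open>?e\<close> is the mean of a product bounded by \<open>M\<close>;
    centering therefore at most doubles the sup-norm.\<close>
  have e: "\<bar>?e\<bar> \<le> M"
  proof -
    have "\<bar>\<integral>z. \<phi> k z * \<phi> j z \<partial>P\<bar> \<le> (\<integral>z. M \<partial>P)"
      using phi_integrable_mult[OF k j] bd0 by (intro integral_abs_bound[THEN order_trans] integral_mono) auto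
    then show ?thesis using orthonormal[OF k j] by (simp add: prob_space)
  qed
  have var: "(\<integral>z. (\<phi> k z * \<phi> j z - ?e)\<^sup>2 \<partial>P) \<le> \<kappa>\<^sup>2 * p\<^sup>2"
  proof -
    have i2: "integrable P (\<lambda>z. (\<phi> k z * \<phi> j z)\<^sup>2)"
    proof (rule integrable_const_bound[of _ "M\<^sup>2"])
      show "AE z in P. norm ((\<phi> k z * \<phi> j z)\<^sup>2) \<le> M\<^sup>2"
      proof (rule AE_I2)
        fix z assume "z \<in> space P"
        from bd0[OF this] show "norm ((\<phi> k z * \<phi> j z)\<^sup>2) \<le> M\<^sup>2"
          by (simp add: abs_le_square_iff[symmetric])
      qed
    qed measurable
    have "(\<integral>z. (\<phi> k z * \<phi> j z - ?e)\<^sup>2 \<partial>P) = variance (\<lambda>z. \<phi> k z * \<phi> j z)"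
      using orthonormal[OF k j] by simp
    also have "\<dots> = expectation (\<lambda>z. (\<phi> k z * \<phi> j z)\<^sup>2) - (expectation (\<lambda>z. \<phi> k z * \<phi> j z))\<^sup>2"
      using phi_integrable_mult[OF k j] i2 by (rule variance_eq)
    also have "\<dots> \<le> expectation (\<lambda>z. (\<phi> k z * \<phi> j z)\<^sup>2)" by simp
    also have "\<dots> \<le> \<kappa>\<^sup>2 * p\<^sup>2"
    proof -
      have *: "expectation (\<lambda>z. (\<phi> k z * \<phi> j z)\<^sup>2) \<le> \<kappa>\<^sup>2 * a k" if k: "k \<in> {1..D}" and j: "j \<in> {1..D}" for k j
      proof -
        have "expectation (\<lambda>z. (\<phi> k z * \<phi> j z)\<^sup>2) \<le> (\<integral>z. \<kappa>\<^sup>2 * a k * (\<phi> j z * \<phi> j z) \<partial>P)"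
        proof (rule integral_mono_AE')
          show "AE z in P. (\<phi> k z * \<phi> j z)\<^sup>2 \<le> \<kappa>\<^sup>2 * a k * (\<phi> j z * \<phi> j z)"
          proof (rule AE_I2)
            fix z assume z: "z \<in> space P"
            have "(\<phi> k z)\<^sup>2 \<le> (\<kappa> * sqrt (a k))\<^sup>2"
              using phi_bound[OF k z] kappa a_pos[OF k] by (subst abs_le_square_iff[symmetric]) auto
            then show "(\<phi> k z * \<phi> j z)\<^sup>2 \<le> \<kappa>\<^sup>2 * a k * (\<phi> j z * \<phi> j z)"
              using a_pos[OF k] by (auto simp: power_mult_distrib power2_eq_square[of "\<phi> j z"] intro!: mult_right_mono)
          qed
        qed (use phi_integrable_mult[OF j j] a_pos[OF k] in auto)
        then show ?thesis using orthonormal[OF j j] by simp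
      qed
      from *[OF k j] *[OF j k] show ?thesis using a
        by (auto simp: p_def min_def mult.commute[of "\<phi> j _"])
    qed
    finally show ?thesis .
  qed
  have "s * q \<le> \<kappa> * real n"
  proof -
    have "max (a k) (a j) \<le> \<kappa> * real n / l\<^sup>2" using a_le k j by auto
    then have "real n * l * max (a k) (a j) \<le> real n * l * (\<kappa> * real n / l\<^sup>2)"
      using n_pos l by (intro mult_left_mono) auto
    also have "\<dots> = \<kappa> * (real n)\<^sup>2 / l" using l by (simp add: power2_eq_square)
    also have "\<dots> \<le> \<kappa> * (real n)\<^sup>2" using l kappa by (simp add: divide_le_eq mult_left_le)
    also have "\<dots> \<le> \<kappa>\<^sup>2 * (real n)\<^sup>2" using kappa by (intro mult_right_mono self_le_power) auto
    finally have "sqrt (real n * l * max (a k) (a j)) \<le> \<kappa> * real n"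
      using kappa by (intro real_le_lsqrt) (auto simp: power_mult_distrib)
    then show ?thesis by (simp add: s_def q_def real_sqrt_mult)
  qed
  note sq = this
  have "with_prob_at_least (PiM {1..n} (\<lambda>_. P)) (1 - 2 * exp (- t))
     (\<lambda>\<omega>. \<bar>\<Sum>i\<in>I. (\<phi> k (\<omega> i) * \<phi> j (\<omega> i) - ?e)\<bar> \<le> \<theta> * (real n * (\<kappa>\<^sup>2 * p\<^sup>2)) + t / \<theta>)"
  proof (rule iid_sum_concentration[where f="\<lambda>z. \<phi> k z * \<phi> j z - ?e"])
    show "(\<integral>z. \<phi> k z * \<phi> j z - ?e \<partial>P) = 0"
      using phi_integrable_mult[OF k j] orthonormal[OF k j] by (simp add: prob_space)
    show "AE z in P. \<bar>\<phi> k z * \<phi> j z - ?e\<bar> \<le> 2 * M"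
    proof (rule AE_I2)
      fix z assume "z \<in> space P"
      from bd0[OF this] e show "\<bar>\<phi> k z * \<phi> j z - ?e\<bar> \<le> 2 * M" by linarith
    qed
    have "\<theta> * (2 * M) = (s * q) / (\<kappa> * real n)"
      using kappa n_pos p by (simp add: \<theta>_def Mpq field_simps power3_eq_cube power2_eq_square)
    also have "\<dots> \<le> 1" using sq kappa n_pos by simp
    finally show "\<theta> * (2 * M) \<le> 1" .
  qed (use th assms(3) var in auto)
  moreover have "\<theta> * (real n * (\<kappa>\<^sup>2 * p\<^sup>2)) + t / \<theta> \<le> 3 * \<kappa> ^ 4 * (s * p)"
  proof -
    have "\<theta> * (real n * (\<kappa>\<^sup>2 * p\<^sup>2)) = (1 / (2 * \<kappa>)) * (s * p)"
      using kappa n_pos p by (simp add: \<theta>_def field_simps power3_eq_cube power2_eq_square)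
    also have "\<dots> \<le> \<kappa> ^ 4 * (s * p)"
    proof (intro mult_right_mono)
      have "1 / (2 * \<kappa>) \<le> 1" using kappa by simp
      also have "1 \<le> \<kappa> ^ 4" using kappa by simp
      finally show "1 / (2 * \<kappa>) \<le> \<kappa> ^ 4" .
    qed (use s p in auto)
    finally have 1: "\<theta> * (real n * (\<kappa>\<^sup>2 * p\<^sup>2)) \<le> \<kappa> ^ 4 * (s * p)" .
    have "t / \<theta> \<le> \<kappa> * l / \<theta>" using assms(4) th by (simp add: divide_right_mono)
    also have "\<dots> = 2 * \<kappa> ^ 4 * ((l * real n) / s * p)"
      using s by (simp add: \<theta>_def field_simps power3_eq_cube power4_eq_xxxx)
    also have "(l * real n) / s = s" using s by (simp add: field_simps)
    finally show ?thesis using 1 by linarith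
  qed
  ultimately show ?thesis by (elim with_prob_at_least_mono) (auto simp: s_def p_def)
qed

section \<open>Operator norm of the empirical Gram matrix minus the identity\<close>

definition gram :: "nat set \<Rightarrow> (nat \<Rightarrow> 'z) \<Rightarrow> nat \<Rightarrow> nat \<Rightarrow> real" where
  "gram I \<omega> k j = (\<Sum>i\<in>I. (\<phi> k (\<omega> i) * \<phi> j (\<omega> i) - (if k = j then 1 else 0))) / real (card I)"

text \<open>An entry vanishes unless the two supports meet, so \<open>overlap\<close> bounds the
  weighted rows. The entries contribute \<open>sqrt (n * l) / n\<close> and the overlap
  \<open>sqrt n / l\<close>; the product is \<open>1 / sqrt l\<close>.\<close>

lemma gram_norm_bound:
  assumes "I \<subseteq> {1..n}" "real n \<le> \<kappa> * real (card I)" "\<omega> \<in> space (PiM {1..n} (\<lambda>_. P))"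
    and entries: "\<And>k j. k \<in> {1..D} \<Longrightarrow> j \<in> {1..D} \<Longrightarrow>
      \<bar>\<Sum>i\<in>I. (\<phi> k (\<omega> i) * \<phi> j (\<omega> i) - (if k = j then 1 else 0))\<bar>
        \<le> 3 * \<kappa> ^ 4 * (sqrt (real n * l) * sqrt (min (a k) (a j)))"
  shows "(\<Sum>k=1..D. (\<Sum>j=1..D. gram I \<omega> k j * \<beta> j)\<^sup>2) \<le> (3 * \<kappa> ^ 7 / sqrt l)\<^sup>2 * (\<Sum>j=1..D. (\<beta> j)\<^sup>2)"
proof (rule schur_test[where s="\<lambda>k. sqrt (a k)"])
  have \<omega>: "\<omega> i \<in> space P" if "i \<in> I" for i
    using assms(1,3) that by (auto simp: space_PiM)
  have cI: "0 < real (card I)" using assms(2) n_pos kappa by (cases "card I = 0") auto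
  show "gram I \<omega> k j = gram I \<omega> j k" for k j by (simp add: gram_def mult.commute)
  show "0 < sqrt (a k)" if "k \<in> {1..D}" for k using a_pos[OF that] by simp
  show "0 \<le> 3 * \<kappa> ^ 7 / sqrt l" using kappa l by simp
  fix k assume k: "k \<in> {1..D}"
  let ?J = "{j \<in> {1..D}. \<exists>z\<in>space P. \<phi> k z \<noteq> 0 \<and> \<phi> j z \<noteq> 0}"
  \<comment> \<open>A function of norm one does not vanish identically, so \<open>k\<close> meets
    itself. Entries outside \<open>?J\<close> are thus off-diagonal, and no identity is subtracted
    from them.\<close>
  have kJ: "k \<in> ?J"
  proof (rule ccontr)
    assume "k \<notin> ?J"
    then have "(\<integral>z. \<phi> k z * \<phi> k z \<partial>P) = (\<integral>z. 0 \<partial>P)" using k by (intro Bochner_Integration.integral_cong) auto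
    then show False using orthonormal[OF k k] by simp
  qed
  have zero: "gram I \<omega> k j = 0" if "j \<in> {1..D}" "j \<notin> ?J" for j
  proof -
    have "k \<noteq> j" using kJ that by auto
    moreover have "\<phi> k (\<omega> i) * \<phi> j (\<omega> i) = 0" if "i \<in> I" for i
      using \<omega>[OF that] \<open>j \<notin> ?J\<close> \<open>j \<in> {1..D}\<close> by auto
    ultimately have "(\<Sum>i\<in>I. (\<phi> k (\<omega> i) * \<phi> j (\<omega> i) - (if k = j then 1 else 0))) = 0"
      by (intro sum.neutral) (simp del: mult_eq_0_iff)
    then show ?thesis by (simp add: gram_def)
  qed
  define c where "c = 3 * \<kappa> ^ 4 * sqrt (real n * l) * (\<kappa> / real n)"
  have c: "0 \<le> c" using kappa l by (simp add: c_def)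
  have "(\<Sum>j\<in>{1..D}. \<bar>gram I \<omega> k j\<bar> * (sqrt (a k) / sqrt (a j))) = (\<Sum>j\<in>?J. \<bar>gram I \<omega> k j\<bar> * (sqrt (a k) / sqrt (a j)))"
    using zero by (intro sum.mono_neutral_right) auto
  also have "\<dots> \<le> (\<Sum>j\<in>?J. c * (sqrt (min (a k) (a j)) * sqrt (a k / a j)))"
  proof (rule sum_mono)
    fix j assume j: "j \<in> ?J"
    have "\<bar>gram I \<omega> k j\<bar> \<le> 3 * \<kappa> ^ 4 * (sqrt (real n * l) * sqrt (min (a k) (a j))) / real (card I)"
      unfolding gram_def abs_divide using entries[OF k, of j] j cI by (simp add: divide_right_mono)
    also have "\<dots> = 3 * \<kappa> ^ 4 * (sqrt (real n * l) * sqrt (min (a k) (a j))) * (1 / real (card I))"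
      by simp
    also have "\<dots> \<le> 3 * \<kappa> ^ 4 * (sqrt (real n * l) * sqrt (min (a k) (a j))) * (\<kappa> / real n)"
    proof (intro mult_left_mono)
      show "1 / real (card I) \<le> \<kappa> / real n" using assms(2) cI n_pos by (simp add: field_simps)
      show "0 \<le> 3 * \<kappa> ^ 4 * (sqrt (real n * l) * sqrt (min (a k) (a j)))"
        using kappa l a_pos[OF k] a_pos[of j] j by auto
    qed
    finally have "\<bar>gram I \<omega> k j\<bar> \<le> c * sqrt (min (a k) (a j))" by (simp add: c_def mult_ac)
    moreover have "0 \<le> sqrt (a k) / sqrt (a j)" using a_pos[OF k] a_pos[of j] j by auto
    ultimately have "\<bar>gram I \<omega> k j\<bar> * (sqrt (a k) / sqrt (a j)) \<le> c * sqrt (min (a k) (a j)) * (sqrt (a k) / sqrt (a j))"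
      by (rule mult_right_mono)
    then show "\<bar>gram I \<omega> k j\<bar> * (sqrt (a k) / sqrt (a j)) \<le> c * (sqrt (min (a k) (a j)) * sqrt (a k / a j))"
      by (simp add: real_sqrt_divide)
  qed
  also have "\<dots> = c * (\<Sum>j\<in>?J. sqrt (min (a k) (a j)) * sqrt (a k / a j))" by (simp add: sum_distrib_left)
  also have "\<dots> \<le> c * (\<kappa> * (sqrt (\<kappa> * real n) / l))"
    using overlap[OF k] c by (intro mult_left_mono) auto
  also have "\<dots> = 3 * \<kappa> ^ 6 * sqrt \<kappa> * ((sqrt (real n) * sqrt (real n)) / real n) * (sqrt l / l)"
  proof -
    have "3 * \<kappa> ^ 4 * (p * q) * (\<kappa> / N) * (\<kappa> * ((r * p) / l)) = 3 * \<kappa> ^ 6 * r * ((p * p) / N) * (q / l)" for p q r N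
      by (simp add: eval_nat_numeral One_nat_def)
    then show ?thesis unfolding c_def real_sqrt_mult .
  qed
  also have "\<dots> = 3 * \<kappa> ^ 6 * sqrt \<kappa> / sqrt l"
  proof -
    have "sqrt l / l = 1 / sqrt l" using l by (simp add: field_simps real_sqrt_mult_self)
    then show ?thesis using n_pos by simp
  qed
  also have "\<dots> \<le> 3 * \<kappa> ^ 7 / sqrt l"
  proof -
    have "sqrt \<kappa> \<le> \<kappa>" using kappa by (intro real_le_lsqrt self_le_power) auto
    then have "\<kappa> ^ 6 * sqrt \<kappa> \<le> \<kappa> ^ 6 * \<kappa>" using kappa by (intro mult_left_mono) auto
    also have "\<dots> = \<kappa> ^ 7" by (simp add: eval_nat_numeral One_nat_def)
    finally have "3 * \<kappa> ^ 6 * sqrt \<kappa> \<le> 3 * \<kappa> ^ 7" by simp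
    then show ?thesis using l by (intro divide_right_mono) auto
  qed
  finally show "(\<Sum>j\<in>{1..D}. \<bar>gram I \<omega> k j\<bar> * (sqrt (a k) / sqrt (a j))) \<le> 3 * \<kappa> ^ 7 / sqrt l" .
qed

end

section \<open>Least squares on a strongly localized model\<close>

text \<open>The difference \<open>e = v - \<beta>\<close> is \<open>G \<beta>\<close>, of norm at
  most \<open>\<delta>\<close> times that of \<open>\<beta>\<close>; expanding the squared norm of
  \<open>\<beta> + e\<close> gives everything. The condition \<open>\<delta> \<le> 1 / 6\<close>
  keeps the norms of \<open>\<beta>\<close> and \<open>v\<close> comparable, so that errors can be
  stated in terms of \<open>v\<close>, whose norm is the one that concentrates.\<close>

lemma near_identity_system:
  fixes \<beta> v :: "'i \<Rightarrow> real"
  assumes sys: "\<And>k. k \<in> S \<Longrightarrow> v k = \<beta> k + (\<Sum>j\<in>S. G k j * \<beta> j)"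
    and G: "(\<Sum>k\<in>S. (\<Sum>j\<in>S. G k j * \<beta> j)\<^sup>2) \<le> \<delta>\<^sup>2 * (\<Sum>j\<in>S. (\<beta> j)\<^sup>2)"
    and \<delta>: "0 \<le> \<delta>" "\<delta> \<le> 1 / 6"
  shows "(\<Sum>k\<in>S. (v k - \<beta> k)\<^sup>2) \<le> \<delta>\<^sup>2 * (\<Sum>k\<in>S. (\<beta> k)\<^sup>2)"
    and "\<bar>(\<Sum>k\<in>S. (\<beta> k)\<^sup>2) - (\<Sum>k\<in>S. (v k)\<^sup>2)\<bar> \<le> 6 * \<delta> * (\<Sum>k\<in>S. (v k)\<^sup>2)"
    and "\<bar>(\<Sum>k\<in>S. v k * \<beta> k) - (\<Sum>k\<in>S. (v k)\<^sup>2)\<bar> \<le> 4 * \<delta> * (\<Sum>k\<in>S. (v k)\<^sup>2)"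
    and "(\<Sum>k\<in>S. (\<beta> k)\<^sup>2) \<le> 2 * (\<Sum>k\<in>S. (v k)\<^sup>2)"
proof -
  define e where "e k = v k - \<beta> k" for k
  define B N E X where "B = (\<Sum>k\<in>S. (\<beta> k)\<^sup>2)" and "N = (\<Sum>k\<in>S. (v k)\<^sup>2)"
    and "E = (\<Sum>k\<in>S. (e k)\<^sup>2)" and "X = (\<Sum>k\<in>S. e k * \<beta> k)"
  have "E = (\<Sum>k\<in>S. (\<Sum>j\<in>S. G k j * \<beta> j)\<^sup>2)"
    unfolding E_def e_def by (intro sum.cong) (auto simp: sys)
  then have E: "E \<le> \<delta>\<^sup>2 * B" "0 \<le> E" using G by (auto simp: B_def E_def intro: sum_nonneg)
  have B: "0 \<le> B" by (auto simp: B_def intro: sum_nonneg)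
  have "X\<^sup>2 \<le> E * B" unfolding X_def E_def B_def by (rule Cauchy_Schwarz_ineq_sum)
  also have "\<dots> \<le> (\<delta> * B)\<^sup>2"
    using mult_right_mono[OF E(1) B] by (simp add: power2_eq_square mult_ac)
  finally have X: "\<bar>X\<bar> \<le> \<delta> * B" using abs_le_square_iff[of X "\<delta> * B"] \<delta> B by simp
  have v: "v k = \<beta> k + e k" for k by (simp add: e_def)
  have N: "N = B + 2 * X + E"
    unfolding N_def B_def X_def E_def v
    by (simp add: power2_sum sum.distrib sum_distrib_left algebra_simps)
  have vb: "(\<Sum>k\<in>S. v k * \<beta> k) = B + X"
    unfolding B_def X_def v by (simp add: power2_eq_square sum.distrib algebra_simps)
  have "\<delta>\<^sup>2 * B \<le> \<delta> * B"
    using \<delta> B by (intro mult_right_mono) (auto simp: power2_eq_square mult_left_le)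
  then have E': "E \<le> \<delta> * B" using E by linarith
  have NB: "\<bar>N - B\<bar> \<le> 3 * (\<delta> * B)" using N X E' E(2) by linarith
  have "3 * (\<delta> * B) \<le> B / 2" using mult_right_mono[OF \<delta>(2) B] by simp
  then have B2: "B \<le> 2 * N" using NB by linarith
  then have dB: "\<delta> * B \<le> 2 * (\<delta> * N)" using mult_left_mono[OF B2 \<delta>(1)] by simp
  show "(\<Sum>k\<in>S. (v k - \<beta> k)\<^sup>2) \<le> \<delta>\<^sup>2 * (\<Sum>k\<in>S. (\<beta> k)\<^sup>2)"
    using E by (simp add: E_def B_def e_def)
  show "\<bar>(\<Sum>k\<in>S. (\<beta> k)\<^sup>2) - (\<Sum>k\<in>S. (v k)\<^sup>2)\<bar> \<le> 6 * \<delta> * (\<Sum>k\<in>S. (v k)\<^sup>2)"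
    unfolding B_def[symmetric] N_def[symmetric] using NB dB by linarith
  show "\<bar>(\<Sum>k\<in>S. v k * \<beta> k) - (\<Sum>k\<in>S. (v k)\<^sup>2)\<bar> \<le> 4 * \<delta> * (\<Sum>k\<in>S. (v k)\<^sup>2)"
    unfolding vb N_def[symmetric] using N X E' E(2) dB by linarith
  show "(\<Sum>k\<in>S. (\<beta> k)\<^sup>2) \<le> 2 * (\<Sum>k\<in>S. (v k)\<^sup>2)"
    unfolding B_def[symmetric] N_def[symmetric] by (rule B2)
qed

text \<open>Comparing \<open>t\<close> with \<open>t + c u\<close> gives a quadratic inequality in
  \<open>c\<close> that holds for all \<open>c\<close> and forces the linear coefficient
  \<open>X\<close> to vanish. The test values are the minimizer \<open>X / Q\<close>, or
  \<open>X\<close> itself when \<open>Q = 0\<close>.\<close>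

lemma least_squares_orthogonality:
  assumes "is_least_squares I \<omega> m t" "subspace m" "u \<in> m" "finite I" "I \<noteq> {}"
  shows "(\<Sum>i\<in>I. (snd (\<omega> i) - t (fst (\<omega> i))) * u (fst (\<omega> i))) = 0"
proof -
  define R where "R i = snd (\<omega> i) - t (fst (\<omega> i))" for i
  define U where "U i = u (fst (\<omega> i))" for i
  define X Q where "X = (\<Sum>i\<in>I. R i * U i)" and "Q = (\<Sum>i\<in>I. (U i)\<^sup>2)"
  have t: "t \<in> m" and opt: "\<And>w. w \<in> m \<Longrightarrow> emp_mean I \<omega> (contrast t) \<le> emp_mean I \<omega> (contrast w)"
    using assms(1) by (auto simp: is_least_squares_def is_arg_min_def not_less)
  have ineq: "2 * c * X \<le> c\<^sup>2 * Q" for c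
  proof -
    have w: "t + c *\<^sub>R u \<in> m" using assms(2,3) t by (intro subspace_add subspace_scale)
    have "(\<Sum>i\<in>I. (R i)\<^sup>2) \<le> (\<Sum>i\<in>I. (R i - c * U i)\<^sup>2)"
      using opt[OF w] assms(4,5)
      by (simp add: emp_mean_def contrast_def case_prod_beta scaleR_fun_def R_def U_def divide_le_cancel card_gt_0_iff diff_diff_eq)
    also have "\<dots> = (\<Sum>i\<in>I. (R i)\<^sup>2) - 2 * c * X + c\<^sup>2 * Q"
      by (simp add: power2_diff X_def Q_def sum.distrib sum_subtractf sum_distrib_left power_mult_distrib mult_ac)
    finally show ?thesis by linarith
  qed
  have Q: "0 \<le> Q" by (auto simp: Q_def intro: sum_nonneg)
  have "X = 0"
  proof (cases "Q = 0")
    case True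
    then show ?thesis using ineq[of X] by (auto simp: mult_le_0_iff)
  next
    case False
    then have "2 * (X / Q) * X \<le> (X / Q)\<^sup>2 * Q" using ineq by blast
    then have "2 * X\<^sup>2 / Q \<le> X\<^sup>2 / Q" using False by (simp add: power2_eq_square)
    then have "2 * X\<^sup>2 \<le> X\<^sup>2" using False Q by (simp add: divide_le_cancel)
    then show ?thesis by simp
  qed
  then show ?thesis by (simp add: X_def R_def U_def)
qed

lemma span_image_eq_combination:
  fixes \<phi> :: "nat \<Rightarrow> predictor"
  assumes "u \<in> span (\<phi> ` {1..D})"
  obtains \<beta> where "u = (\<lambda>x. \<Sum>k=1..D. \<beta> k * \<phi> k x)"
proof -
  let ?T = "{u. \<exists>\<beta>. u = (\<lambda>x. \<Sum>k=1..D. \<beta> k * \<phi> k x)}"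
  have "span (\<phi> ` {1..D}) \<subseteq> ?T"
  proof (rule span_minimal)
    show "\<phi> ` {1..D} \<subseteq> ?T"
    proof clarify
      fix j assume j: "j \<in> {1..D}"
      have "\<phi> j = (\<lambda>x. \<Sum>k=1..D. (if k = j then 1 else 0) * \<phi> k x)"
        using j by (simp add: if_distrib[of "\<lambda>c. c * _"] cong: if_cong)
      then show "\<exists>\<beta>. \<phi> j = (\<lambda>x. \<Sum>k=1..D. \<beta> k * \<phi> k x)" by (rule exI[of _ "\<lambda>k. if k = j then 1 else 0"])
    qed
    show "subspace ?T"
    proof (rule subspaceI)
      show "0 \<in> ?T" by (auto intro!: exI[of _ "\<lambda>_. 0"])
    next
      fix u w assume "u \<in> ?T" "w \<in> ?T"
      then obtain b c where "u = (\<lambda>x. \<Sum>k=1..D. b k * \<phi> k x)" "w = (\<lambda>x. \<Sum>k=1..D. c k * \<phi> k x)" by auto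
      then have "u + w = (\<lambda>x. \<Sum>k=1..D. (b k + c k) * \<phi> k x)"
        by (auto simp: fun_eq_iff distrib_right sum.distrib)
      then show "u + w \<in> ?T" by (auto intro!: exI[of _ "\<lambda>k. b k + c k"])
    next
      fix c :: real and u assume "u \<in> ?T"
      then obtain b where "u = (\<lambda>x. \<Sum>k=1..D. b k * \<phi> k x)" by auto
      then have "c *\<^sub>R u = (\<lambda>x. \<Sum>k=1..D. (c * b k) * \<phi> k x)"
        by (auto simp: scaleR_fun_def sum_distrib_left mult.assoc)
      then show "c *\<^sub>R u \<in> ?T" by (auto intro!: exI[of _ "\<lambda>k. c * b k"])
    qed
  qed
  then show thesis using assms that by auto
qed

section \<open>Good events for scores and Gram matrices\<close>

context localized_family
begin

definition score :: "nat set \<Rightarrow> (nat \<Rightarrow> 'z) \<Rightarrow> nat \<Rightarrow> real" where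
  "score I \<omega> k = (\<Sum>i\<in>I. \<xi> (\<omega> i) * \<phi> k (\<omega> i)) / real (card I)"

text \<open>The part with \<open>D / sqrt l\<close> becomes a relative error once \<open>D\<close>
  is compared with \<open>noise_energy\<close>; the part with \<open>l ^ 3\<close> is the additive
  remainder of the oracle inequality.\<close>

definition "deviation = 24 * \<kappa> ^ 11 * (real D / sqrt l + l ^ 3) / real n"

definition score_good :: "nat set \<Rightarrow> (nat \<Rightarrow> 'z) \<Rightarrow> bool" where
  "score_good I \<omega> \<longleftrightarrow> \<bar>(\<Sum>k=1..D. (score I \<omega> k)\<^sup>2) - noise_energy / real (card I)\<bar> \<le> deviation"

definition gram_good :: "nat set \<Rightarrow> (nat \<Rightarrow> 'z) \<Rightarrow> bool" where
  "gram_good I \<omega> \<longleftrightarrow> (\<forall>\<beta>. (\<Sum>k=1..D. (\<Sum>j=1..D. gram I \<omega> k j * \<beta> j)\<^sup>2)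
      \<le> (3 * \<kappa> ^ 7 / sqrt l)\<^sup>2 * (\<Sum>j=1..D. (\<beta> j)\<^sup>2))"

lemma score_good_concentration:
  assumes "I \<subseteq> {1..n}" "real n \<le> \<kappa> * real (card I)" "t \<le> \<kappa> * l" "l ^ 3 \<le> real n"
  shows "with_prob_at_least (PiM {1..n} (\<lambda>_. P)) (1 - (real D * real n + 2) * (2 * exp (- t))) (score_good I)"
  using norm_concentration[OF assms(1,3)]
proof (rule with_prob_at_least_mono)
  fix \<omega>
  let ?N = "\<Sum>k=1..D. (\<Sum>i\<in>I. \<xi> (\<omega> i) * \<phi> k (\<omega> i))\<^sup>2"
  assume *: "\<bar>?N - real (card I) * noise_energy\<bar>
    \<le> 32 * \<kappa> ^ 9 * (sqrt (real D) * (real n * l)) + 8 * \<kappa> ^ 9 * (real D * (sqrt (real n) * l))"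
  define c where "c = real (card I)"
  have c: "0 < c" "real n \<le> \<kappa> * c" using assms(2) n_pos kappa by (cases "card I = 0"; auto simp: c_def)+
  have sq: "(\<Sum>k=1..D. (score I \<omega> k)\<^sup>2) = ?N / c\<^sup>2"
    by (simp only: score_def c_def power_divide sum_divide_distrib[symmetric])
  have "\<bar>?N / c\<^sup>2 - noise_energy / c\<bar> = \<bar>?N - c * noise_energy\<bar> / c\<^sup>2"
  proof -
    have "N / c\<^sup>2 - e / c = (N - c * e) / c\<^sup>2" for N e
      using c by (simp add: diff_divide_distrib power2_eq_square)
    then show ?thesis by (simp add: abs_divide)
  qed
  also have "\<dots> \<le> (32 * \<kappa> ^ 9 * (sqrt (real D) * (real n * l)) + 8 * \<kappa> ^ 9 * (real D * (sqrt (real n) * l))) / c\<^sup>2"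
    using * by (intro divide_right_mono) (auto simp: c_def)
  also have "\<dots> \<le> (24 * \<kappa> ^ 9 * (real n * (real D / sqrt l + l ^ 3))) / c\<^sup>2"
  proof (intro divide_right_mono)
    define q where "q = sqrt l"
    have q: "1 \<le> q" "l = q\<^sup>2" using l by (auto simp: q_def)
    define d where "d = sqrt (real D)"
    have d: "real D = d\<^sup>2" by (simp add: d_def)
    \<comment> \<open>Arithmetic-geometric mean for \<open>d = sqrt D\<close> and
      \<open>q ^ 3\<close>, divided by \<open>q = sqrt l\<close>: the chaos term is traded for a
      relative part and a pure power of \<open>l\<close>.\<close>
    have "2 * (d * l) \<le> real D / q + q ^ 5"
    proof -
      have "0 \<le> (d - q ^ 3)\<^sup>2" by simp
      then have "2 * d * q ^ 3 \<le> d\<^sup>2 + q ^ 6"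
        by (simp add: power2_diff power_mult[symmetric])
      then have "2 * d * q ^ 3 / q \<le> (d\<^sup>2 + q ^ 6) / q" using q by (intro divide_right_mono) auto
      moreover have "2 * d * q ^ 3 / q = 2 * (d * l)" using q by (simp add: power3_eq_cube power2_eq_square)
      moreover have "(d\<^sup>2 + q ^ 6) / q = real D / q + q ^ 5"
        using q d by (simp add: add_divide_distrib eval_nat_numeral One_nat_def)
      ultimately show ?thesis by simp
    qed
    also have "q ^ 5 \<le> l ^ 3"
      using q power_increasing[of 5 6 q] by (simp add: power_mult[symmetric])
    finally have 1: "2 * (sqrt (real D) * l) \<le> real D / sqrt l + l ^ 3" by (simp add: d_def q_def)
    \<comment> \<open>This is where \<open>l ^ 3 \<le> n\<close> is used; it is equivalent to
      \<open>sqrt n * l \<le> n / sqrt l\<close>.\<close>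
    have 2: "real D * (sqrt (real n) * l) \<le> real n * (real D / sqrt l + l ^ 3)"
    proof -
      have "q ^ 3 \<le> sqrt (real n)"
        using assms(4) q by (intro real_le_rsqrt) (simp add: power_mult[symmetric])
      then have "sqrt (real n) * q ^ 3 \<le> sqrt (real n) * sqrt (real n)" by (intro mult_left_mono) auto
      then have "sqrt (real n) * (l * q) \<le> real n" using q by (simp add: power3_eq_cube power2_eq_square)
      then have "sqrt (real n) * l \<le> real n / q" using q by (simp add: pos_le_divide_eq mult_ac)
      then have "real D * (sqrt (real n) * l) \<le> real D * (real n / q)" by (intro mult_left_mono) auto
      also have "\<dots> \<le> real n * (real D / sqrt l + l ^ 3)"
        using l by (simp add: q_def distrib_left mult.commute)
      finally show ?thesis .
    qed
    have "32 * \<kappa> ^ 9 * (sqrt (real D) * (real n * l)) = 16 * \<kappa> ^ 9 * (real n * (2 * (sqrt (real D) * l)))" by simp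
    also have "\<dots> \<le> 16 * \<kappa> ^ 9 * (real n * (real D / sqrt l + l ^ 3))"
      using 1 kappa by (intro mult_left_mono) auto
    finally have "32 * \<kappa> ^ 9 * (sqrt (real D) * (real n * l)) \<le> 16 * \<kappa> ^ 9 * (real n * (real D / sqrt l + l ^ 3))" .
    moreover have "8 * \<kappa> ^ 9 * (real D * (sqrt (real n) * l)) \<le> 8 * \<kappa> ^ 9 * (real n * (real D / sqrt l + l ^ 3))"
      using 2 kappa by (intro mult_left_mono) auto
    moreover have "x + x' \<le> 24 * c * y" if "x \<le> 16 * c * y" "x' \<le> 8 * c * y" for x x' c y :: real
      using that by simp
    ultimately show "32 * \<kappa> ^ 9 * (sqrt (real D) * (real n * l)) + 8 * \<kappa> ^ 9 * (real D * (sqrt (real n) * l))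
        \<le> 24 * \<kappa> ^ 9 * (real n * (real D / sqrt l + l ^ 3))" by blast
  qed auto
  also have "\<dots> = (24 * \<kappa> ^ 9 * (real D / sqrt l + l ^ 3)) * (real n / c\<^sup>2)" by simp
  also have "\<dots> \<le> (24 * \<kappa> ^ 9 * (real D / sqrt l + l ^ 3)) * (\<kappa>\<^sup>2 / real n)"
  proof (intro mult_left_mono)
    have "(real n)\<^sup>2 \<le> (\<kappa> * c)\<^sup>2" using c n_pos by (intro power_mono) auto
    then show "real n / c\<^sup>2 \<le> \<kappa>\<^sup>2 / real n" using c n_pos by (simp add: field_simps power2_eq_square)
  qed (use kappa l in auto)
  also have "\<dots> = deviation"
    by (simp add: deviation_def eval_nat_numeral One_nat_def)
  finally show "score_good I \<omega>" by (simp add: score_good_def sq c_def)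
qed simp

text \<open>Given the entries, Schur's bound is deterministic, so a union over \<open>D^2\<close>
  entries yields one event valid for all \<open>\<beta>\<close>, including data-dependent
  coefficient vectors.\<close>

lemma gram_good_concentration:
  assumes "I \<subseteq> {1..n}" "real n \<le> \<kappa> * real (card I)" "t \<le> \<kappa> * l"
  shows "with_prob_at_least (PiM {1..n} (\<lambda>_. P)) (1 - (real D * real D) * (2 * exp (- t))) (gram_good I)"
proof -
  interpret S: prob_space "PiM {1..n} (\<lambda>_. P)" by (rule prob_space_PiM) (rule prob_space_axioms)
  have "with_prob_at_least (PiM {1..n} (\<lambda>_. P)) (1 - real (card ({1..D} \<times> {1..D})) * (2 * exp (- t)))
     (\<lambda>\<omega>. \<forall>(k,j)\<in>{1..D} \<times> {1..D}. \<bar>\<Sum>i\<in>I. (\<phi> k (\<omega> i) * \<phi> j (\<omega> i) - (if k = j then 1 else 0))\<bar>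
        \<le> 3 * \<kappa> ^ 4 * (sqrt (real n * l) * sqrt (min (a k) (a j))))"
    by (rule S.with_prob_at_least_ball)
      (use gram_entry_concentration[OF _ _ assms(1,3)] in \<open>auto split del: if_split\<close>)
  then show ?thesis
  proof (rule with_prob_at_least_mono, goal_cases)
    case (2 \<omega>)
    then show ?case unfolding gram_good_def
      by (intro allI gram_norm_bound assms) (auto split del: if_split)
  qed simp
qed

end

section \<open>Averages over the folds\<close>

lemma sum_indexed_partition:
  fixes g :: "'a \<Rightarrow> real"
  assumes "indexed_partition J F S" "finite J" "finite S"
  shows "sum g S = (\<Sum>j\<in>J. sum g (F j))"
proof -
  have inj: "inj_on F J" and part: "partition_on S (F ` J)"
    using assms(1) by (auto simp: indexed_partition_def)
  have U: "(\<Union>j\<in>J. F j) = S" using part by (auto simp: partition_on_def)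
  have "sum g (\<Union>j\<in>J. F j) = (\<Sum>j\<in>J. sum g (F j))"
  proof (rule sum.UNION_disjoint)
    show "\<forall>i\<in>J. finite (F i)" using U assms(3) by (auto intro: finite_subset)
    show "\<forall>i\<in>J. \<forall>j\<in>J. i \<noteq> j \<longrightarrow> F i \<inter> F j = {}"
    proof (intro ballI impI)
      fix i j assume ij: "i \<in> J" "j \<in> J" "i \<noteq> j"
      then have "F i \<noteq> F j" using inj by (meson inj_onD)
      then show "F i \<inter> F j = {}"
        using part ij by (intro disjointD[of "F ` J"]) (auto simp: partition_on_def)
    qed
  qed (rule assms(2))
  then show ?thesis by (simp add: U)
qed

text \<open>Each observation belongs to \<open>V - 1\<close> complements, all of equal size. Applied
  to the contrast of the projection, this removes from the penalty everything that does not involve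
  the fold estimators.\<close>

lemma sum_emp_mean_leave_one_out:
  assumes B: "regular_partition n V B" and V: "2 \<le> V" and n: "0 < n"
  shows "(\<Sum>j=1..V. emp_mean ({1..n} - B j) \<omega> f) = real V * emp_mean {1..n} \<omega> f"
    and "\<And>j. j \<in> {1..V} \<Longrightarrow> B j \<subseteq> {1..n}"
    and "\<And>j. j \<in> {1..V} \<Longrightarrow> real (card (B j)) = real n / real V"
    and "\<And>j. j \<in> {1..V} \<Longrightarrow> real (card ({1..n} - B j)) = real n * (real V - 1) / real V"
proof -
  have part: "partition_on {1..n} (B ` {1..V})"
    using B by (auto simp: regular_partition_def indexed_partition_def)
  show sub: "B j \<subseteq> {1..n}" if "j \<in> {1..V}" for j
    using part that by (auto simp: partition_on_def)
  show cB: "real (card (B j)) = real n / real V" if "j \<in> {1..V}" for j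
    using B that by (auto simp: regular_partition_def)
  show cC: "real (card ({1..n} - B j)) = real n * (real V - 1) / real V" if "j \<in> {1..V}" for j
  proof -
    have "card ({1..n} - B j) = n - card (B j)"
      using sub[OF that] by (subst card_Diff_subset) (auto intro: finite_subset)
    moreover have "card (B j) \<le> n" using card_mono[OF _ sub[OF that]] by simp
    ultimately have "real (card ({1..n} - B j)) = real n - real n / real V"
      using cB[OF that] by (simp add: of_nat_diff)
    then show ?thesis using V by (simp add: field_simps)
  qed
  have "sum g {1..n} = (\<Sum>j=1..V. sum g (B j))" for g :: "nat \<Rightarrow> real"
    using B by (intro sum_indexed_partition) (auto simp: regular_partition_def)
  note S = this
  define T where "T = (\<Sum>i=1..n. f (\<omega> i))"
  have "(\<Sum>j=1..V. emp_mean ({1..n} - B j) \<omega> f)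
      = (\<Sum>j=1..V. (T - (\<Sum>i\<in>B j. f (\<omega> i))) * (real V / (real n * (real V - 1))))"
    using sub by (intro sum.cong refl) (simp add: emp_mean_def cC sum_diff T_def del: of_nat_diff)
  also have "\<dots> = (real V * T - T) * (real V / (real n * (real V - 1)))"
    unfolding sum_distrib_right[symmetric] sum_subtractf S[of "\<lambda>i. f (\<omega> i)", folded T_def, symmetric] by simp
  also have "\<dots> = real V * emp_mean {1..n} \<omega> f"
    using V n by (simp add: emp_mean_def T_def field_simps)
  finally show "(\<Sum>j=1..V. emp_mean ({1..n} - B j) \<omega> f) = real V * emp_mean {1..n} \<omega> f" .
qed

text \<open>
  \<open>N\<close>, \<open>N1\<close>, \<open>N2\<close> stand for the squared norms of the score vectors of the full sample, of the
  complement of a block and of the block itself, and \<open>X\<close> for the scalar product of the first two,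
  which polarization expresses through these norms.
\<close>

lemma fold_bracket_bound:
  fixes H N N1 N2 V :: real
  assumes V: "2 \<le> V" and \<delta>: "0 \<le> \<delta>" "\<delta> \<le> 1 / 6" and H: "0 \<le> H"
    and N: "\<bar>N - H\<bar> \<le> \<rho>" and N1: "\<bar>N1 - V / (V - 1) * H\<bar> \<le> \<rho>" and N2: "\<bar>N2 - V * H\<bar> \<le> \<rho>"
    and X: "N2 = V\<^sup>2 * N + (V - 1)\<^sup>2 * N1 - 2 * (V * (V - 1)) * X"
    and B: "\<bar>b - N1\<bar> \<le> 6 * \<delta> * N1" and p: "\<bar>p - N1\<bar> \<le> 4 * \<delta> * N1"
    and g: "\<bar>g\<bar> \<le> \<delta> * b" and e: "2 * \<bar>Y - X\<bar> \<le> \<delta> * (N + b)" and b: "b \<le> 2 * N1"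
  shows "\<bar>(b + g - 2 * Y + p) - 2 * H / (V - 1)\<bar> \<le> 37 * \<delta> * H + 10 * \<rho>"
proof -
  define W where "W = V * (V - 1)"
  have W: "2 \<le> W" using V mult_mono[of 2 V 1 "V - 1"] by (simp add: W_def)
  define n n1 n2 where "n = N - H" and "n1 = N1 - V / (V - 1) * H" and "n2 = N2 - V * H"
  have N': "N = H + n" "N1 = V / (V - 1) * H + n1" "N2 = V * H + n2" by (auto simp: n_def n1_def n2_def)
  have rho: "0 \<le> \<rho>" using N by linarith
  have "V\<^sup>2 * N + (V - 1)\<^sup>2 * N1 - N2 = 2 * X * W" using X by (simp add: W_def)
  then have "2 * X = (V\<^sup>2 * N + (V - 1)\<^sup>2 * N1 - N2) / W" using W by simp
  \<comment> \<open>The leading terms add up to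
    \<open>V^2 * H + V * (V - 1) * H - V * H = 2 * H * W\<close>: the scalar product
    \<open>X\<close> has the same leading value \<open>H\<close> as \<open>N\<close>.\<close>
  also have "\<dots> = 2 * H + (V\<^sup>2 / W) * n + ((V - 1)\<^sup>2 / W) * n1 - (1 / W) * n2"
  proof -
    have "(V - 1)\<^sup>2 * (V / (V - 1) * H) = (V - 1) * V * H" using V by (simp add: power2_eq_square)
    then have "V\<^sup>2 * N + (V - 1)\<^sup>2 * N1 - N2 = 2 * H * W + V\<^sup>2 * n + (V - 1)\<^sup>2 * n1 - n2"
      unfolding N' distrib_left by (simp add: W_def algebra_simps power2_eq_square)
    then show ?thesis using W by (simp add: add_divide_distrib diff_divide_distrib)
  qed
  finally have X': "2 * X = 2 * H + (V\<^sup>2 / W) * n + ((V - 1)\<^sup>2 / W) * n1 - (1 / W) * n2" .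
  have c1: "0 \<le> V\<^sup>2 / W" "V\<^sup>2 / W \<le> 2" using V W by (auto simp: W_def field_simps power2_eq_square)
  have "(V - 1)\<^sup>2 \<le> W" using V unfolding W_def power2_eq_square by (intro mult_right_mono) auto
  then have c2: "0 \<le> (V - 1)\<^sup>2 / W" "(V - 1)\<^sup>2 / W \<le> 1" using W by auto
  have c3: "0 \<le> 1 / W" "1 / W \<le> 1" using W by auto
  have ab: "\<bar>c * x\<bar> \<le> d * \<rho>" if "0 \<le> c" "c \<le> d" "\<bar>x\<bar> \<le> \<rho>" for c d x :: real
    using that by (auto simp: abs_mult intro: mult_mono)
  \<comment> \<open>The main term of a fold arises here as the difference of
    \<open>2 * V / (V - 1) * H\<close> and \<open>2 * H\<close>.\<close>
  have "2 * N1 - 2 * X - 2 * H / (V - 1) = 2 * n1 - (V\<^sup>2 / W) * n - ((V - 1)\<^sup>2 / W) * n1 + (1 / W) * n2"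
  proof -
    have "2 * (V / (V - 1) * H) = 2 * H + 2 * H / (V - 1)" using V by (simp add: field_simps)
    moreover have "2 * (r + n1) - (2 * H + x + y - z) - h = 2 * n1 - x - y + z"
      if "2 * r = 2 * H + h" for r h x y z :: real using that by simp
    ultimately show ?thesis unfolding X' N'(2) by blast
  qed
  \<comment> \<open>\<open>6 = 2 + 2 + 1 + 1\<close>, from the coefficients \<open>2\<close>,
    \<open>V\<^sup>2 / W\<close>, \<open>(V - 1)\<^sup>2 / W\<close> and
    \<open>1 / W\<close>.\<close>
  then have main: "\<bar>2 * N1 - 2 * X - 2 * H / (V - 1)\<bar> \<le> 6 * \<rho>"
    using ab[OF c1 N[folded n_def]] ab[OF c2 N1[folded n1_def]] ab[OF c3 N2[folded n2_def]] N1[folded n1_def]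
    by linarith
  have "V / (V - 1) \<le> 2" using V by (simp add: field_simps)
  then have "V / (V - 1) * H \<le> 2 * H" using H by (intro mult_right_mono) auto
  then have "N1 \<le> 2 * H + \<rho>" using N1 by linarith
  then have d1: "\<delta> * N1 \<le> 2 * (\<delta> * H) + \<delta> * \<rho>"
    using mult_left_mono[of N1 "2 * H + \<rho>" \<delta>] \<delta> by (simp add: algebra_simps)
  have d2: "\<delta> * N \<le> \<delta> * H + \<delta> * \<rho>"
    using mult_left_mono[of N "H + \<rho>" \<delta>] \<delta> N by (simp add: algebra_simps)
  have d3: "\<delta> * b \<le> 2 * (\<delta> * N1)" using mult_left_mono[OF b \<delta>(1)] by simp
  have dr: "\<delta> * \<rho> \<le> \<rho> / 6" using mult_right_mono[OF \<delta>(2) rho] by simp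
  have "\<bar>(b + g - 2 * Y + p) - (2 * N1 - 2 * X)\<bar> \<le> 10 * (\<delta> * N1) + 2 * (\<delta> * b) + \<delta> * N"
  proof -
    have "\<bar>(b + g - 2 * Y + p) - (2 * N1 - 2 * X)\<bar> \<le> \<bar>b - N1\<bar> + \<bar>p - N1\<bar> + \<bar>g\<bar> + 2 * \<bar>Y - X\<bar>" by (smt (verit))
    also have "\<dots> \<le> 6 * \<delta> * N1 + 4 * \<delta> * N1 + \<delta> * b + \<delta> * (N + b)" by (intro add_mono B p g e)
    also have "\<dots> = 10 * (\<delta> * N1) + 2 * (\<delta> * b) + \<delta> * N" by (simp add: algebra_simps)
    finally show ?thesis .
  qed
  then show ?thesis using main d1 d2 d3 dr unfolding mult.assoc by linarith
qed

text \<open>The abstract family specialized to observations: \<open>s\<close> plays the role of the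
  projection and its residual that of \<open>\<xi>\<close>. The lower bound on
  \<open>noise_energy\<close> is the form in which the noise level enters.\<close>

locale ls_model = localized_family P n \<kappa> l D "\<lambda>k z. \<phi> k (fst z)" "\<lambda>z. snd z - s (fst z)" a
  for P :: "obs measure" and n \<kappa> l D and \<phi> :: "nat \<Rightarrow> predictor" and s :: predictor and a +
  fixes m :: model
  assumes model: "subspace m" "span (\<phi> ` {1..D}) = m" "s \<in> m"
    and noise_energy_ge: "real D \<le> \<kappa> * noise_energy"
begin

definition combine :: "(nat \<Rightarrow> real) \<Rightarrow> predictor" where
  "combine \<beta> = (\<lambda>x. s x + (\<Sum>k=1..D. \<beta> k * \<phi> k x))"

lemma sum_product_div_card:
  assumes "0 < card J"
  shows "(\<Sum>i\<in>J. \<phi> k (fst (\<omega> i)) * \<phi> j (fst (\<omega> i))) / real (card J) = gram J \<omega> k j + (if k = j then 1 else 0)"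
  using assms by (simp add: gram_def sum_subtractf diff_divide_distrib)

text \<open>The empirical risk expanded around \<open>s\<close>: the score is the linear term,
  identity plus \<open>gram\<close> the quadratic form. As \<open>J\<close> and
  \<open>\<beta>\<close> are unrelated, it also evaluates an estimator on a sample other than the
  one it was trained on.\<close>

lemma emp_contrast_combine:
  assumes J: "0 < card J"
  shows "emp_mean J \<omega> (contrast (combine \<beta>)) = emp_mean J \<omega> (contrast s)
    - 2 * (\<Sum>k=1..D. \<beta> k * score J \<omega> k) + (\<Sum>k=1..D. \<beta> k * (\<beta> k + (\<Sum>j=1..D. gram J \<omega> k j * \<beta> j)))"
proof -
  let ?c = "real (card J)"
  define \<xi> where "\<xi> i = snd (\<omega> i) - s (fst (\<omega> i))" for i
  define f where "f i = (\<Sum>k=1..D. \<beta> k * \<phi> k (fst (\<omega> i)))" for i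
  have "contrast (combine \<beta>) (\<omega> i) = (\<xi> i)\<^sup>2 - 2 * (\<xi> i * f i) + (f i)\<^sup>2" for i
  proof -
    have "contrast (combine \<beta>) (\<omega> i) = (\<xi> i - f i)\<^sup>2"
      by (simp add: contrast_def case_prod_beta combine_def \<xi>_def f_def diff_diff_eq)
    then show ?thesis by (simp add: power2_diff)
  qed
  then have "emp_mean J \<omega> (contrast (combine \<beta>))
      = (\<Sum>i\<in>J. (\<xi> i)\<^sup>2) / ?c - 2 * ((\<Sum>i\<in>J. \<xi> i * f i) / ?c) + (\<Sum>i\<in>J. (f i)\<^sup>2) / ?c"
    by (simp add: emp_mean_def sum.distrib sum_subtractf sum_distrib_left[symmetric] add_divide_distrib diff_divide_distrib)
  also have "(\<Sum>i\<in>J. (\<xi> i)\<^sup>2) / ?c = emp_mean J \<omega> (contrast s)"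
    by (simp add: emp_mean_def contrast_def case_prod_beta \<xi>_def)
  also have "(\<Sum>i\<in>J. \<xi> i * f i) / ?c = (\<Sum>k=1..D. \<beta> k * score J \<omega> k)"
  proof -
    have "(\<Sum>i\<in>J. \<xi> i * f i) = (\<Sum>i\<in>J. \<Sum>k=1..D. \<beta> k * (\<xi> i * \<phi> k (fst (\<omega> i))))"
      by (simp add: f_def sum_distrib_left mult_ac)
    also have "\<dots> = (\<Sum>k=1..D. \<beta> k * (\<Sum>i\<in>J. \<xi> i * \<phi> k (fst (\<omega> i))))"
      by (subst sum.swap) (simp add: sum_distrib_left)
    finally show ?thesis
      unfolding score_def times_divide_eq_right sum_divide_distrib[symmetric] by (simp add: \<xi>_def)
  qed
  also have "(\<Sum>i\<in>J. (f i)\<^sup>2) / ?c = (\<Sum>k=1..D. \<beta> k * (\<beta> k + (\<Sum>j=1..D. gram J \<omega> k j * \<beta> j)))"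
  proof -
    have "(\<Sum>i\<in>J. (f i)\<^sup>2) = (\<Sum>i\<in>J. \<Sum>k=1..D. \<Sum>j=1..D. \<beta> k * \<beta> j * (\<phi> k (fst (\<omega> i)) * \<phi> j (fst (\<omega> i))))"
      by (simp add: f_def power2_eq_square sum_product mult_ac)
    also have "\<dots> = (\<Sum>k=1..D. \<Sum>j=1..D. \<beta> k * \<beta> j * (\<Sum>i\<in>J. \<phi> k (fst (\<omega> i)) * \<phi> j (fst (\<omega> i))))"
      unfolding sum_distrib_left by (subst sum.swap, rule sum.cong[OF refl], rule sum.swap)
    finally have "(\<Sum>i\<in>J. (f i)\<^sup>2) / ?c = (\<Sum>k=1..D. \<Sum>j=1..D. \<beta> k * \<beta> j * (gram J \<omega> k j + (if k = j then 1 else 0)))"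
      unfolding sum_product_div_card[OF J, symmetric] times_divide_eq_right sum_divide_distrib[symmetric] by simp
    also have "\<dots> = (\<Sum>k=1..D. \<beta> k * (\<beta> k + (\<Sum>j=1..D. gram J \<omega> k j * \<beta> j)))"
    proof (rule sum.cong[OF refl])
      fix k assume k: "k \<in> {1..D}"
      have "(\<Sum>j=1..D. \<beta> k * \<beta> j * (gram J \<omega> k j + (if k = j then 1 else 0)))
         = (\<Sum>j=1..D. \<beta> k * \<beta> j * gram J \<omega> k j) + (\<Sum>j=1..D. if k = j then \<beta> k * \<beta> j else 0)"
        unfolding sum.distrib[symmetric] by (intro sum.cong) (auto simp: algebra_simps)
      also have "\<dots> = \<beta> k * (\<beta> k + (\<Sum>j=1..D. gram J \<omega> k j * \<beta> j))"
        using k by (simp add: distrib_left sum_distrib_left mult_ac)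
      finally show "(\<Sum>j=1..D. \<beta> k * \<beta> j * (gram J \<omega> k j + (if k = j then 1 else 0)))
         = \<beta> k * (\<beta> k + (\<Sum>j=1..D. gram J \<omega> k j * \<beta> j))" .
    qed
    finally show ?thesis .
  qed
  finally show ?thesis by simp
qed

text \<open>The normal equations tested on each basis function, for the coefficients that the given
  minimizer happens to have relative to \<open>s\<close>.\<close>

lemma least_squares_system:
  assumes "is_least_squares I \<omega> m t" "0 < card I"
  obtains \<beta> where "t = combine \<beta>"
    and "\<And>k. k \<in> {1..D} \<Longrightarrow> score I \<omega> k = \<beta> k + (\<Sum>j=1..D. gram I \<omega> k j * \<beta> j)"
proof -
  have "t \<in> m" using assms(1) by (auto simp: is_least_squares_def is_arg_min_def)
  then have "t - s \<in> span (\<phi> ` {1..D})" using model subspace_diff by auto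
  then obtain \<beta> where \<beta>: "t - s = (\<lambda>x. \<Sum>k=1..D. \<beta> k * \<phi> k x)" by (rule span_image_eq_combination)
  have t: "t = combine \<beta>" using fun_cong[OF \<beta>] by (auto simp: combine_def fun_eq_iff algebra_simps)
  have fin: "finite I" "I \<noteq> {}" using assms(2) by (auto simp: card_gt_0_iff)
  have "score I \<omega> k = \<beta> k + (\<Sum>j=1..D. gram I \<omega> k j * \<beta> j)" if k: "k \<in> {1..D}" for k
  proof -
    have "\<phi> k \<in> m" using model(2) k span_base[of "\<phi> k" "\<phi> ` {1..D}"] by auto
    note zero = least_squares_orthogonality[OF assms(1) model(1) this fin, unfolded t]
    have split: "(snd (\<omega> i) - combine \<beta> (fst (\<omega> i))) * \<phi> k (fst (\<omega> i)) =
        (snd (\<omega> i) - s (fst (\<omega> i))) * \<phi> k (fst (\<omega> i)) - (\<Sum>j=1..D. \<beta> j * (\<phi> k (fst (\<omega> i)) * \<phi> j (fst (\<omega> i))))" for i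
    proof -
      have "(\<Sum>j=1..D. \<beta> j * (\<phi> k (fst (\<omega> i)) * \<phi> j (fst (\<omega> i)))) = (\<Sum>j=1..D. \<beta> j * \<phi> j (fst (\<omega> i))) * \<phi> k (fst (\<omega> i))"
        unfolding sum_distrib_right by (intro sum.cong) (auto simp: mult_ac)
      then show ?thesis by (simp add: combine_def algebra_simps)
    qed
    have "(\<Sum>i\<in>I. (snd (\<omega> i) - s (fst (\<omega> i))) * \<phi> k (fst (\<omega> i)))
        = (\<Sum>i\<in>I. \<Sum>j=1..D. \<beta> j * (\<phi> k (fst (\<omega> i)) * \<phi> j (fst (\<omega> i))))"
      using zero unfolding split sum_subtractf by linarith
    also have "\<dots> = (\<Sum>j=1..D. \<beta> j * (\<Sum>i\<in>I. \<phi> k (fst (\<omega> i)) * \<phi> j (fst (\<omega> i))))"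
      by (subst sum.swap) (simp add: sum_distrib_left)
    finally have "score I \<omega> k = (\<Sum>j=1..D. \<beta> j * (gram I \<omega> k j + (if k = j then 1 else 0)))"
      unfolding score_def sum_product_div_card[OF assms(2), symmetric] times_divide_eq_right sum_divide_distrib[symmetric]
      by simp
    also have "\<dots> = (\<Sum>j=1..D. \<beta> j * gram I \<omega> k j) + (\<Sum>j=1..D. if k = j then \<beta> j else 0)"
      unfolding sum.distrib[symmetric] by (intro sum.cong) (auto simp: algebra_simps)
    finally show ?thesis using k by (simp add: mult_ac)
  qed
  then show thesis using that t by auto
qed

end

section \<open>Risk and V-fold criterion on the good events\<close>

context ls_model
begin

lemma vfold_criterion_bounds:
  fixes V :: nat and tV :: "nat \<Rightarrow> predictor"
  defines "\<delta> \<equiv> 3 * \<kappa> ^ 7 / sqrt l" and "H \<equiv> noise_energy / real n"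
  assumes \<delta>: "\<delta> \<le> 1 / 6" and V: "2 \<le> V" "real V \<le> \<kappa>" and B: "regular_partition n V B"
    and full: "score_good {1..n} \<omega>" "gram_good {1..n} \<omega>"
    and folds: "\<And>j. j \<in> {1..V} \<Longrightarrow> score_good (B j) \<omega>"
      "\<And>j. j \<in> {1..V} \<Longrightarrow> score_good ({1..n} - B j) \<omega>" "\<And>j. j \<in> {1..V} \<Longrightarrow> gram_good ({1..n} - B j) \<omega>"
    and t: "is_least_squares {1..n} \<omega> m t"
    and tV: "\<And>j. j \<in> {1..V} \<Longrightarrow> is_least_squares ({1..n} - B j) \<omega> m (tV j)"
  obtains \<beta> where "t = combine \<beta>" "\<bar>(\<Sum>k=1..D. (\<beta> k)\<^sup>2) - H\<bar> \<le> 6 * \<delta> * H + 2 * deviation"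
    and "\<bar>emp_mean {1..n} \<omega> (contrast t) + pen_VF n V B \<omega> tV - emp_mean {1..n} \<omega> (contrast s) - H\<bar>
      \<le> \<kappa> * (41 * \<delta> * H + 12 * deviation)"
proof -
  define \<rho> where "\<rho> = deviation"
  have \<delta>0: "0 \<le> \<delta>" using kappa l by (simp add: \<delta>_def)
  have H: "0 \<le> H" using noise_energy_nonneg by (simp add: H_def)
  have \<rho>: "0 \<le> \<rho>" using kappa l by (simp add: \<rho>_def deviation_def)
  have n0: "0 < n" using n_pos by simp
  note fold = sum_emp_mean_leave_one_out[OF B V(1) n0]
  have Vr: "2 \<le> real V" using V by simp
  have gg: "(\<Sum>k=1..D. (\<Sum>j=1..D. gram I \<omega> k j * \<beta> j)\<^sup>2) \<le> \<delta>\<^sup>2 * (\<Sum>j=1..D. (\<beta> j)\<^sup>2)" if "gram_good I \<omega>" for I \<beta>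
    using that by (auto simp: gram_good_def \<delta>_def)
  define v where "v = score {1..n} \<omega>"
  define N where "N = (\<Sum>k=1..D. (v k)\<^sup>2)"
  have N: "\<bar>N - H\<bar> \<le> \<rho>" using full(1) by (simp add: score_good_def N_def v_def H_def \<rho>_def)
  have N0: "0 \<le> N" by (auto simp: N_def intro: sum_nonneg)
  obtain \<beta> where \<beta>: "t = combine \<beta>" and sys: "\<And>k. k \<in> {1..D} \<Longrightarrow> v k = \<beta> k + (\<Sum>j=1..D. gram {1..n} \<omega> k j * \<beta> j)"
    using least_squares_system[OF t] n0 unfolding v_def by auto
  note nis = near_identity_system[OF sys gg[OF full(2)] \<delta>0 \<delta>, folded N_def]
  have \<delta>N: "\<delta> * N \<le> \<delta> * H + \<rho> / 6"
  proof -
    have "\<delta> * N \<le> \<delta> * (H + \<rho>)" using N \<delta>0 by (intro mult_left_mono) auto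
    also have "\<dots> \<le> \<delta> * H + \<rho> / 6" using mult_right_mono[OF \<delta> \<rho>] by (simp add: distrib_left)
    finally show ?thesis .
  qed
  have risk: "\<bar>(\<Sum>k=1..D. (\<beta> k)\<^sup>2) - H\<bar> \<le> 6 * \<delta> * H + 2 * deviation"
    using nis(2) N \<delta>N unfolding \<rho>_def[symmetric] mult.assoc by linarith
  \<comment> \<open>On the training sample the normal equations make the quadratic form equal to the
    scalar product of \<open>v\<close> and \<open>\<beta>\<close>, which cancels half of the linear
    term.\<close>
  have emp_t: "emp_mean {1..n} \<omega> (contrast t) = emp_mean {1..n} \<omega> (contrast s) - (\<Sum>k=1..D. v k * \<beta> k)"
  proof -
    have "(\<Sum>k=1..D. \<beta> k * (\<beta> k + (\<Sum>j=1..D. gram {1..n} \<omega> k j * \<beta> j))) = (\<Sum>k=1..D. v k * \<beta> k)"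
      using sys by (intro sum.cong) (auto simp: mult.commute)
    then show ?thesis unfolding \<beta> using emp_contrast_combine[of "{1..n}" \<omega> \<beta>] n0
      by (simp add: v_def[symmetric] mult.commute[of "\<beta> _" "v _"])
  qed
  have p2: "\<bar>(\<Sum>k=1..D. v k * \<beta> k) - H\<bar> \<le> 4 * (\<delta> * H) + 2 * \<rho>"
    using nis(3) N \<delta>N \<rho> unfolding mult.assoc by linarith
  define \<epsilon> where "\<epsilon> = 37 * \<delta> * H + 10 * \<rho>"
  \<comment> \<open>The fold estimator is evaluated on two samples. On its own sample the normal
    equations collapse the expansion to \<open>- p\<close>; on the full one the scalar product
    \<open>Y\<close> and the quadratic form \<open>bb + g\<close> remain.\<close>
  have bracket: "\<exists>x. emp_mean {1..n} \<omega> (contrast (tV j)) - emp_mean ({1..n} - B j) \<omega> (contrast (tV j)) =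
        emp_mean {1..n} \<omega> (contrast s) - emp_mean ({1..n} - B j) \<omega> (contrast s) + x
        \<and> \<bar>x - 2 * H / (real V - 1)\<bar> \<le> \<epsilon>" if j: "j \<in> {1..V}" for j
  proof -
    let ?C = "{1..n} - B j"
    have cC: "real (card ?C) = real n * (real V - 1) / real V" and cB: "real (card (B j)) = real n / real V"
      using fold(3,4) j by auto
    have pos: "0 < real (card ?C)" "0 < real (card (B j))" using cC cB n_pos Vr by auto
    define v1 v2 where "v1 = score ?C \<omega>" and "v2 = score (B j) \<omega>"
    define N1 N2 where "N1 = (\<Sum>k=1..D. (v1 k)\<^sup>2)" and "N2 = (\<Sum>k=1..D. (v2 k)\<^sup>2)"
    have "noise_energy / (real n * (real V - 1) / real V) = real V / (real V - 1) * H"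
      "noise_energy / (real n / real V) = real V * H" by (simp_all add: H_def mult_ac)
    then have N1: "\<bar>N1 - real V / (real V - 1) * H\<bar> \<le> \<rho>" and N2: "\<bar>N2 - real V * H\<bar> \<le> \<rho>"
      using folds(1,2)[OF j] unfolding score_good_def cC cB by (auto simp: N1_def N2_def v1_def v2_def \<rho>_def)
    \<comment> \<open>The full score is the mean of the scores of block and complement with weights
      \<open>1 / V\<close> and \<open>(V - 1) / V\<close>. Solved for the block, it lets three
      concentrating norms determine the scalar product of the dependent vectors \<open>v\<close> and
      \<open>v1\<close>.\<close>
    have v2: "v2 k = real V * v k - (real V - 1) * v1 k" for k
    proof -
      let ?f = "\<lambda>i. (snd (\<omega> i) - s (fst (\<omega> i))) * \<phi> k (fst (\<omega> i))"
      have "sum ?f {1..n} = sum ?f ?C + sum ?f (B j)"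
        using fold(2)[OF j] by (simp add: sum.subset_diff)
      moreover have "x / (real n / real V) = real V * ((y + x) / real n) - (real V - 1) * (y / (real n * (real V - 1) / real V))" for x y
        using n_pos Vr by (simp add: field_simps)
      ultimately show ?thesis unfolding v1_def v2_def v_def score_def cC cB by simp
    qed
    define X where "X = (\<Sum>k=1..D. v k * v1 k)"
    have X: "N2 = (real V)\<^sup>2 * N + (real V - 1)\<^sup>2 * N1 - 2 * (real V * (real V - 1)) * X"
    proof -
      have "(x * v k - y * v1 k)\<^sup>2 = x\<^sup>2 * (v k)\<^sup>2 + y\<^sup>2 * (v1 k)\<^sup>2 - 2 * (x * y) * (v k * v1 k)" for x y k
        by (simp add: power2_eq_square algebra_simps)
      then show ?thesis unfolding N2_def v2 N_def N1_def X_def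
        by (simp only: sum.distrib sum_subtractf sum_distrib_left)
    qed
    have "0 < card ?C" using pos(1) by simp
    with least_squares_system[OF tV[OF j]] obtain b where b: "tV j = combine b"
      and sysj: "\<And>k. k \<in> {1..D} \<Longrightarrow> v1 k = b k + (\<Sum>i=1..D. gram ?C \<omega> k i * b i)"
      unfolding v1_def by auto
    note nisj = near_identity_system[OF sysj gg[OF folds(3)[OF j]] \<delta>0 \<delta>, folded N1_def]
    define bb where "bb = (\<Sum>k=1..D. (b k)\<^sup>2)"
    define g where "g = (\<Sum>k=1..D. b k * (\<Sum>i=1..D. gram {1..n} \<omega> k i * b i))"
    define Y where "Y = (\<Sum>k=1..D. b k * v k)"
    define p where "p = (\<Sum>k=1..D. v1 k * b k)"
    have bb0: "0 \<le> bb" by (auto simp: bb_def intro: sum_nonneg)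
    have "g\<^sup>2 \<le> bb * (\<Sum>k=1..D. (\<Sum>i=1..D. gram {1..n} \<omega> k i * b i)\<^sup>2)"
      unfolding g_def bb_def by (rule Cauchy_Schwarz_ineq_sum)
    also have "\<dots> \<le> bb * (\<delta>\<^sup>2 * bb)" unfolding bb_def by (intro mult_left_mono gg full(2) sum_nonneg) auto
    also have "\<dots> = (\<delta> * bb)\<^sup>2" by (simp add: power2_eq_square)
    finally have g: "\<bar>g\<bar> \<le> \<delta> * bb" using abs_le_square_iff[of g "\<delta> * bb"] \<delta>0 bb0 by simp
    have "(X - Y)\<^sup>2 = (\<Sum>k=1..D. v k * (v1 k - b k))\<^sup>2"
      by (simp add: X_def Y_def sum_subtractf[symmetric] right_diff_distrib mult.commute)
    also have "\<dots> \<le> N * (\<Sum>k=1..D. (v1 k - b k)\<^sup>2)" unfolding N_def by (rule Cauchy_Schwarz_ineq_sum)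
    also have "\<dots> \<le> N * (\<delta>\<^sup>2 * bb)" using nisj(1) N0 unfolding bb_def by (intro mult_left_mono)
    finally have XY: "(X - Y)\<^sup>2 \<le> N * (\<delta>\<^sup>2 * bb)" .
    \<comment> \<open>Cauchy-Schwarz has bounded the difference by
      \<open>\<delta> * sqrt (N * bb)\<close>; the geometric mean is now replaced by the arithmetic
      one, comparing squares to avoid roots.\<close>
    have "(2 * (X - Y))\<^sup>2 = 4 * (X - Y)\<^sup>2" by (simp only: power_mult_distrib) simp
    also have "\<dots> \<le> 4 * (N * (\<delta>\<^sup>2 * bb))" using XY by simp
    also have "\<dots> = \<delta>\<^sup>2 * (4 * (N * bb))" by simp
    also have "\<dots> \<le> \<delta>\<^sup>2 * (N + bb)\<^sup>2"
    proof (intro mult_left_mono)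
      have "0 \<le> (N - bb)\<^sup>2" by simp
      then show "4 * (N * bb) \<le> (N + bb)\<^sup>2" by (simp add: power2_eq_square algebra_simps)
    qed simp
    also have "\<dots> = (\<delta> * (N + bb))\<^sup>2" by (simp add: power_mult_distrib)
    finally have "\<bar>2 * (X - Y)\<bar> \<le> \<bar>\<delta> * (N + bb)\<bar>" by (subst abs_le_square_iff)
    then have e: "2 * \<bar>Y - X\<bar> \<le> \<delta> * (N + bb)"
      using \<delta>0 bb0 N0 by (simp only: abs_mult abs_minus_commute[of X Y])
    have "\<bar>(bb + g - 2 * Y + p) - 2 * H / (real V - 1)\<bar> \<le> \<epsilon>"
      unfolding \<epsilon>_def
      by (rule fold_bracket_bound[OF Vr \<delta>0 \<delta> H N N1 N2 X _ _ g e])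
        (use nisj in \<open>simp_all add: bb_def p_def\<close>)
    moreover have "emp_mean {1..n} \<omega> (contrast (tV j)) = emp_mean {1..n} \<omega> (contrast s) - 2 * Y + (bb + g)"
    proof -
      have "(\<Sum>k=1..D. b k * (b k + (\<Sum>i=1..D. gram {1..n} \<omega> k i * b i))) = bb + g"
        by (simp add: bb_def g_def distrib_left sum.distrib power2_eq_square)
      then show ?thesis unfolding b Y_def v_def using emp_contrast_combine[of "{1..n}" \<omega> b] n0 by simp
    qed
    moreover have "emp_mean ?C \<omega> (contrast (tV j)) = emp_mean ?C \<omega> (contrast s) - p"
    proof -
      have "(\<Sum>k=1..D. b k * (b k + (\<Sum>i=1..D. gram ?C \<omega> k i * b i))) = p"
        unfolding p_def using sysj by (intro sum.cong) (auto simp: mult.commute)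
      moreover have "(\<Sum>k=1..D. b k * score ?C \<omega> k) = p" by (simp add: p_def v1_def mult.commute)
      ultimately show ?thesis unfolding b using emp_contrast_combine[OF \<open>0 < card ?C\<close>, of \<omega> b] by simp
    qed
    ultimately show ?thesis by (intro exI[of _ "bb + g - 2 * Y + p"]) auto
  qed
  then obtain x where x: "\<And>j. j \<in> {1..V} \<Longrightarrow>
      emp_mean {1..n} \<omega> (contrast (tV j)) - emp_mean ({1..n} - B j) \<omega> (contrast (tV j)) =
        emp_mean {1..n} \<omega> (contrast s) - emp_mean ({1..n} - B j) \<omega> (contrast s) + x j"
      "\<And>j. j \<in> {1..V} \<Longrightarrow> \<bar>x j - 2 * H / (real V - 1)\<bar> \<le> \<epsilon>"
    by metis
  have "pen_VF n V B \<omega> tV = (real V - 1) / real V * (\<Sum>j=1..V.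
      emp_mean {1..n} \<omega> (contrast s) - emp_mean ({1..n} - B j) \<omega> (contrast s) + x j)"
    unfolding pen_VF_def using x(1) by (intro arg_cong2[where f="(*)"] sum.cong) auto
  also have "\<dots> = (real V - 1) / real V * (\<Sum>j=1..V. x j)"
    using fold(1)[of \<omega> "contrast s"] by (simp add: sum.distrib sum_subtractf)
  \<comment> \<open>\<open>(V - 1) / V\<close> times \<open>V\<close> copies of
    \<open>2 * H / (V - 1)\<close> is \<open>2 * H\<close>: the normalization of the penalty makes
    its leading term independent of \<open>V\<close>.\<close>
  also have "\<dots> = (real V - 1) / real V * (\<Sum>j=1..V. x j - 2 * H / (real V - 1)) + 2 * H"
    using Vr by (simp add: sum_subtractf right_diff_distrib)
  finally have "\<bar>pen_VF n V B \<omega> tV - 2 * H\<bar> = (real V - 1) / real V * \<bar>\<Sum>j=1..V. x j - 2 * H / (real V - 1)\<bar>"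
    using Vr by (simp add: abs_mult)
  also have "\<dots> \<le> (real V - 1) / real V * (\<Sum>j=1..V. \<epsilon>)"
  proof (intro mult_left_mono)
    show "\<bar>\<Sum>j=1..V. x j - 2 * H / (real V - 1)\<bar> \<le> (\<Sum>j=1..V. \<epsilon>)"
      using x(2) by (intro order_trans[OF sum_abs] sum_mono)
  qed (use Vr in auto)
  also have "\<dots> = (real V - 1) * \<epsilon>" using Vr by simp
  also have "\<dots> \<le> \<kappa> * \<epsilon>"
    using V \<delta>0 H \<rho> by (intro mult_right_mono) (auto simp: \<epsilon>_def)
  finally have pen: "\<bar>pen_VF n V B \<omega> tV - 2 * H\<bar> \<le> \<kappa> * \<epsilon>" .
  have sum: "1 * (4 * (\<delta> * H) + 2 * \<rho>) \<le> \<kappa> * (4 * (\<delta> * H) + 2 * \<rho>)"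
    using kappa \<delta>0 H \<rho> by (intro mult_right_mono) auto
  have total: "\<kappa> * \<epsilon> + \<kappa> * (4 * (\<delta> * H) + 2 * \<rho>) = \<kappa> * (41 * \<delta> * H + 12 * \<rho>)"
    by (simp add: \<epsilon>_def algebra_simps)
  have "\<bar>emp_mean {1..n} \<omega> (contrast t) + pen_VF n V B \<omega> tV - emp_mean {1..n} \<omega> (contrast s) - H\<bar>
      \<le> \<kappa> * (41 * \<delta> * H + 12 * \<rho>)"
  proof -
    have "\<bar>e - S + p - e - h\<bar> \<le> c" if "1 * x \<le> y" "k + y = c" "\<bar>p - 2 * h\<bar> \<le> k" "\<bar>S - h\<bar> \<le> x"
      for e S p h c x y k :: real using that by linarith
    from this[OF sum total pen p2] show ?thesis unfolding emp_t .
  qed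
  with \<beta> risk show thesis using that by (simp add: \<rho>_def)
qed

end

section \<open>Consequences of the regression setting\<close>

lemma sup_norm_on_le_iff:
  assumes "0 \<le> c"
  shows "sup_norm_on \<X> f \<le> ennreal c \<longleftrightarrow> (\<forall>x\<in>\<X>. \<bar>f x\<bar> \<le> c)"
  using assms by (auto simp: sup_norm_on_def SUP_le_iff ennreal_le_iff)

section \<open>Conditional moments of the noise and boundedness of the regression function\<close>

locale regression =
  fixes d \<X> P s\<^sub>0 \<sigma> \<epsilon> and A \<sigma>\<^sub>m :: real
  assumes setting: "regression_setting d \<X> P s\<^sub>0 \<sigma> \<epsilon>"
    and response_bound: "AE z in P. \<bar>snd z\<bar> \<le> A"
    and noise_level: "0 < \<sigma>\<^sub>m" "AE z in P. \<sigma>\<^sub>m \<le> \<sigma> (fst z)"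

sublocale regression \<subseteq> prob_space P
  using setting by (simp add: regression_setting_def)

context regression
begin

abbreviation "X \<equiv> covariate_space d \<X>"
abbreviation "\<mu> \<equiv> covariate_law d \<X> P"
abbreviation "F \<equiv> covariate_algebra d \<X> P"

lemma sets_P: "sets P = sets (X \<Otimes>\<^sub>M borel)"
  using setting by (simp add: regression_setting_def)

lemma space_X: "space X = \<X>"
  using setting by (auto simp: covariate_space_def space_restrict_space space_PiM regression_setting_def)

lemma space_P: "space P = \<X> \<times> UNIV"
  using sets_eq_imp_space_eq[OF sets_P] by (simp add: space_pair_measure space_X)

lemma fst_measurable[measurable]: "fst \<in> P \<rightarrow>\<^sub>M X"
  by (simp add: measurable_cong_sets[OF sets_P refl])

lemma snd_measurable[measurable]: "snd \<in> borel_measurable P"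
  by (simp add: measurable_cong_sets[OF sets_P refl])

lemma sets_mu: "sets \<mu> = sets X" by (simp add: covariate_law_def)

lemma measurable_mu: "borel_measurable \<mu> = borel_measurable X"
  by (rule measurable_cong_sets[OF sets_mu refl])

lemma s0_measurable[measurable]: "s\<^sub>0 \<in> borel_measurable X"
  using setting by (simp add: regression_setting_def L2_space_def measurable_mu[symmetric])

lemma sigma_measurable[measurable]: "\<sigma> \<in> borel_measurable X"
  using setting by (simp add: regression_setting_def)

lemma eps_measurable[measurable]: "\<epsilon> \<in> borel_measurable P"
  using setting by (simp add: regression_setting_def)

lemma sigma_nonneg: "x \<in> \<X> \<Longrightarrow> 0 \<le> \<sigma> x"
  using setting by (simp add: regression_setting_def)

lemma response: "AE z in P. snd z - s\<^sub>0 (fst z) = \<sigma> (fst z) * \<epsilon> z"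
proof -
  have "AE z in P. snd z = s\<^sub>0 (fst z) + \<sigma> (fst z) * \<epsilon> z"
    using setting by (simp add: regression_setting_def)
  then show ?thesis by eventually_elim simp
qed

lemma integral_mu: "g \<in> borel_measurable X \<Longrightarrow> (\<integral>x. g x \<partial>\<mu>) = (\<integral>z. g (fst z) \<partial>P)" for g :: "point \<Rightarrow> real"
  unfolding covariate_law_def by (rule integral_distr) measurable

lemma subalgebra_F: "subalgebra P F"
  unfolding subalgebra_def covariate_algebra_def using sets_image_in_sets[OF refl fst_measurable] by auto

end

sublocale regression \<subseteq> cond: finite_measure_subalgebra P F
  by unfold_locales (rule subalgebra_F)

context regression
begin

lemma covariate_measurable_F: "g \<in> borel_measurable X \<Longrightarrow> (\<lambda>z. g (fst z)) \<in> borel_measurable F"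
  unfolding covariate_algebra_def
  by (rule measurable_compose[OF measurable_vimage_algebra1]) (auto simp: space_P space_X)

text \<open>\<open>real_cond_exp\<close> is total, so the hypothesis on the conditional second
  moment does not assert integrability. But it is the difference of the \<open>enn2real\<close>
  values for positive and negative part; the negative part is zero here and \<open>enn2real\<close>
  sends infinity to 0, so the value 1 forces the nonnegative conditional expectation to be 1, and
  that integrates to the second moment.\<close>

lemma eps_square_integrable: "integrable P (\<lambda>z. (\<epsilon> z)\<^sup>2)"
proof -
  have "AE z in P. real_cond_exp P F (\<lambda>w. (\<epsilon> w)\<^sup>2) z = 1"
    using setting by (simp add: regression_setting_def)
  moreover have "AE z in P. nn_cond_exp P F (\<lambda>w. ennreal (- (\<epsilon> w)\<^sup>2)) z = 0"
  proof -
    have "(\<lambda>w. ennreal (- (\<epsilon> w)\<^sup>2)) = (\<lambda>_. 0)" by (simp add: ennreal_neg fun_eq_iff)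
    moreover have "AE z in P. 0 = nn_cond_exp P F (\<lambda>_. 0) z" by (rule cond.nn_cond_exp_F_meas) simp
    ultimately show ?thesis by (auto simp: eq_commute[of 0])
  qed
  ultimately have one: "AE z in P. nn_cond_exp P F (\<lambda>w. ennreal ((\<epsilon> w)\<^sup>2)) z = 1"
  proof eventually_elim
    case (elim z)
    then have "enn2real (nn_cond_exp P F (\<lambda>w. ennreal ((\<epsilon> w)\<^sup>2)) z) = 1"
      by (simp add: real_cond_exp_def)
    then show ?case by (cases "nn_cond_exp P F (\<lambda>w. ennreal ((\<epsilon> w)\<^sup>2)) z") auto
  qed
  have "(\<integral>\<^sup>+z. ennreal ((\<epsilon> z)\<^sup>2) \<partial>P) = (\<integral>\<^sup>+z. nn_cond_exp P F (\<lambda>w. ennreal ((\<epsilon> w)\<^sup>2)) z \<partial>P)"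
    using cond.nn_cond_exp_intg[of "\<lambda>_. 1" "\<lambda>w. ennreal ((\<epsilon> w)\<^sup>2)"] by simp
  also have "\<dots> = (\<integral>\<^sup>+z. 1 \<partial>P)" using one by (rule nn_integral_cong_AE)
  finally show ?thesis by (intro integrableI_bounded) (auto simp: emeasure_space_1)
qed

lemma noise_conditional_mean:
  assumes [measurable]: "h \<in> borel_measurable X" and "integrable P (\<lambda>z. h (fst z) * \<epsilon> z)"
  shows "(\<integral>z. h (fst z) * \<epsilon> z \<partial>P) = 0"
proof -
  have "(\<integral>z. h (fst z) * \<epsilon> z \<partial>P) = (\<integral>z. h (fst z) * real_cond_exp P F \<epsilon> z \<partial>P)"
    by (rule cond.real_cond_exp_intg(2)[symmetric]) (use assms covariate_measurable_F[OF assms(1)] in auto)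
  also have "\<dots> = (\<integral>z. 0 \<partial>P)"
  proof (rule integral_cong_AE)
    have "AE z in P. real_cond_exp P F \<epsilon> z = 0" using setting by (simp add: regression_setting_def)
    then show "AE z in P. h (fst z) * real_cond_exp P F \<epsilon> z = 0" by eventually_elim simp
  qed (use borel_measurable_cond_exp2[of P F \<epsilon>] in measurable)
  finally show ?thesis by simp
qed

lemma noise_conditional_variance:
  assumes [measurable]: "h \<in> borel_measurable X" and h: "AE z in P. \<bar>h (fst z)\<bar> \<le> c"
  shows "integrable P (\<lambda>z. h (fst z) * (\<epsilon> z)\<^sup>2)"
    and "(\<integral>z. h (fst z) * (\<epsilon> z)\<^sup>2 \<partial>P) = (\<integral>z. h (fst z) \<partial>P)"
proof -
  show i: "integrable P (\<lambda>z. h (fst z) * (\<epsilon> z)\<^sup>2)"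
  proof (rule Bochner_Integration.integrable_bound[of _ "\<lambda>z. c * (\<epsilon> z)\<^sup>2"])
    show "AE z in P. norm (h (fst z) * (\<epsilon> z)\<^sup>2) \<le> norm (c * (\<epsilon> z)\<^sup>2)"
      using h by eventually_elim (auto simp: abs_mult intro!: mult_right_mono)
  qed (use eps_square_integrable in auto)
  have "(\<integral>z. h (fst z) * (\<epsilon> z)\<^sup>2 \<partial>P) = (\<integral>z. h (fst z) * real_cond_exp P F (\<lambda>w. (\<epsilon> w)\<^sup>2) z \<partial>P)"
    by (rule cond.real_cond_exp_intg(2)[symmetric]) (use i covariate_measurable_F[OF assms(1)] in auto)
  also have "\<dots> = (\<integral>z. h (fst z) \<partial>P)"
  proof (rule integral_cong_AE)
    have "AE z in P. real_cond_exp P F (\<lambda>w. (\<epsilon> w)\<^sup>2) z = 1"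
      using setting by (simp add: regression_setting_def)
    then show "AE z in P. h (fst z) * real_cond_exp P F (\<lambda>w. (\<epsilon> w)\<^sup>2) z = h (fst z)" by eventually_elim simp
  qed (use borel_measurable_cond_exp2[of P F "\<lambda>w. (\<epsilon> w)\<^sup>2"] in measurable)
  finally show "(\<integral>z. h (fst z) * (\<epsilon> z)\<^sup>2 \<partial>P) = (\<integral>z. h (fst z) \<partial>P)" .
qed

text \<open>
  Where \<open>c * s\<^sub>0\<close> exceeds the bound on the response, the noise has a strict sign; testing it
  against a function of the covariate supported there shows that this set is null. The weight
  \<open>1 / (1 + \<sigma>)\<close> provides integrability.
\<close>

lemma signed_regression_function_le:
  assumes c: "\<bar>c\<bar> = 1"
  shows "AE z in P. c * s\<^sub>0 (fst z) \<le> A"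
proof -
  define h where "h x = (if A < c * s\<^sub>0 x then 1 / (1 + \<sigma> x) else 0)" for x
  have [measurable]: "h \<in> borel_measurable X" unfolding h_def by measurable
  define k where "k x = h x * \<sigma> x" for x
  have [measurable]: "k \<in> borel_measurable X" unfolding k_def by measurable
  have k: "\<bar>k x\<bar> \<le> 1" if "x \<in> \<X>" for x
    using sigma_nonneg[OF that] by (auto simp: k_def h_def divide_simps)
  have ieps: "integrable P \<epsilon>"
    using square_integrable_imp_integrable[of \<epsilon>] eps_square_integrable by simp
  have ik: "integrable P (\<lambda>z. k (fst z) * \<epsilon> z)"
  proof (rule Bochner_Integration.integrable_bound[OF ieps])
    show "AE z in P. norm (k (fst z) * \<epsilon> z) \<le> norm (\<epsilon> z)"
    proof (rule AE_I2)
      fix z assume "z \<in> space P"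
      then have "\<bar>k (fst z)\<bar> \<le> 1" by (intro k) (auto simp: space_P)
      then show "norm (k (fst z) * \<epsilon> z) \<le> norm (\<epsilon> z)" by (simp add: abs_mult mult_left_le_one_le)
    qed
  qed measurable
  have eq: "AE z in P. - c * (k (fst z) * \<epsilon> z) = h (fst z) * (c * s\<^sub>0 (fst z) - c * snd z)"
    using response
  proof eventually_elim
    case (elim z)
    have "- c * (k (fst z) * \<epsilon> z) = - c * (h (fst z) * (\<sigma> (fst z) * \<epsilon> z))" by (simp add: k_def)
    also have "\<dots> = - c * (h (fst z) * (snd z - s\<^sub>0 (fst z)))" by (simp add: elim)
    finally show ?case by (simp add: algebra_simps)
  qed
  have nn: "AE z in P. 0 \<le> - c * (k (fst z) * \<epsilon> z)"
    using eq response_bound AE_space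
  proof eventually_elim
    case (elim z)
    have "c * snd z \<le> A" using elim c abs_ge_self[of "c * snd z"] by (simp add: abs_mult)
    moreover have "0 \<le> \<sigma> (fst z)" using elim sigma_nonneg by (auto simp: space_P)
    ultimately show ?case unfolding elim(1) by (auto simp: h_def)
  qed
  have "(\<integral>z. - c * (k (fst z) * \<epsilon> z) \<partial>P) = 0"
    using noise_conditional_mean[OF _ ik] by simp
  then have "AE z in P. - c * (k (fst z) * \<epsilon> z) = 0"
    using integral_nonneg_eq_0_iff_AE[OF integrable_mult_right[OF ik, of "- c"]] nn by simp
  then show ?thesis using eq response_bound AE_space
  proof eventually_elim
    case (elim z)
    have *: "c * snd z \<le> A" using elim c abs_ge_self[of "c * snd z"] by (simp add: abs_mult)
    have s: "0 \<le> \<sigma> (fst z)" using elim sigma_nonneg by (auto simp: space_P)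
    show ?case
    proof (rule ccontr)
      assume "\<not> ?case"
      then have "0 < h (fst z) * (c * s\<^sub>0 (fst z) - c * snd z)" using * s by (auto simp: h_def)
      then show False using elim by simp
    qed
  qed
qed

lemma regression_function_bound: "AE z in P. \<bar>s\<^sub>0 (fst z)\<bar> \<le> A"
  using signed_regression_function_le[of 1, simplified] signed_regression_function_le[of "-1", simplified]
  by eventually_elim auto

lemma noise_bound: "AE z in P. \<bar>snd z - s\<^sub>0 (fst z)\<bar> \<le> 2 * A"
  using regression_function_bound response_bound by eventually_elim auto

text \<open>\<open>\<sigma>\<close> is not assumed bounded. Integrability of
  \<open>h * \<sigma> * \<epsilon>\<close> is therefore inherited from
  \<open>h * (Y - s\<^sub>0)\<close>, which is bounded and equal to it almost everywhere.\<close>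

lemma noise_orthogonal:
  assumes [measurable]: "h \<in> borel_measurable X" and h: "AE z in P. \<bar>h (fst z)\<bar> \<le> c"
  shows "integrable P (\<lambda>z. h (fst z) * (snd z - s\<^sub>0 (fst z)))"
    and "(\<integral>z. h (fst z) * (snd z - s\<^sub>0 (fst z)) \<partial>P) = 0"
proof -
  show i: "integrable P (\<lambda>z. h (fst z) * (snd z - s\<^sub>0 (fst z)))"
  proof (rule integrable_const_bound[of _ "c * (2 * A)"])
    show "AE z in P. norm (h (fst z) * (snd z - s\<^sub>0 (fst z))) \<le> c * (2 * A)"
      using h noise_bound by eventually_elim (auto simp: abs_mult intro!: mult_mono)
  qed measurable
  have eq: "AE z in P. h (fst z) * (snd z - s\<^sub>0 (fst z)) = (h (fst z) * \<sigma> (fst z)) * \<epsilon> z"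
    using response by eventually_elim simp
  have "integrable P (\<lambda>z. (h (fst z) * \<sigma> (fst z)) * \<epsilon> z)"
    using i by (rule integrable_cong_AE_imp) (use eq in \<open>auto elim: AE_mp\<close>)
  from noise_conditional_mean[OF _ this] integral_cong_AE[OF _ _ eq]
  show "(\<integral>z. h (fst z) * (snd z - s\<^sub>0 (fst z)) \<partial>P) = 0" by simp
qed

text \<open>The squared noise dominates \<open>\<sigma>\<^sub>m\<^sup>2 * \<epsilon>\<^sup>2\<close>
  pointwise, and the conditional mean of the latter is known; only bounded functions of the
  covariate have to be moved through the conditional expectation.\<close>

lemma noise_square_ge:
  assumes [measurable]: "h \<in> borel_measurable X" and h: "AE z in P. \<bar>h (fst z)\<bar> \<le> c"
    and nn: "\<And>x. x \<in> \<X> \<Longrightarrow> 0 \<le> h x"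
  shows "\<sigma>\<^sub>m\<^sup>2 * (\<integral>z. h (fst z) \<partial>P) \<le> (\<integral>z. h (fst z) * (snd z - s\<^sub>0 (fst z))\<^sup>2 \<partial>P)"
proof -
  have "\<sigma>\<^sub>m\<^sup>2 * (\<integral>z. h (fst z) \<partial>P) = (\<integral>z. \<sigma>\<^sub>m\<^sup>2 * (h (fst z) * (\<epsilon> z)\<^sup>2) \<partial>P)"
    using noise_conditional_variance[OF assms(1) h] by simp
  also have "\<dots> \<le> (\<integral>z. h (fst z) * (snd z - s\<^sub>0 (fst z))\<^sup>2 \<partial>P)"
  proof (rule integral_mono_AE)
    show "integrable P (\<lambda>z. h (fst z) * (snd z - s\<^sub>0 (fst z))\<^sup>2)"
    proof (rule integrable_const_bound[of _ "c * (2 * A)\<^sup>2"])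
      show "AE z in P. norm (h (fst z) * (snd z - s\<^sub>0 (fst z))\<^sup>2) \<le> c * (2 * A)\<^sup>2"
        using h noise_bound
      proof eventually_elim
        case (elim z)
        have "(snd z - s\<^sub>0 (fst z))\<^sup>2 \<le> (2 * A)\<^sup>2"
          using power_mono[OF elim(2) abs_ge_zero, of 2] by simp
        then show ?case using elim by (auto simp: abs_mult intro!: mult_mono)
      qed
    qed measurable
    show "AE z in P. \<sigma>\<^sub>m\<^sup>2 * (h (fst z) * (\<epsilon> z)\<^sup>2) \<le> h (fst z) * (snd z - s\<^sub>0 (fst z))\<^sup>2"
      using response noise_level(2) AE_space
    proof eventually_elim
      case (elim z)
      have h0: "0 \<le> h (fst z)" using elim by (intro nn) (auto simp: space_P)
      have "\<sigma>\<^sub>m\<^sup>2 * (\<epsilon> z)\<^sup>2 \<le> (\<sigma> (fst z))\<^sup>2 * (\<epsilon> z)\<^sup>2"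
        using elim noise_level(1) by (intro mult_right_mono power_mono) auto
      then show ?case unfolding elim(1) power_mult_distrib using mult_left_mono[OF _ h0] by (simp add: mult.left_commute)
    qed
  qed (use noise_conditional_variance[OF assms(1) h] in simp)
  finally show ?thesis .
qed

end

section \<open>A model satisfying (SA) as a localized family\<close>

lemma combination_in_subspace:
  fixes \<phi> :: "nat \<Rightarrow> predictor"
  assumes "subspace m" "finite S" "\<And>k. k \<in> S \<Longrightarrow> \<phi> k \<in> m"
  shows "(\<lambda>x. \<Sum>k\<in>S. \<beta> k * \<phi> k x) \<in> m"
  using assms(2,3)
proof (induction S)
  case empty
  have "(\<lambda>x. 0) = (0 :: predictor)" by (simp add: fun_eq_iff)
  then show ?case using subspace_0[OF assms(1)] by simp
next
  case (insert k S)
  have "(\<lambda>x. \<Sum>k\<in>insert k S. \<beta> k * \<phi> k x) = \<beta> k *\<^sub>R \<phi> k + (\<lambda>x. \<Sum>k\<in>S. \<beta> k * \<phi> k x)"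
    using insert by (simp add: fun_eq_iff scaleR_fun_def)
  then show ?case using insert by (auto intro!: subspace_add subspace_scale assms(1))
qed

locale sa_model = regression d \<X> P s\<^sub>0 \<sigma> \<epsilon> "A_bd K" "sigma_min K"
  for d \<X> P s\<^sub>0 \<sigma> \<epsilon> K +
  fixes n :: nat and \<kappa> :: real and m :: model and b :: nat and G and A :: "nat \<Rightarrow> real" and \<phi> :: "nat \<Rightarrow> predictor"
  assumes kappa: "2 \<le> \<kappa>" "r_M K \<le> \<kappa>" "A_c K \<le> \<kappa>" "A_Mplus K \<le> \<kappa>" "A_bd K \<le> \<kappa>" "1 \<le> \<kappa> * (sigma_min K)\<^sup>2"
    and n: "1 \<le> ln (real n)" "ln (real n) \<le> real n"
    and is_model: "is_model (covariate_law d \<X> P) m"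
    and auslb: "SA_Auslb K \<X> (covariate_law d \<X> P) m b G A \<phi>"
    and p2: "SA_P2 K n m b A"
    and proj_bound: "sup_norm_on \<X> (orth_proj (covariate_law d \<X> P) m s\<^sub>0) \<le> ennreal (A_bd K)"
begin

abbreviation "l \<equiv> ln (real n)"
abbreviation "D \<equiv> dim m"
abbreviation "s\<^sub>m \<equiv> orth_proj \<mu> m s\<^sub>0"

lemma n_pos: "0 < real n" using n by linarith

lemma A_bd_nonneg: "0 \<le> A_bd K"
proof -
  have "AE z in P. 0 \<le> A_bd K" using response_bound by eventually_elim auto
  then show ?thesis by simp
qed

lemma constants_pos: "0 < r_M K" "0 < A_c K" using auslb by (auto simp: SA_Auslb_def)

lemma D_ge: "1 \<le> D" using p2 by (simp add: SA_P2_def)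

lemma b_pos: "1 \<le> b" using auslb by (auto simp: SA_Auslb_def)

lemma A_pos: "i \<in> {1..b} \<Longrightarrow> 0 < A i" using auslb by (auto simp: SA_Auslb_def)

lemma A_mono: "i \<in> {1..b} \<Longrightarrow> A i \<le> A b"
proof -
  assume i: "i \<in> {1..b}"
  have "mono_on {1..b} A" using auslb by (auto simp: SA_Auslb_def)
  then show ?thesis using i by (auto simp: mono_on_def)
qed

lemma dim_le: "real D \<le> \<kappa> * real n / l\<^sup>2" and b_A_le: "(real b)\<^sup>2 * A b \<le> \<kappa> * real n / l\<^sup>2"
proof -
  have "max (real D) ((real b)\<^sup>2 * A b) \<le> A_Mplus K * real n / l\<^sup>2" using p2 by (simp add: SA_P2_def)
  also have "\<dots> \<le> \<kappa> * real n / l\<^sup>2" using kappa by (intro divide_right_mono mult_right_mono) auto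
  finally show "real D \<le> \<kappa> * real n / l\<^sup>2" "(real b)\<^sup>2 * A b \<le> \<kappa> * real n / l\<^sup>2" by auto
qed

lemma groups: "indexed_partition {1..b} G {1..D}" using auslb by (auto simp: SA_Auslb_def)

lemma sum_groups: "sum f {1..D} = (\<Sum>i=1..b. sum f (G i))" for f :: "nat \<Rightarrow> real"
  by (rule sum_indexed_partition[OF groups]) auto

lemma group_subset: "i \<in> {1..b} \<Longrightarrow> G i \<subseteq> {1..D}"
  using groups by (auto simp: indexed_partition_def partition_on_def)

lemma group_finite: "i \<in> {1..b} \<Longrightarrow> finite (G i)"
  using group_subset finite_subset by blast

text \<open>The group of a basis function. \<open>A (index k)\<close> becomes the \<open>a k\<close>
  of the abstract family.\<close>

definition index :: "nat \<Rightarrow> nat" where "index k = (SOME i. i \<in> {1..b} \<and> k \<in> G i)"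

lemma index: "k \<in> {1..D} \<Longrightarrow> index k \<in> {1..b} \<and> k \<in> G (index k)"
proof -
  assume k: "k \<in> {1..D}"
  have "(\<Union>i\<in>{1..b}. G i) = {1..D}"
    using groups by (auto simp: indexed_partition_def partition_on_def)
  with k have "\<exists>i. i \<in> {1..b} \<and> k \<in> G i" by blast
  then show ?thesis unfolding index_def by (rule someI_ex)
qed

lemma index_eq: "i \<in> {1..b} \<Longrightarrow> k \<in> G i \<Longrightarrow> index k = i"
proof (rule ccontr)
  assume i: "i \<in> {1..b}" "k \<in> G i" "index k \<noteq> i"
  have k: "k \<in> {1..D}" using group_subset[OF i(1)] i(2) by blast
  have inj: "inj_on G {1..b}" and part: "partition_on {1..D} (G ` {1..b})"
    using groups by (auto simp: indexed_partition_def)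
  have "G (index k) \<noteq> G i" using inj i index[OF k] by (meson inj_onD)
  then have "G (index k) \<inter> G i = {}"
    using part i index[OF k] by (intro disjointD[of "G ` {1..b}"]) (auto simp: partition_on_def)
  then show False using index[OF k] i by auto
qed

lemma basis: "span (\<phi> ` {1..D}) = m" and subspace_m: "subspace m"
  using auslb is_model by (auto simp: SA_Auslb_def orthonormal_basis_def is_model_def)

lemma phi_in: "k \<in> {1..D} \<Longrightarrow> \<phi> k \<in> m"
  using basis span_base[of "\<phi> k" "\<phi> ` {1..D}"] by auto

lemma model_measurable: "u \<in> m \<Longrightarrow> u \<in> borel_measurable X"
  using is_model by (auto simp: is_model_def L2_space_def measurable_mu[symmetric])

lemma phi_measurable: "k \<in> {1..D} \<Longrightarrow> \<phi> k \<in> borel_measurable X"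
  by (intro model_measurable phi_in)

lemma phi_le: "k \<in> {1..D} \<Longrightarrow> x \<in> \<X> \<Longrightarrow> \<bar>\<phi> k x\<bar> \<le> r_M K * sqrt (A (index k))"
proof -
  assume k: "k \<in> {1..D}" and x: "x \<in> \<X>"
  have "sup_norm_on \<X> (\<phi> k) \<le> ennreal (r_M K * sqrt (A (index k)))"
    using auslb index[OF k] unfolding SA_Auslb_def by blast
  moreover have "0 \<le> r_M K * sqrt (A (index k))"
    using constants_pos A_pos index[OF k] by (simp add: less_imp_le)
  ultimately show ?thesis using x by (simp add: sup_norm_on_le_iff)
qed

lemma model_bounded:
  assumes "u \<in> m"
  obtains c where "\<And>x. x \<in> \<X> \<Longrightarrow> \<bar>u x\<bar> \<le> c"
proof -
  obtain \<beta> where u: "u = (\<lambda>x. \<Sum>k=1..D. \<beta> k * \<phi> k x)"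
    using assms basis span_image_eq_combination[of u \<phi> D] by auto
  have "\<bar>u x\<bar> \<le> (\<Sum>k=1..D. \<bar>\<beta> k\<bar> * (r_M K * sqrt (A (index k))))" if x: "x \<in> \<X>" for x
    unfolding u using phi_le[OF _ x] by (intro order_trans[OF sum_abs] sum_mono) (auto simp: abs_mult mult_left_mono)
  then show thesis by (rule that)
qed

lemma model_AE_bounded:
  assumes "u \<in> m"
  obtains c where "AE z in P. \<bar>u (fst z)\<bar> \<le> c"
proof -
  obtain c where c: "\<And>x. x \<in> \<X> \<Longrightarrow> \<bar>u x\<bar> \<le> c" using model_bounded[OF assms] by blast
  have "AE z in P. \<bar>u (fst z)\<bar> \<le> c" by (rule AE_I2) (auto simp: space_P intro: c)
  then show thesis by (rule that)
qed

lemma AE_bounded_mult_integrable: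
  fixes f g :: "obs \<Rightarrow> real"
  assumes "f \<in> borel_measurable P" "g \<in> borel_measurable P" "AE z in P. \<bar>f z\<bar> \<le> c" "AE z in P. \<bar>g z\<bar> \<le> c'"
  shows "integrable P (\<lambda>z. f z * g z)"
proof (rule integrable_const_bound[of _ "c * c'"])
  show "AE z in P. norm (f z * g z) \<le> c * c'"
    using assms(3,4) by eventually_elim (auto simp: abs_mult intro!: mult_mono)
qed (use assms in measurable)

lemma model_mult_integrable:
  assumes "u \<in> m" "w \<in> m"
  shows "integrable P (\<lambda>z. u (fst z) * w (fst z))"
proof -
  note [measurable] = model_measurable[OF assms(1)] model_measurable[OF assms(2)]
  obtain c c' where "AE z in P. \<bar>u (fst z)\<bar> \<le> c" "AE z in P. \<bar>w (fst z)\<bar> \<le> c'"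
    using model_AE_bounded assms by metis
  then show ?thesis by (intro AE_bounded_mult_integrable) measurable
qed

lemma s0_mult_integrable:
  assumes "u \<in> m"
  shows "integrable P (\<lambda>z. s\<^sub>0 (fst z) * u (fst z))"
proof -
  note [measurable] = model_measurable[OF assms]
  obtain c where "AE z in P. \<bar>u (fst z)\<bar> \<le> c" using model_AE_bounded assms by metis
  then show ?thesis by (intro AE_bounded_mult_integrable[OF _ _ regression_function_bound]) measurable
qed

lemma orthonormal_P:
  assumes "k \<in> {1..D}" "j \<in> {1..D}"
  shows "(\<integral>z. \<phi> k (fst z) * \<phi> j (fst z) \<partial>P) = (if k = j then 1 else 0)"
proof -
  note [measurable] = phi_measurable[OF assms(1)] phi_measurable[OF assms(2)]
  have "(\<integral>x. \<phi> k x * \<phi> j x \<partial>\<mu>) = (if k = j then 1 else 0)"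
    using auslb assms by (auto simp: SA_Auslb_def orthonormal_basis_def)
  then show ?thesis by (subst (asm) integral_mu) auto
qed

lemma integral_phi_combination:
  assumes "j \<in> {1..D}"
  shows "(\<integral>z. (\<Sum>k=1..D. \<beta> k * \<phi> k (fst z)) * \<phi> j (fst z) \<partial>P) = \<beta> j"
proof -
  have "(\<integral>z. (\<Sum>k=1..D. \<beta> k * \<phi> k (fst z)) * \<phi> j (fst z) \<partial>P)
      = (\<integral>z. (\<Sum>k=1..D. \<beta> k * (\<phi> k (fst z) * \<phi> j (fst z))) \<partial>P)"
    by (simp add: sum_distrib_right mult.assoc)
  also have "\<dots> = (\<Sum>k=1..D. \<integral>z. \<beta> k * (\<phi> k (fst z) * \<phi> j (fst z)) \<partial>P)"
    using assms by (intro Bochner_Integration.integral_sum integrable_mult_right model_mult_integrable phi_in)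
  also have "\<dots> = (\<Sum>k=1..D. if k = j then \<beta> k else 0)"
    using assms orthonormal_P by (intro sum.cong) auto
  finally show ?thesis using assms by simp
qed

text \<open>The choice operator is resolved by exhibiting a candidate, the sum with the Fourier
  coefficients of \<open>s\<^sub>0\<close>. Boundedness of the basis and of \<open>s\<^sub>0\<close>
  makes all the products integrable.\<close>

lemma orth_proj:
  shows "s\<^sub>m \<in> m" and "\<And>u. u \<in> m \<Longrightarrow> (\<integral>z. (s\<^sub>0 (fst z) - s\<^sub>m (fst z)) * u (fst z) \<partial>P) = 0"
proof -
  define c where "c k = (\<integral>z. s\<^sub>0 (fst z) * \<phi> k (fst z) \<partial>P)" for k
  define t where "t = (\<lambda>x. \<Sum>k=1..D. c k * \<phi> k x)"
  have t: "t \<in> m" unfolding t_def by (rule combination_in_subspace[OF subspace_m]) (auto intro: phi_in)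
  have "(\<integral>x. (s\<^sub>0 x - t x) * u x \<partial>\<mu>) = 0" if u: "u \<in> m" for u
  proof -
    note [measurable] = model_measurable[OF t] model_measurable[OF u]
    obtain \<beta> where \<beta>: "u = (\<lambda>x. \<Sum>k=1..D. \<beta> k * \<phi> k x)"
      using u basis span_image_eq_combination[of u \<phi> D] by auto
    have i: "integrable P (\<lambda>z. (s\<^sub>0 (fst z) - t (fst z)) * \<phi> k (fst z))" if "k \<in> {1..D}" for k
      using s0_mult_integrable[OF phi_in[OF that]] model_mult_integrable[OF t phi_in[OF that]]
      by (simp add: left_diff_distrib)
    have z: "(\<integral>z. (s\<^sub>0 (fst z) - t (fst z)) * \<phi> k (fst z) \<partial>P) = 0" if "k \<in> {1..D}" for k
      using s0_mult_integrable[OF phi_in[OF that]] model_mult_integrable[OF t phi_in[OF that]]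
        integral_phi_combination[OF that, of c]
      by (simp add: left_diff_distrib c_def t_def)
    have "(\<integral>x. (s\<^sub>0 x - t x) * u x \<partial>\<mu>) = (\<integral>z. (s\<^sub>0 (fst z) - t (fst z)) * u (fst z) \<partial>P)"
      by (rule integral_mu) measurable
    also have "\<dots> = (\<integral>z. (\<Sum>k=1..D. \<beta> k * ((s\<^sub>0 (fst z) - t (fst z)) * \<phi> k (fst z))) \<partial>P)"
      unfolding \<beta> by (simp add: sum_distrib_left mult.left_commute)
    also have "\<dots> = (\<Sum>k=1..D. \<integral>z. \<beta> k * ((s\<^sub>0 (fst z) - t (fst z)) * \<phi> k (fst z)) \<partial>P)"
      by (intro Bochner_Integration.integral_sum integrable_mult_right i)
    also have "\<dots> = 0" using z by (intro sum.neutral) auto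
    finally show ?thesis .
  qed
  then have "\<exists>t. t \<in> m \<and> (\<forall>u\<in>m. (\<integral>x. (s\<^sub>0 x - t x) * u x \<partial>\<mu>) = 0)" using t by auto
  then have s: "s\<^sub>m \<in> m \<and> (\<forall>u\<in>m. (\<integral>x. (s\<^sub>0 x - s\<^sub>m x) * u x \<partial>\<mu>) = 0)"
    unfolding orth_proj_def by (rule someI_ex)
  then show sm: "s\<^sub>m \<in> m" by blast
  fix u assume u: "u \<in> m"
  note [measurable] = model_measurable[OF sm] model_measurable[OF u]
  have "(\<integral>x. (s\<^sub>0 x - s\<^sub>m x) * u x \<partial>\<mu>) = 0" using s u by blast
  then show "(\<integral>z. (s\<^sub>0 (fst z) - s\<^sub>m (fst z)) * u (fst z) \<partial>P) = 0"
    by (subst (asm) integral_mu) measurable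
qed

lemma sm_measurable[measurable]: "s\<^sub>m \<in> borel_measurable X"
  by (rule model_measurable[OF orth_proj(1)])

lemma sm_bound: "x \<in> \<X> \<Longrightarrow> \<bar>s\<^sub>m x\<bar> \<le> A_bd K"
  using proj_bound A_bd_nonneg by (simp add: sup_norm_on_le_iff)

lemma sm_AE_bound: "AE z in P. \<bar>s\<^sub>m (fst z)\<bar> \<le> A_bd K"
  by (rule AE_I2) (auto simp: space_P intro: sm_bound)

lemma bias_AE_bound: "AE z in P. \<bar>s\<^sub>0 (fst z) - s\<^sub>m (fst z)\<bar> \<le> 2 * A_bd K"
  using sm_AE_bound regression_function_bound by eventually_elim auto

text \<open>All functions of a group that are nonzero at \<open>x\<close> overlap any fixed one of
  them, so the overlap condition of a group with itself counts them.\<close>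

lemma active_count:
  assumes "i \<in> {1..b}" "x \<in> \<X>"
  shows "real (card {k \<in> G i. \<phi> k x \<noteq> 0}) \<le> A_c K"
proof (cases "{k \<in> G i. \<phi> k x \<noteq> 0} = {}")
  case True
  then show ?thesis using constants_pos(2) by (simp only: card.empty)
next
  case False
  then obtain k where k: "k \<in> G i" "\<phi> k x \<noteq> 0" by auto
  have "real (card {k \<in> G i. \<phi> k x \<noteq> 0}) \<le> real (card {l \<in> G i. supp_on \<X> (\<phi> k) \<inter> supp_on \<X> (\<phi> l) \<noteq> {}})"
    using k assms group_finite[OF assms(1)] by (intro of_nat_mono card_mono) (auto simp: supp_on_def)
  also have "\<dots> \<le> A_c K * max (A i / A i) 1" using auslb assms(1) k(1) unfolding SA_Auslb_def by blast
  also have "\<dots> = A_c K" using A_pos[OF assms(1)] by simp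
  finally show ?thesis .
qed

text \<open>At a point each group has at most \<open>A_c\<close> active functions, of size at most
  \<open>r_M * sqrt (A i)\<close>, and the roots sum to at most \<open>r_M * sqrt D\<close>. Three
  constants occur, hence \<open>\<kappa> ^ 3\<close>.\<close>

lemma sum_abs_phi_le:
  assumes x: "x \<in> \<X>"
  shows "(\<Sum>k=1..D. \<bar>\<phi> k x\<bar>) \<le> \<kappa> ^ 3 * sqrt (real D)"
proof -
  have "(\<Sum>k=1..D. \<bar>\<phi> k x\<bar>) = (\<Sum>i=1..b. \<Sum>k\<in>G i. \<bar>\<phi> k x\<bar>)" by (rule sum_groups)
  also have "\<dots> \<le> (\<Sum>i=1..b. A_c K * (r_M K * sqrt (A i)))"
  proof (rule sum_mono)
    fix i assume i: "i \<in> {1..b}"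
    have r0: "0 \<le> r_M K * sqrt (A i)" using constants_pos A_pos[OF i] by simp
    have "(\<Sum>k\<in>G i. \<bar>\<phi> k x\<bar>) = (\<Sum>k\<in>{k \<in> G i. \<phi> k x \<noteq> 0}. \<bar>\<phi> k x\<bar>)"
      using group_finite[OF i] by (intro sum.mono_neutral_right) auto
    also have "\<dots> \<le> (\<Sum>k\<in>{k \<in> G i. \<phi> k x \<noteq> 0}. r_M K * sqrt (A i))"
    proof (rule sum_mono)
      fix k assume "k \<in> {k \<in> G i. \<phi> k x \<noteq> 0}"
      then show "\<bar>\<phi> k x\<bar> \<le> r_M K * sqrt (A i)"
        using phi_le[OF _ x, of k] index_eq[OF i, of k] group_subset[OF i] by auto
    qed
    also have "\<dots> \<le> A_c K * (r_M K * sqrt (A i))"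
      using active_count[OF i x] r0 by (simp add: mult_right_mono)
    finally show "(\<Sum>k\<in>G i. \<bar>\<phi> k x\<bar>) \<le> A_c K * (r_M K * sqrt (A i))" .
  qed
  also have "\<dots> = A_c K * (r_M K * (\<Sum>i=1..b. sqrt (A i)))" by (simp add: sum_distrib_left)
  also have "\<dots> \<le> A_c K * (r_M K * (r_M K * sqrt (real D)))"
    using auslb constants_pos by (intro mult_left_mono) (auto simp: SA_Auslb_def)
  also have "\<dots> \<le> \<kappa> * (\<kappa> * (\<kappa> * sqrt (real D)))"
    using kappa constants_pos by (intro mult_mono) auto
  finally show ?thesis by (simp add: power3_eq_cube)
qed

text \<open>For each group, the number of neighbours of \<open>k\<close> times their weight is at
  most \<open>A_c\<close> times the larger of \<open>sqrt (A i)\<close> and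
  \<open>sqrt (A i')\<close>; the weights are made for this cancellation. Summing over
  \<open>b\<close> groups gives \<open>b * sqrt (A b)\<close>, the quantity that (P2)
  bounds.\<close>

lemma overlap_le:
  assumes k: "k \<in> {1..D}"
  shows "(\<Sum>j | j \<in> {1..D} \<and> (\<exists>z\<in>space P. \<phi> k (fst z) \<noteq> 0 \<and> \<phi> j (fst z) \<noteq> 0).
      sqrt (min (A (index k)) (A (index j))) * sqrt (A (index k) / A (index j))) \<le> \<kappa> * (sqrt (\<kappa> * real n) / l)"
proof -
  define i where "i = index k"
  have i: "i \<in> {1..b}" "k \<in> G i" using index[OF k] by (auto simp: i_def)
  let ?meets = "\<lambda>j. supp_on \<X> (\<phi> k) \<inter> supp_on \<X> (\<phi> j) \<noteq> {}"
  define w where "w j = sqrt (min (A i) (A j)) * sqrt (A i / A j)" for j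
  have J: "{j. j \<in> {1..D} \<and> (\<exists>z\<in>space P. \<phi> k (fst z) \<noteq> 0 \<and> \<phi> j (fst z) \<noteq> 0)} = {j \<in> {1..D}. ?meets j}"
    by (fastforce simp: space_P supp_on_def)
  have "(\<Sum>j\<in>{j \<in> {1..D}. ?meets j}. w (index j)) = (\<Sum>j=1..D. if ?meets j then w (index j) else 0)"
    by (rule sum.inter_filter) simp
  also have "\<dots> = (\<Sum>i'=1..b. \<Sum>j\<in>G i'. if ?meets j then w (index j) else 0)"
    by (rule sum_groups)
  also have "\<dots> \<le> (\<Sum>i'=1..b. A_c K * sqrt (A b))"
  proof (rule sum_mono)
    fix i' assume i': "i' \<in> {1..b}"
    have pos: "0 < A i" "0 < A i'" using A_pos i i' by auto
    have w0: "0 \<le> w i'" using pos by (simp add: w_def)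
    have "(\<Sum>j\<in>G i'. if ?meets j then w (index j) else 0) = (\<Sum>j\<in>G i'. if ?meets j then w i' else 0)"
      using index_eq[OF i'] by (intro sum.cong) auto
    also have "\<dots> = real (card {j \<in> G i'. ?meets j}) * w i'"
      using group_finite[OF i'] by (simp add: sum.inter_filter[symmetric])
    also have "\<dots> \<le> A_c K * max (A i' / A i) 1 * w i'"
      using auslb i i' w0 unfolding SA_Auslb_def by (intro mult_right_mono) blast+
    also have "max (A i' / A i) 1 * w i' \<le> sqrt (A b)"
    proof (cases "A i \<le> A i'")
      case True
      have "max (A i' / A i) 1 * w i' = (A i' / A i) * (sqrt (A i) * sqrt (A i / A i'))"
        using True pos by (simp add: w_def max_def min_def)
      also have "sqrt (A i) * sqrt (A i / A i') = A i / sqrt (A i')"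
        using pos by (simp add: real_sqrt_divide)
      also have "(A i' / A i) * (A i / sqrt (A i')) = sqrt (A i')" using pos by (simp add: real_div_sqrt)
      also have "\<dots> \<le> sqrt (A b)" using A_mono[OF i'] by simp
      finally show ?thesis .
    next
      case False
      have "max (A i' / A i) 1 * w i' = sqrt (A i') * sqrt (A i / A i')"
        using False pos by (simp add: w_def max_def min_def divide_simps)
      also have "\<dots> = sqrt (A i)" using pos by (simp add: real_sqrt_divide)
      also have "\<dots> \<le> sqrt (A b)" using A_mono[OF i(1)] by simp
      finally show ?thesis .
    qed
    then have "A_c K * max (A i' / A i) 1 * w i' \<le> A_c K * sqrt (A b)"
      using constants_pos by (simp add: mult.assoc mult_left_mono)
    finally show "(\<Sum>j\<in>G i'. if ?meets j then w (index j) else 0) \<le> A_c K * sqrt (A b)" .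
  qed
  also have "\<dots> = A_c K * sqrt ((real b)\<^sup>2 * A b)" by (simp add: real_sqrt_mult)
  also have "\<dots> \<le> \<kappa> * sqrt (\<kappa> * real n / l\<^sup>2)"
    using b_A_le kappa constants_pos A_pos[of b] b_pos by (intro mult_mono) auto
  also have "\<dots> = \<kappa> * (sqrt (\<kappa> * real n) / l)" using n by (simp add: real_sqrt_divide)
  finally show ?thesis unfolding J by (simp add: w_def i_def)
qed

lemma residual_AE_bound: "AE z in P. \<bar>snd z - s\<^sub>m (fst z)\<bar> \<le> 2 * \<kappa>"
  using sm_AE_bound response_bound by eventually_elim (use kappa in linarith)

lemma residual_mult_phi:
  assumes k: "k \<in> {1..D}"
  shows "(\<integral>z. (snd z - s\<^sub>m (fst z)) * \<phi> k (fst z) \<partial>P) = 0"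
proof -
  note [measurable] = phi_measurable[OF k]
  obtain c where "AE z in P. \<bar>\<phi> k (fst z)\<bar> \<le> c" using model_AE_bounded[OF phi_in[OF k]] .
  note * = noise_orthogonal[OF phi_measurable[OF k] this]
  have "integrable P (\<lambda>z. (s\<^sub>0 (fst z) - s\<^sub>m (fst z)) * \<phi> k (fst z))"
    using s0_mult_integrable[OF phi_in[OF k]] model_mult_integrable[OF orth_proj(1) phi_in[OF k]]
    by (simp add: left_diff_distrib)
  moreover have "(snd z - s\<^sub>m (fst z)) * \<phi> k (fst z) =
      \<phi> k (fst z) * (snd z - s\<^sub>0 (fst z)) + (s\<^sub>0 (fst z) - s\<^sub>m (fst z)) * \<phi> k (fst z)" for z :: obs
    by (simp add: algebra_simps)
  ultimately show ?thesis using * orth_proj(2)[OF phi_in[OF k]] by simp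
qed

text \<open>The bias can only add energy: the cross term integrates the noise against a bounded
  function of the covariate and vanishes, so the noise alone gives the lower bound.\<close>

lemma residual_energy_ge:
  assumes k: "k \<in> {1..D}"
  shows "(sigma_min K)\<^sup>2 \<le> (\<integral>z. ((snd z - s\<^sub>m (fst z)) * \<phi> k (fst z))\<^sup>2 \<partial>P)"
proof -
  note [measurable] = phi_measurable[OF k]
  obtain c where c: "\<And>x. x \<in> \<X> \<Longrightarrow> \<bar>\<phi> k x\<bar> \<le> c" using model_bounded[OF phi_in[OF k]] by blast
  have sq: "(\<phi> k x)\<^sup>2 \<le> c\<^sup>2" if "x \<in> \<X>" for x
    using power_mono[OF c[OF that] abs_ge_zero, of 2] by simp
  have sqAE: "AE z in P. \<bar>(\<phi> k (fst z))\<^sup>2\<bar> \<le> c\<^sup>2"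
    by (rule AE_I2) (auto simp: space_P intro: sq)
  define h where "h x = 2 * (s\<^sub>0 x - s\<^sub>m x) * (\<phi> k x)\<^sup>2" for x
  have [measurable]: "h \<in> borel_measurable X" unfolding h_def by measurable
  have "AE z in P. \<bar>h (fst z)\<bar> \<le> 4 * A_bd K * c\<^sup>2"
    using bias_AE_bound sqAE
  proof eventually_elim
    case (elim z)
    have "\<bar>2 * (s\<^sub>0 (fst z) - s\<^sub>m (fst z))\<bar> * \<bar>(\<phi> k (fst z))\<^sup>2\<bar> \<le> (4 * A_bd K) * c\<^sup>2"
      using elim A_bd_nonneg by (intro mult_mono) (auto simp: abs_mult)
    then show ?case by (simp add: h_def abs_mult)
  qed
  note h = noise_orthogonal[OF \<open>h \<in> borel_measurable X\<close> this]
  have "(\<integral>z. (\<phi> k (fst z))\<^sup>2 \<partial>P) = 1" using orthonormal_P[OF k k] by (simp add: power2_eq_square)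
  then have 1: "(sigma_min K)\<^sup>2 \<le> (\<integral>z. (\<phi> k (fst z))\<^sup>2 * (snd z - s\<^sub>0 (fst z))\<^sup>2 \<partial>P)"
    using noise_square_ge[of "\<lambda>x. (\<phi> k x)\<^sup>2", OF _ sqAE] by simp
  have i1: "integrable P (\<lambda>z. (\<phi> k (fst z))\<^sup>2 * (snd z - s\<^sub>0 (fst z))\<^sup>2)"
  proof (rule AE_bounded_mult_integrable[OF _ _ sqAE])
    show "AE z in P. \<bar>(snd z - s\<^sub>0 (fst z))\<^sup>2\<bar> \<le> (2 * A_bd K)\<^sup>2"
      using noise_bound
    proof eventually_elim
      case (elim z)
      from power_mono[OF elim abs_ge_zero, of 2] show ?case by simp
    qed
  qed measurable
  have i2: "integrable P (\<lambda>z. ((snd z - s\<^sub>m (fst z)) * \<phi> k (fst z))\<^sup>2)"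
  proof (rule integrable_const_bound[of _ "(2 * \<kappa> * c)\<^sup>2"])
    show "AE z in P. norm (((snd z - s\<^sub>m (fst z)) * \<phi> k (fst z))\<^sup>2) \<le> (2 * \<kappa> * c)\<^sup>2"
      using residual_AE_bound AE_space
    proof eventually_elim
      case (elim z)
      have "\<bar>(snd z - s\<^sub>m (fst z)) * \<phi> k (fst z)\<bar> \<le> 2 * \<kappa> * c"
        using elim c[of "fst z"] by (auto simp: abs_mult space_P intro!: mult_mono)
      from power_mono[OF this abs_ge_zero, of 2] show ?case by simp
    qed
  qed measurable
  have "(\<integral>z. (\<phi> k (fst z))\<^sup>2 * (snd z - s\<^sub>0 (fst z))\<^sup>2 \<partial>P)
      = (\<integral>z. (\<phi> k (fst z))\<^sup>2 * (snd z - s\<^sub>0 (fst z))\<^sup>2 + h (fst z) * (snd z - s\<^sub>0 (fst z)) \<partial>P)"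
    using h i1 by simp
  also have "\<dots> \<le> (\<integral>z. ((snd z - s\<^sub>m (fst z)) * \<phi> k (fst z))\<^sup>2 \<partial>P)"
  proof (rule integral_mono)
    fix z
    have "((snd z - s\<^sub>m (fst z)) * \<phi> k (fst z))\<^sup>2 =
        (\<phi> k (fst z))\<^sup>2 * (snd z - s\<^sub>0 (fst z))\<^sup>2 + h (fst z) * (snd z - s\<^sub>0 (fst z))
        + ((s\<^sub>0 (fst z) - s\<^sub>m (fst z)) * \<phi> k (fst z))\<^sup>2"
      by (simp add: h_def power2_eq_square algebra_simps)
    then show "(\<phi> k (fst z))\<^sup>2 * (snd z - s\<^sub>0 (fst z))\<^sup>2 + h (fst z) * (snd z - s\<^sub>0 (fst z))
        \<le> ((snd z - s\<^sub>m (fst z)) * \<phi> k (fst z))\<^sup>2" by simp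
  qed (use h i1 i2 in auto)
  finally show ?thesis using 1 by linarith
qed

end

sublocale sa_model \<subseteq> localized_family P n \<kappa> "ln (real n)" "dim m" "\<lambda>k z. \<phi> k (fst z)"
    "\<lambda>z. snd z - orth_proj (covariate_law d \<X> P) m s\<^sub>0 (fst z)" "\<lambda>k. A (index k)"
proof unfold_locales
  show "1 \<le> \<kappa>" "1 \<le> l" "l \<le> real n" "1 \<le> dim m" using kappa n D_ge by auto
  show "(\<lambda>z. snd z - s\<^sub>m (fst z)) \<in> borel_measurable P" by measurable
  show "AE z in P. \<bar>snd z - s\<^sub>m (fst z)\<bar> \<le> 2 * \<kappa>" by (rule residual_AE_bound)
  show "(\<Sum>k=1..dim m. \<bar>\<phi> k (fst z)\<bar>) \<le> \<kappa> ^ 3 * sqrt (real (dim m))" if "z \<in> space P" for z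
    using that by (intro sum_abs_phi_le) (auto simp: space_P)
  fix k assume k: "k \<in> {1..dim m}"
  note ik = index[OF k]
  show "(\<lambda>z. \<phi> k (fst z)) \<in> borel_measurable P" using phi_measurable[OF k] by measurable
  show A: "0 < A (index k)" using A_pos ik by auto
  have "1 * A b \<le> (real b)\<^sup>2 * A b" using b_pos A_pos[of b] by (intro mult_right_mono) auto
  then show "A (index k) \<le> \<kappa> * real n / l\<^sup>2" using A_mono[of "index k"] ik b_A_le by auto
  show "(\<integral>z. (snd z - s\<^sub>m (fst z)) * \<phi> k (fst z) \<partial>P) = 0" by (rule residual_mult_phi[OF k])
  show "(\<Sum>j | j \<in> {1..dim m} \<and> (\<exists>z\<in>space P. \<phi> k (fst z) \<noteq> 0 \<and> \<phi> j (fst z) \<noteq> 0).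
      sqrt (min (A (index k)) (A (index j))) * sqrt (A (index k) / A (index j))) \<le> \<kappa> * (sqrt (\<kappa> * real n) / l)"
    by (rule overlap_le[OF k])
  show "\<bar>\<phi> k (fst z)\<bar> \<le> \<kappa> * sqrt (A (index k))" if "z \<in> space P" for z
  proof -
    have "\<bar>\<phi> k (fst z)\<bar> \<le> r_M K * sqrt (A (index k))" using that by (intro phi_le[OF k]) (auto simp: space_P)
    also have "\<dots> \<le> \<kappa> * sqrt (A (index k))" using kappa A by (intro mult_right_mono) auto
    finally show ?thesis .
  qed
  show "(\<integral>z. \<phi> k (fst z) * \<phi> j (fst z) \<partial>P) = (if k = j then 1 else 0)" if "j \<in> {1..dim m}" for j
    by (rule orthonormal_P[OF k that])
qed

sublocale sa_model \<subseteq> ls: ls_model P n \<kappa> "ln (real n)" "dim m" \<phi> "orth_proj (covariate_law d \<X> P) m s\<^sub>0" "\<lambda>k. A (index k)" m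
proof unfold_locales
  show "subspace m" "span (\<phi> ` {1..dim m}) = m" "s\<^sub>m \<in> m" using subspace_m basis orth_proj by auto
  have "(\<Sum>k=1..dim m. (sigma_min K)\<^sup>2) \<le> noise_energy"
    unfolding noise_energy_def by (intro sum_mono residual_energy_ge)
  then have "\<kappa> * (\<Sum>k=1..dim m. (sigma_min K)\<^sup>2) \<le> \<kappa> * noise_energy"
    using kappa by (intro mult_left_mono) auto
  moreover have "real (dim m) * 1 \<le> real (dim m) * (\<kappa> * (sigma_min K)\<^sup>2)"
    using kappa by (intro mult_left_mono) auto
  ultimately show "real (dim m) \<le> \<kappa> * noise_energy" by (simp add: mult_ac)
qed

section \<open>The oracle inequality\<close>

text \<open>Primed letters belong to the selected model: \<open>x\<close> is a risk,
  \<open>y\<close> a criterion, \<open>R\<close> their common deterministic value and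
  \<open>z\<close> the shift. The chain runs from \<open>x'\<close> through \<open>R'\<close>,
  \<open>y'\<close>, \<open>y\<close> and \<open>R\<close> to \<open>x\<close>.\<close>

lemma oracle_arithmetic:
  fixes R R' x x' y y' c \<eta> \<tau> z :: real
  assumes e: "0 \<le> c" "0 \<le> \<eta>" "c * \<eta> \<le> 1 / 4" and \<tau>: "0 \<le> \<tau>" and R: "0 \<le> R" "0 \<le> R'" and x: "0 \<le> x"
    and "\<bar>x - R\<bar> \<le> c * (R * \<eta> + \<tau>)" "\<bar>y - z - R\<bar> \<le> c * (R * \<eta> + \<tau>)"
    and "\<bar>x' - R'\<bar> \<le> c * (R' * \<eta> + \<tau>)" "\<bar>y' - z - R'\<bar> \<le> c * (R' * \<eta> + \<tau>)" and "y' \<le> y"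
  shows "x' \<le> (1 + 16 * c * \<eta>) * x + 10 * c * \<tau>"
proof -
  define a where "a = c * \<eta>"
  define u where "u = c * \<tau>"
  have a: "0 \<le> a" "a \<le> 1 / 4" using e by (auto simp: a_def)
  have u: "0 \<le> u" using e \<tau> by (simp add: u_def)
  have ca: "c * (Q * \<eta> + \<tau>) = a * Q + u" for Q by (simp add: a_def u_def algebra_simps)
  note h = assms(8-12)[unfolded ca]
  have aa: "0 \<le> a * a" "a * a \<le> a / 4" using mult_left_mono[OF a(2) a(1)] a by auto
  \<comment> \<open>Division by \<open>1 - a\<close>, using
    \<open>1 / (1 - a) \<le> 1 + 2 * a\<close> for small \<open>a\<close> in product form.\<close>
  have solve: "Q \<le> (1 + 2 * a) * w" if "(1 - a) * Q \<le> w" "0 \<le> Q" for Q w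
  proof -
    have "(1 + 2 * a) * (1 - a) = 1 + a - 2 * (a * a)" by (simp add: algebra_simps)
    then have "1 \<le> (1 + 2 * a) * (1 - a)" using aa a by linarith
    then have "1 * Q \<le> ((1 + 2 * a) * (1 - a)) * Q" using that(2) by (rule mult_right_mono)
    also have "\<dots> \<le> (1 + 2 * a) * w" unfolding mult.assoc using that(1) a by (intro mult_left_mono) auto
    finally show ?thesis by simp
  qed
  have R1: "R \<le> (1 + 2 * a) * (x + u)" using h by (intro solve R) (simp add: algebra_simps)
  have "(1 - a) * R' \<le> (1 + a) * R + 2 * u" using h by (simp add: algebra_simps)
  then have R2: "R' \<le> (1 + 2 * a) * ((1 + a) * R + 2 * u)" by (intro solve R)
  \<comment> \<open>The loss of one factor \<open>1 + a\<close> and one division by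
    \<open>1 - a\<close>; the chain incurs it twice.\<close>
  define q where "q = (1 + a) * (1 + 2 * a)"
  have "q = 1 + 3 * a + 2 * (a * a)" by (simp add: q_def algebra_simps)
  then have q: "1 \<le> q" "q \<le> 1 + 7 / 2 * a" using a aa by (linarith, linarith)
  have "q * q \<le> (1 + 7 / 2 * a) * (1 + 7 / 2 * a)" using q by (intro mult_mono) auto
  also have "\<dots> = 1 + 7 * a + 49 / 4 * (a * a)" by (simp add: algebra_simps)
  also have "\<dots> \<le> 1 + 16 * a" using aa a by linarith
  finally have qq: "q * q \<le> 1 + 16 * a" .
  have "x' \<le> (1 + a) * R' + u" using h by (simp add: algebra_simps)
  also have "\<dots> \<le> (1 + a) * ((1 + 2 * a) * ((1 + a) * R + 2 * u)) + u"
    using R2 a by (intro add_mono mult_left_mono) auto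
  also have "\<dots> = q * ((1 + a) * R) + 2 * (q * u) + u" by (simp add: q_def algebra_simps)
  also have "\<dots> \<le> q * ((1 + a) * ((1 + 2 * a) * (x + u))) + 2 * (q * u) + u"
    using R1 a q by (intro add_mono mult_left_mono) auto
  also have "\<dots> = (q * q) * x + (q * q) * u + 2 * (q * u) + u" by (simp add: q_def algebra_simps)
  \<comment> \<open>From \<open>a \<le> 1 / 4\<close> come \<open>q * q \<le> 5\<close> and
    \<open>q \<le> 15 / 8\<close>.\<close>
  also have "\<dots> \<le> (1 + 16 * a) * x + 5 * u + 2 * (15 / 8 * u) + u"
    using qq q a u x by (intro add_mono mult_right_mono mult_left_mono) auto
  also have "\<dots> \<le> (1 + 16 * a) * x + 10 * u" using u by simp
  finally show ?thesis by (simp add: a_def u_def mult.assoc)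
qed

section \<open>Risk and criterion of one model with high probability\<close>

context sa_model
begin

lemma n_gt_one: "1 < n"
proof -
  have "0 < l" using n by linarith
  then show ?thesis using n_pos by simp
qed

lemma excess_risk_eq:
  assumes t: "t \<in> m"
  shows "excess_risk P s\<^sub>0 t = (\<integral>z. (s\<^sub>0 (fst z) - t (fst z))\<^sup>2 \<partial>P)"
    and "integrable P (\<lambda>z. contrast t z - contrast s\<^sub>0 z)"
proof -
  note [measurable] = model_measurable[OF t]
  obtain c where c: "AE z in P. \<bar>t (fst z)\<bar> \<le> c" using model_AE_bounded[OF t] .
  have h: "AE z in P. \<bar>s\<^sub>0 (fst z) - t (fst z)\<bar> \<le> A_bd K + c"
    using c regression_function_bound by eventually_elim auto
  have "AE z in P. \<bar>(2 :: real) * (s\<^sub>0 (fst z) - t (fst z))\<bar> \<le> 2 * (A_bd K + c)"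
    using h by eventually_elim (simp add: abs_mult)
  from noise_orthogonal[of "\<lambda>x. 2 * (s\<^sub>0 x - t x)", OF _ this]
  have o: "integrable P (\<lambda>z. 2 * (s\<^sub>0 (fst z) - t (fst z)) * (snd z - s\<^sub>0 (fst z)))"
    "(\<integral>z. 2 * (s\<^sub>0 (fst z) - t (fst z)) * (snd z - s\<^sub>0 (fst z)) \<partial>P) = 0" by auto
  have i: "integrable P (\<lambda>z. (s\<^sub>0 (fst z) - t (fst z))\<^sup>2)"
    unfolding power2_eq_square by (rule AE_bounded_mult_integrable[OF _ _ h h]) measurable
  have e: "contrast t z - contrast s\<^sub>0 z =
      (s\<^sub>0 (fst z) - t (fst z))\<^sup>2 + 2 * (s\<^sub>0 (fst z) - t (fst z)) * (snd z - s\<^sub>0 (fst z))" for z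
    by (simp add: contrast_def case_prod_beta power2_eq_square algebra_simps)
  show "excess_risk P s\<^sub>0 t = (\<integral>z. (s\<^sub>0 (fst z) - t (fst z))\<^sup>2 \<partial>P)"
    unfolding excess_risk_def e using i o by simp
  show "integrable P (\<lambda>z. contrast t z - contrast s\<^sub>0 z)" unfolding e using i o by simp
qed

lemma excess_risk_combine:
  "excess_risk P s\<^sub>0 (ls.combine \<beta>) = excess_risk P s\<^sub>0 s\<^sub>m + (\<Sum>k=1..D. (\<beta> k)\<^sup>2)"
proof -
  define u where "u = (\<lambda>x. \<Sum>k=1..D. \<beta> k * \<phi> k x)"
  have u: "u \<in> m" unfolding u_def by (rule combination_in_subspace[OF subspace_m]) (auto intro: phi_in)
  have t: "ls.combine \<beta> = s\<^sub>m + u" by (simp add: ls.combine_def u_def fun_eq_iff)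
  have tm: "ls.combine \<beta> \<in> m" unfolding t by (intro subspace_add subspace_m orth_proj(1) u)
  note [measurable] = model_measurable[OF u]
  have i1: "integrable P (\<lambda>z. (s\<^sub>0 (fst z) - s\<^sub>m (fst z))\<^sup>2)"
    unfolding power2_eq_square by (rule AE_bounded_mult_integrable[OF _ _ bias_AE_bound bias_AE_bound]) measurable
  have i2: "integrable P (\<lambda>z. (s\<^sub>0 (fst z) - s\<^sub>m (fst z)) * u (fst z))"
    using s0_mult_integrable[OF u] model_mult_integrable[OF orth_proj(1) u] by (simp add: left_diff_distrib)
  have uu: "u (fst z) = (\<Sum>k=1..D. \<phi> k (fst z) * \<beta> k)" for z :: obs by (simp add: u_def mult.commute)
  have "(s\<^sub>0 (fst z) - ls.combine \<beta> (fst z))\<^sup>2 =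
      (s\<^sub>0 (fst z) - s\<^sub>m (fst z))\<^sup>2 - 2 * ((s\<^sub>0 (fst z) - s\<^sub>m (fst z)) * u (fst z)) + (u (fst z))\<^sup>2" for z :: obs
    by (simp add: t power2_eq_square algebra_simps)
  then have "excess_risk P s\<^sub>0 (ls.combine \<beta>) = (\<integral>z. (s\<^sub>0 (fst z) - s\<^sub>m (fst z))\<^sup>2 \<partial>P)
      - 2 * (\<integral>z. (s\<^sub>0 (fst z) - s\<^sub>m (fst z)) * u (fst z) \<partial>P) + (\<integral>z. (u (fst z))\<^sup>2 \<partial>P)"
    unfolding excess_risk_eq(1)[OF tm] using i1 i2 combination_variance(1)[of \<beta>] by (simp add: uu)
  then show ?thesis
    using orth_proj(2)[OF u] combination_variance(2)[of \<beta>] excess_risk_eq(1)[OF orth_proj(1)] by (simp add: uu)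
qed

lemma excess_risk_nonneg: "t \<in> m \<Longrightarrow> 0 \<le> excess_risk P s\<^sub>0 t"
  by (simp add: excess_risk_eq(1))

text \<open>Criteria are compared after subtracting the empirical risk of \<open>s\<^sub>0\<close>,
  a shift common to all models. What then remains of the empirical risk of the projection should be
  close to its excess risk.\<close>

definition bias_good :: "sample \<Rightarrow> bool" where
  "bias_good \<omega> \<longleftrightarrow> \<bar>emp_mean {1..n} \<omega> (contrast s\<^sub>m) - emp_mean {1..n} \<omega> (contrast s\<^sub>0) - excess_risk P s\<^sub>0 s\<^sub>m\<bar>
      \<le> excess_risk P s\<^sub>0 s\<^sub>m / sqrt l + 16 * \<kappa> ^ 3 * l ^ 3 / real n"

text \<open>The variance is controlled by the mean: the contrast difference is
  \<open>s\<^sub>0 - s\<^sub>m\<close> times a bounded factor, so its second moment is at most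
  \<open>16 * \<kappa>\<^sup>2\<close> times the excess risk. This makes the fluctuation
  relative.\<close>

lemma bias_good_concentration:
  assumes "t \<le> \<kappa> * l"
  shows "with_prob_at_least (PiM {1..n} (\<lambda>_. P)) (1 - 2 * exp (- t)) bias_good"
proof -
  let ?L = "excess_risk P s\<^sub>0 s\<^sub>m"
  define f where "f z = contrast s\<^sub>m z - contrast s\<^sub>0 z" for z
  have [measurable]: "f \<in> borel_measurable P"
    unfolding f_def contrast_def case_prod_beta by measurable
  have fi: "integrable P f" unfolding f_def by (rule excess_risk_eq(2)[OF orth_proj(1)])
  have fL: "(\<integral>z. f z \<partial>P) = ?L" by (simp add: f_def excess_risk_def)
  have bd: "AE z in P. \<bar>f z\<bar> \<le> 8 * \<kappa>\<^sup>2 \<and> (f z)\<^sup>2 \<le> 16 * \<kappa>\<^sup>2 * (s\<^sub>0 (fst z) - s\<^sub>m (fst z))\<^sup>2"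
    using bias_AE_bound sm_AE_bound regression_function_bound response_bound
  proof eventually_elim
    case (elim z)
    have f: "f z = (s\<^sub>0 (fst z) - s\<^sub>m (fst z)) * (2 * snd z - s\<^sub>0 (fst z) - s\<^sub>m (fst z))"
      by (simp add: f_def contrast_def case_prod_beta power2_eq_square algebra_simps)
    have b: "\<bar>2 * snd z - s\<^sub>0 (fst z) - s\<^sub>m (fst z)\<bar> \<le> 4 * \<kappa>" using elim kappa by linarith
    have "\<bar>f z\<bar> \<le> (2 * \<kappa>) * (4 * \<kappa>)" unfolding f abs_mult using b elim kappa by (intro mult_mono) auto
    moreover have "(f z)\<^sup>2 \<le> (s\<^sub>0 (fst z) - s\<^sub>m (fst z))\<^sup>2 * (4 * \<kappa>)\<^sup>2"
      unfolding f power_mult_distrib using power_mono[OF b abs_ge_zero, of 2] by (intro mult_left_mono) auto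
    ultimately show ?case by (simp add: power2_eq_square mult_ac)
  qed
  have bd1: "AE z in P. \<bar>f z\<bar> \<le> 8 * \<kappa>\<^sup>2" using bd by eventually_elim auto
  have L: "\<bar>?L\<bar> \<le> 8 * \<kappa>\<^sup>2"
  proof -
    have "\<bar>\<integral>z. f z \<partial>P\<bar> \<le> (\<integral>z. \<bar>f z\<bar> \<partial>P)" by (rule integral_abs_bound)
    also have "\<dots> \<le> (\<integral>z. 8 * \<kappa>\<^sup>2 \<partial>P)" using bd1 fi by (intro integral_mono_AE) auto
    finally show ?thesis by (simp add: fL prob_space)
  qed
  have i2: "integrable P (\<lambda>z. (f z)\<^sup>2)"
    unfolding power2_eq_square by (rule AE_bounded_mult_integrable[OF _ _ bd1 bd1]) measurable
  have isq: "integrable P (\<lambda>z. (s\<^sub>0 (fst z) - s\<^sub>m (fst z))\<^sup>2)"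
    unfolding power2_eq_square by (rule AE_bounded_mult_integrable[OF _ _ bias_AE_bound bias_AE_bound]) measurable
  \<comment> \<open>Turns the variance term into exactly \<open>n * ?L / sqrt l\<close>; the price
    is a term of order \<open>l * sqrt l\<close>, well below \<open>l ^ 3\<close>.\<close>
  define \<theta> where "\<theta> = 1 / (16 * \<kappa>\<^sup>2 * sqrt l)"
  have th: "0 < \<theta>" using kappa n_gt_one by (simp add: \<theta>_def)
  have "with_prob_at_least (PiM {1..n} (\<lambda>_. P)) (1 - 2 * exp (- t))
     (\<lambda>\<omega>. \<bar>\<Sum>i\<in>{1..n}. (f (\<omega> i) - ?L)\<bar> \<le> \<theta> * (real n * (16 * \<kappa>\<^sup>2 * ?L)) + t / \<theta>)"
  proof (rule iid_sum_concentration[where f="\<lambda>z. f z - ?L"])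
    show "(\<integral>z. f z - ?L \<partial>P) = 0" using fi fL by (simp add: prob_space)
    show "AE z in P. \<bar>f z - ?L\<bar> \<le> 16 * \<kappa>\<^sup>2"
      using bd1
    proof eventually_elim
      case (elim z)
      then show ?case using L by linarith
    qed
    have "(\<integral>z. (f z - ?L)\<^sup>2 \<partial>P) = variance f" by (simp add: fL)
    also have "\<dots> = expectation (\<lambda>z. (f z)\<^sup>2) - (expectation f)\<^sup>2" using fi i2 by (rule variance_eq)
    also have "\<dots> \<le> expectation (\<lambda>z. (f z)\<^sup>2)" by simp
    also have "\<dots> \<le> (\<integral>z. 16 * \<kappa>\<^sup>2 * (s\<^sub>0 (fst z) - s\<^sub>m (fst z))\<^sup>2 \<partial>P)"
      using bd i2 isq by (intro integral_mono_AE) auto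
    also have "\<dots> = 16 * \<kappa>\<^sup>2 * ?L" by (simp add: excess_risk_eq(1)[OF orth_proj(1)])
    finally show "(\<integral>z. (f z - ?L)\<^sup>2 \<partial>P) \<le> 16 * \<kappa>\<^sup>2 * ?L" .
    show "\<theta> * (16 * \<kappa>\<^sup>2) \<le> 1" using kappa n n_gt_one by (simp add: \<theta>_def divide_le_eq_1_pos)
  qed (use th in auto)
  then show ?thesis
  proof (rule with_prob_at_least_mono)
    fix \<omega>
    assume h: "\<bar>\<Sum>i\<in>{1..n}. (f (\<omega> i) - ?L)\<bar> \<le> \<theta> * (real n * (16 * \<kappa>\<^sup>2 * ?L)) + t / \<theta>"
    let ?x = "emp_mean {1..n} \<omega> (contrast s\<^sub>m) - emp_mean {1..n} \<omega> (contrast s\<^sub>0) - ?L"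
    have x: "(\<Sum>i\<in>{1..n}. (f (\<omega> i) - ?L)) = real n * ?x"
      using n_pos by (simp add: f_def emp_mean_def sum_subtractf right_diff_distrib)
    have 1: "\<theta> * (real n * (16 * \<kappa>\<^sup>2 * ?L)) = real n * (?L / sqrt l)"
      using kappa by (simp add: \<theta>_def)
    have "t / \<theta> \<le> \<kappa> * l / \<theta>" using assms th by (intro divide_right_mono) auto
    also have "\<dots> = 16 * \<kappa> ^ 3 * (l * sqrt l)" by (simp add: \<theta>_def power3_eq_cube power2_eq_square)
    also have "\<dots> \<le> 16 * \<kappa> ^ 3 * l ^ 3"
    proof -
      have "sqrt l \<le> l" using n by (intro real_le_lsqrt self_le_power) auto
      then have "l * sqrt l \<le> l * (l * l)" using n by (intro mult_left_mono order_trans[OF _ mult_left_mono[of 1 l l]]) auto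
      then show ?thesis using kappa by (intro mult_left_mono) (auto simp: power3_eq_cube)
    qed
    also have "\<dots> = real n * (16 * \<kappa> ^ 3 * l ^ 3 / real n)" using n_pos by simp
    finally have 2: "t / \<theta> \<le> real n * (16 * \<kappa> ^ 3 * l ^ 3 / real n)" .
    have "real n * \<bar>?x\<bar> = \<bar>real n * ?x\<bar>" by (simp add: abs_mult)
    also have "\<dots> \<le> real n * (?L / sqrt l + 16 * \<kappa> ^ 3 * l ^ 3 / real n)"
      using h 1 2 unfolding x distrib_left by linarith
    finally show "bias_good \<omega>" unfolding bias_good_def using n_pos by simp
  qed simp
qed

text \<open>The event covers all minimizers simultaneously, and \<open>R\<close> depends on the
  model alone, so neither refers to a particular selection. In \<open>427 = 411 + 16\<close>, the
  part \<open>411 = 41 * 3 + 12 * 24\<close> comes from the criterion and \<open>16\<close> from the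
  bias event.\<close>

lemma model_event:
  fixes V :: nat and t :: real
  defines "c \<equiv> 427 * \<kappa> ^ 13"
  defines "R \<equiv> excess_risk P s\<^sub>0 s\<^sub>m + noise_energy / real n"
  assumes big: "4 * c \<le> sqrt l" "l ^ 3 \<le> real n" and V: "2 \<le> V" "real V \<le> \<kappa>"
    and B: "regular_partition n V B" and t: "t \<le> \<kappa> * l"
  shows "0 \<le> R" and "with_prob_at_least (PiM {1..n} (\<lambda>_. P)) (1 - 36 * \<kappa> * (real n)\<^sup>2 * exp (- t))
    (\<lambda>\<omega>. \<forall>s sV. is_least_squares {1..n} \<omega> m s \<longrightarrow> (\<forall>j\<in>{1..V}. is_least_squares ({1..n} - B j) \<omega> m (sV j)) \<longrightarrow>
       0 \<le> excess_risk P s\<^sub>0 s \<and> \<bar>excess_risk P s\<^sub>0 s - R\<bar> \<le> c * (R * (1 / sqrt l) + l ^ 3 / real n) \<and>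
       \<bar>emp_mean {1..n} \<omega> (contrast s) + pen_VF n V B \<omega> sV - emp_mean {1..n} \<omega> (contrast s\<^sub>0) - R\<bar>
         \<le> c * (R * (1 / sqrt l) + l ^ 3 / real n))"
proof -
  let ?M = "PiM {1..n} (\<lambda>_. P)"
  interpret S: prob_space ?M by (rule prob_space_PiM) (rule prob_space_axioms)
  define H \<eta> \<tau> where "H = noise_energy / real n" and "\<eta> = 1 / sqrt l" and "\<tau> = l ^ 3 / real n"
  have H: "0 \<le> H" using noise_energy_nonneg by (simp add: H_def)
  have \<eta>: "0 \<le> \<eta>" and \<tau>: "0 \<le> \<tau>" using n by (auto simp: \<eta>_def \<tau>_def)
  let ?L = "excess_risk P s\<^sub>0 s\<^sub>m"
  have L: "0 \<le> ?L" by (rule excess_risk_nonneg[OF orth_proj(1)])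
  show R: "0 \<le> R" using L H by (simp add: R_def H_def)
  have k1: "1 \<le> \<kappa>" using kappa by simp
  have n0: "0 < n" using n_pos by simp
  have pw: "\<kappa> ^ i \<le> \<kappa> ^ j" if "i \<le> j" for i j :: nat using k1 that by (rule power_increasing[rotated])
  note fold = sum_emp_mean_leave_one_out[OF B V(1) n0]
  have sqrtl: "18 * \<kappa> ^ 7 \<le> sqrt l" 
  proof -
    have "0 \<le> \<kappa> ^ 13" "\<kappa> ^ 7 \<le> \<kappa> ^ 13" using k1 pw by auto
    then show ?thesis using big(1) unfolding c_def by linarith
  qed
  have \<delta>: "3 * \<kappa> ^ 7 / sqrt l \<le> 1 / 6" using sqrtl n by (simp add: divide_simps)
  have "\<kappa> ^ 2 \<le> sqrt l * sqrt l"
  proof -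
    have "\<kappa> \<le> sqrt l" using sqrtl pw[of 1 7] k1 by simp
    then show ?thesis using k1 n_gt_one by (simp only: power2_eq_square) (intro mult_mono, auto)
  qed
  then have "\<kappa> \<le> l" using n k1 self_le_power[of \<kappa> 2] by simp
  then have "\<kappa> \<le> l\<^sup>2" using n self_le_power[of l 2] by simp
  then have "\<kappa> * real n / l\<^sup>2 \<le> real n" using n by (simp add: divide_simps mult.commute mult_left_mono)
  then have Dn: "real D \<le> real n" using dim_le by linarith
  have nn: "1 \<le> (real n)\<^sup>2" using n0 by simp
  have e: "0 \<le> exp (- t)" by simp
  \<comment> \<open>A common failure bound for all kinds of events: the numbers
    \<open>D * n + 2\<close>, \<open>D * D\<close> and \<open>1\<close> are at most
    \<open>3 * n^2\<close>, each multiplied by \<open>2 * exp (- t)\<close>.\<close>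
  define p where "p = 6 * (real n)\<^sup>2 * exp (- t)"
  have p0: "0 \<le> p" by (simp add: p_def)
  have pr: "x * (2 * exp (- t)) \<le> p" if "x \<le> 3 * (real n)\<^sup>2" for x
    using mult_right_mono[OF that, of "2 * exp (- t)"] by (simp add: p_def)
  have DD: "real D * real n \<le> (real n)\<^sup>2" "real D * real D \<le> (real n)\<^sup>2"
    using Dn by (auto simp: power2_eq_square intro: mult_mono)
  have sg: "with_prob_at_least ?M (1 - p) (score_good I)" if "I \<subseteq> {1..n}" "real n \<le> \<kappa> * real (card I)" for I
    using score_good_concentration[OF that t big(2)] pr[of "real D * real n + 2"] DD nn
    by (elim with_prob_at_least_mono) auto
  have gg: "with_prob_at_least ?M (1 - p) (gram_good I)" if "I \<subseteq> {1..n}" "real n \<le> \<kappa> * real (card I)" for I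
    using gram_good_concentration[OF that t] pr[of "real D * real D"] DD nn
    by (elim with_prob_at_least_mono) auto
  have bg: "with_prob_at_least ?M (1 - p) bias_good"
    using bias_good_concentration[OF t] pr[of 1] nn by (elim with_prob_at_least_mono) auto
  have full: "{1..n} \<subseteq> {1..n}" "real n \<le> \<kappa> * real (card {1..n})" using k1 n_pos by auto
  have Vr: "2 \<le> real V" using V by simp
  have blk: "B j \<subseteq> {1..n}" "real n \<le> \<kappa> * real (card (B j))" if "j \<in> {1..V}" for j
  proof -
    show "B j \<subseteq> {1..n}" using fold(2)[OF that] .
    have "real n * real V \<le> real n * \<kappa>" using V by (intro mult_left_mono) auto
    then show "real n \<le> \<kappa> * real (card (B j))" using Vr unfolding fold(3)[OF that] by (simp add: field_simps)
  qed
  \<comment> \<open>A complement contains at least half of the sample because there are at least two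
    blocks, and \<open>2 \<le> \<kappa>\<close>.\<close>
  have cmp: "{1..n} - B j \<subseteq> {1..n}" "real n \<le> \<kappa> * real (card ({1..n} - B j))" if "j \<in> {1..V}" for j
  proof -
    have "real n * real V \<le> real n * (2 * (real V - 1))" using Vr by (intro mult_left_mono) auto
    also have "\<dots> \<le> real n * (\<kappa> * (real V - 1))" using kappa Vr by (intro mult_left_mono mult_right_mono) auto
    finally show "real n \<le> \<kappa> * real (card ({1..n} - B j))"
      using Vr unfolding fold(4)[OF that] by (simp add: pos_le_divide_eq mult_ac)
  qed auto
  have folds: "with_prob_at_least ?M (1 - real (card {1..V}) * (p + (p + p)))
      (\<lambda>\<omega>. \<forall>j\<in>{1..V}. score_good (B j) \<omega> \<and> score_good ({1..n} - B j) \<omega> \<and> gram_good ({1..n} - B j) \<omega>)"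
    by (intro S.with_prob_at_least_ball S.with_prob_at_least_conj sg gg blk cmp) auto
  note ev = S.with_prob_at_least_conj[OF bg S.with_prob_at_least_conj[OF sg[OF full] S.with_prob_at_least_conj[OF gg[OF full] folds]]]
  show "with_prob_at_least ?M (1 - 36 * \<kappa> * (real n)\<^sup>2 * exp (- t))
    (\<lambda>\<omega>. \<forall>s sV. is_least_squares {1..n} \<omega> m s \<longrightarrow> (\<forall>j\<in>{1..V}. is_least_squares ({1..n} - B j) \<omega> m (sV j)) \<longrightarrow>
       0 \<le> excess_risk P s\<^sub>0 s \<and> \<bar>excess_risk P s\<^sub>0 s - R\<bar> \<le> c * (R * (1 / sqrt l) + l ^ 3 / real n) \<and>
       \<bar>emp_mean {1..n} \<omega> (contrast s) + pen_VF n V B \<omega> sV - emp_mean {1..n} \<omega> (contrast s\<^sub>0) - R\<bar>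
         \<le> c * (R * (1 / sqrt l) + l ^ 3 / real n))"
    unfolding \<eta>_def[symmetric] \<tau>_def[symmetric]
  proof (rule with_prob_at_least_mono[OF ev], goal_cases)
    case 1
    \<comment> \<open>Three events for the full sample and three for each fold, at most
      \<open>6 * V\<close> in all.\<close>
    have "p + (p + (p + real V * (p + (p + p)))) \<le> 6 * (real V * p)"
      using mult_right_mono[OF Vr p0] p0 by (simp add: algebra_simps)
    also have "\<dots> \<le> 6 * (\<kappa> * p)" using V p0 by (intro mult_left_mono mult_right_mono) auto
    finally show ?case by (simp add: p_def mult_ac)
  next
    case (2 \<omega>)
    note good = 2(2)
    show ?case
    proof (intro allI impI)
      fix s sV
      assume s: "is_least_squares {1..n} \<omega> m s" and sV: "\<forall>j\<in>{1..V}. is_least_squares ({1..n} - B j) \<omega> m (sV j)"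
      obtain \<beta> where \<beta>: "s = ls.combine \<beta>"
        and b1: "\<bar>(\<Sum>k=1..D. (\<beta> k)\<^sup>2) - H\<bar> \<le> 6 * (3 * \<kappa> ^ 7 / sqrt l) * H + 2 * deviation"
        and b2: "\<bar>emp_mean {1..n} \<omega> (contrast s) + pen_VF n V B \<omega> sV - emp_mean {1..n} \<omega> (contrast s\<^sub>m) - H\<bar>
            \<le> \<kappa> * (41 * (3 * \<kappa> ^ 7 / sqrt l) * H + 12 * deviation)"
        using ls.vfold_criterion_bounds[OF \<delta> V B, of \<omega> s sV] good s sV unfolding H_def by blast
      define W where "W = H * \<eta> + \<tau>"
      have W: "0 \<le> H * \<eta>" "0 \<le> W" "H * \<eta> \<le> W" using H \<eta> \<tau> by (auto simp: W_def)
      \<comment> \<open>\<open>noise_energy_ge\<close> bounds \<open>D / n\<close> by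
        \<open>\<kappa> * H\<close>; this converts a deviation measured by the dimension into one
        relative to the variance term of the risk.\<close>
      have dev: "deviation \<le> 24 * \<kappa> ^ 12 * W"
      proof -
        have "deviation = 24 * \<kappa> ^ 11 * ((real D / real n) * \<eta> + \<tau>)"
        proof -
          have "(x / y + w) / z = (x / z) * (1 / y) + w / z" for x y z w :: real
            by (simp add: add_divide_distrib mult.commute)
          then show ?thesis unfolding deviation_def \<eta>_def \<tau>_def times_divide_eq_right[symmetric] by simp
        qed
        also have "\<dots> \<le> 24 * \<kappa> ^ 11 * (\<kappa> * W)"
        proof (intro mult_left_mono)
          have "real D / real n \<le> \<kappa> * H"
            using ls.noise_energy_ge n_pos by (simp add: H_def divide_right_mono)
          then have "(real D / real n) * \<eta> \<le> (\<kappa> * H) * \<eta>" using \<eta> by (rule mult_right_mono)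
          moreover have "1 * \<tau> \<le> \<kappa> * \<tau>" using k1 \<tau> by (rule mult_right_mono)
          ultimately show "(real D / real n) * \<eta> + \<tau> \<le> \<kappa> * W" by (simp add: W_def distrib_left)
        qed (use k1 in auto)
        also have "\<dots> = 24 * (\<kappa> ^ 11 * \<kappa>) * W" by simp
        also have "\<kappa> ^ 11 * \<kappa> = \<kappa> ^ 12" by (simp flip: power_Suc2)
        finally show ?thesis .
      qed
      have d7: "3 * \<kappa> ^ 7 / sqrt l * H \<le> 3 * (\<kappa> ^ 12 * W)"
      proof -
        have "\<kappa> ^ 7 * (H * \<eta>) \<le> \<kappa> ^ 12 * W" using pw[of 7 12] W k1 by (intro mult_mono) auto
        then show ?thesis by (simp add: \<eta>_def)
      qed
      have p1213: "\<kappa> ^ 12 * W \<le> \<kappa> ^ 13 * W" using pw[of 12 13] W by (intro mult_right_mono) auto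
      have kW: "0 \<le> \<kappa> ^ 13 * W" using W k1 by simp
      have c0: "0 \<le> c" using k1 by (simp add: c_def)
      have cR: "c * (R * \<eta> + \<tau>) = c * (?L * \<eta>) + c * W"
        by (simp add: R_def H_def[symmetric] W_def algebra_simps)
      have Le: "0 \<le> ?L * \<eta>" using L \<eta> by simp
      have "\<bar>excess_risk P s\<^sub>0 s - R\<bar> = \<bar>(\<Sum>k=1..D. (\<beta> k)\<^sup>2) - H\<bar>"
        unfolding \<beta> excess_risk_combine by (simp add: R_def H_def)
      \<comment> \<open>\<open>66 = 6 * 3 + 2 * 24\<close>.\<close>
      also have "\<dots> \<le> 66 * (\<kappa> ^ 12 * W)" using b1 d7 dev unfolding mult.assoc by linarith
      also have "\<dots> \<le> c * W" using p1213 kW unfolding c_def mult.assoc by linarith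
      also have "\<dots> \<le> c * (R * \<eta> + \<tau>)" unfolding cR using Le c0 by simp
      finally have 1: "\<bar>excess_risk P s\<^sub>0 s - R\<bar> \<le> c * (R * \<eta> + \<tau>)" .
      have "41 * (3 * \<kappa> ^ 7 / sqrt l) * H + 12 * deviation \<le> 411 * (\<kappa> ^ 12 * W)"
        using d7 dev unfolding mult.assoc by linarith
      then have "\<kappa> * (41 * (3 * \<kappa> ^ 7 / sqrt l) * H + 12 * deviation) \<le> \<kappa> * (411 * (\<kappa> ^ 12 * W))"
        using k1 by (intro mult_left_mono) auto
      also have "\<dots> = 411 * (\<kappa> ^ 12 * \<kappa>) * W" by simp
      also have "\<kappa> ^ 12 * \<kappa> = \<kappa> ^ 13" by (simp flip: power_Suc2)
      finally have 2: "\<kappa> * (41 * (3 * \<kappa> ^ 7 / sqrt l) * H + 12 * deviation) \<le> 411 * \<kappa> ^ 13 * W" .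
      have "16 * \<kappa> ^ 3 * \<tau> \<le> 16 * \<kappa> ^ 13 * W"
        using pw[of 3 13] W \<tau> k1 by (intro mult_mono) (auto simp: W_def)
      moreover have "?L / sqrt l = ?L * \<eta>" "16 * \<kappa> ^ 3 * l ^ 3 / real n = 16 * \<kappa> ^ 3 * \<tau>"
        by (simp_all add: \<eta>_def \<tau>_def)
      ultimately have 3: "\<bar>emp_mean {1..n} \<omega> (contrast s\<^sub>m) - emp_mean {1..n} \<omega> (contrast s\<^sub>0) - ?L\<bar>
          \<le> ?L * \<eta> + 16 * \<kappa> ^ 13 * W"
        using good unfolding bias_good_def by linarith
      have "1 * (?L * \<eta>) \<le> c * (?L * \<eta>)"
        using Le one_le_power[OF k1, of 13] by (intro mult_right_mono) (auto simp: c_def)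
      moreover have "411 * \<kappa> ^ 13 * W + 16 * \<kappa> ^ 13 * W = c * W" by (simp add: c_def)
      moreover have "\<bar>x + y - u - (a + h)\<bar> \<le> q" if "\<bar>x + y - v - h\<bar> \<le> k" "k \<le> k'" "\<bar>v - u - a\<bar> \<le> w + k''"
        "1 * w \<le> w'" "k' + k'' = r" "q = w' + r" for x y u v a h k k' k'' w w' r q :: real
        using that by linarith
      ultimately have "\<bar>emp_mean {1..n} \<omega> (contrast s) + pen_VF n V B \<omega> sV - emp_mean {1..n} \<omega> (contrast s\<^sub>0) - R\<bar>
          \<le> c * (R * \<eta> + \<tau>)"
        unfolding cR unfolding R_def H_def[symmetric] using b2 2 3 by blast
      moreover have "s \<in> m" using s by (auto simp: is_least_squares_def is_arg_min_def)
      ultimately show "0 \<le> excess_risk P s\<^sub>0 s \<and> \<bar>excess_risk P s\<^sub>0 s - R\<bar> \<le> c * (R * \<eta> + \<tau>) \<and>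
         \<bar>emp_mean {1..n} \<omega> (contrast s) + pen_VF n V B \<omega> sV - emp_mean {1..n} \<omega> (contrast s\<^sub>0) - R\<bar>
           \<le> c * (R * \<eta> + \<tau>)"
        using 1 excess_risk_nonneg by blast
    qed
  qed
qed

end

theorem theorem4p2:
  fixes K :: SA_constants and r :: real
  assumes "r > 2"
  shows "\<exists>L>0. \<exists>n0::nat. \<forall>n\<ge>n0.
    \<forall>(d::nat) (\<X>::point set) (P::obs measure) (s\<^sub>0::predictor) (\<sigma>::point \<Rightarrow> real) (\<epsilon>::obs \<Rightarrow> real)
      (\<M>::model set) (V::nat) (B::nat \<Rightarrow> nat set)
      (shat::sample \<Rightarrow> model \<Rightarrow> predictor) (shatV::sample \<Rightarrow> model \<Rightarrow> nat \<Rightarrow> predictor)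
      (mhat::sample \<Rightarrow> model).
      regression_setting d \<X> P s\<^sub>0 \<sigma> \<epsilon> \<longrightarrow>
      finite \<M> \<longrightarrow>
      (\<forall>m\<in>\<M>. is_model (covariate_law d \<X> P) m) \<longrightarrow>
      SA K n d \<X> P s\<^sub>0 \<sigma> \<M> \<longrightarrow>
      V \<in> {2..n - 1} \<longrightarrow> 1 < V \<longrightarrow> real V \<le> r \<longrightarrow>
      regular_partition n V B \<longrightarrow>
      (\<forall>\<omega>\<in>space (sample_space n P). \<forall>m\<in>\<M>. is_least_squares {1..n} \<omega> m (shat \<omega> m)) \<longrightarrow>
      (\<forall>\<omega>\<in>space (sample_space n P). \<forall>m\<in>\<M>. \<forall>j\<in>{1..V}.
          is_least_squares ({1..n} - B j) \<omega> m (shatV \<omega> m j)) \<longrightarrow>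
      (\<forall>\<omega>\<in>space (sample_space n P).
          is_arg_min (\<lambda>m. emp_mean {1..n} \<omega> (contrast (shat \<omega> m)) + pen_VF n V B \<omega> (shatV \<omega> m))
            (\<lambda>m. m \<in> \<M>) (mhat \<omega>)) \<longrightarrow>
      with_prob_at_least (sample_space n P) (1 - L / (real n)\<^sup>2)
        (\<lambda>\<omega>. excess_risk P s\<^sub>0 (shat \<omega> (mhat \<omega>))
              \<le> (1 + L / sqrt (ln (real n))) * (INF m\<in>\<M>. excess_risk P s\<^sub>0 (shat \<omega> m))
                + L * (ln (real n)) ^ 3 / real n)"
proof -
  \<comment> \<open>Fixed before any hypothesis on \<open>K\<close> is available, hence the absolute
    values. The constant 6 makes room for \<open>alpha_M K + 4\<close>, which sets the level of the
    exponential bounds.\<close>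
  define \<kappa> where "\<kappa> = 6 + \<bar>r_M K\<bar> + \<bar>A_c K\<bar> + \<bar>A_Mplus K\<bar> + \<bar>A_bd K\<bar> + 1 / (sigma_min K)\<^sup>2 + r + \<bar>alpha_M K\<bar> + \<bar>c_M K\<bar>"
  define c where "c = 427 * \<kappa> ^ 13"
  \<comment> \<open>Large enough for \<open>16 * c\<close> and \<open>10 * c\<close> from the oracle
    arithmetic and for \<open>36 * \<kappa>\<^sup>2\<close> from the failure probability.\<close>
  define L where "L = 10000 * \<kappa> ^ 13"
  \<comment> \<open>\<open>ln n \<ge> 256\<close> ensures \<open>(ln n)^3 \<le> n\<close>, and
    \<open>ln n \<ge> (4 * c)\<^sup>2\<close> keeps the relative error
    \<open>c / sqrt (ln n)\<close> at most \<open>1 / 4\<close>.\<close>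
  define N where "N = nat \<lceil>exp (max 256 ((4 * c)\<^sup>2))\<rceil>"
  have s0: "0 \<le> 1 / (sigma_min K)\<^sup>2" by simp
  have \<kappa>: "2 \<le> \<kappa>" "r_M K \<le> \<kappa>" "A_c K \<le> \<kappa>" "A_Mplus K \<le> \<kappa>" "A_bd K \<le> \<kappa>" "alpha_M K + 4 \<le> \<kappa>"
    "c_M K \<le> \<kappa>" "r \<le> \<kappa>" "1 / (sigma_min K)\<^sup>2 \<le> \<kappa>"
    using assms s0 unfolding \<kappa>_def by linarith+
  have p13: "1 \<le> \<kappa> ^ 13" "\<kappa>\<^sup>2 \<le> \<kappa> ^ 13"
    using \<kappa>(1) one_le_power[of \<kappa> 13] power_increasing[of 2 13 \<kappa>] by auto
  have L: "0 < L" "16 * c \<le> L" "10 * c \<le> L" "36 * \<kappa>\<^sup>2 \<le> L"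
    using p13 unfolding L_def c_def by linarith+
  have c0: "0 \<le> c" using \<kappa>(1) by (simp add: c_def)
  show ?thesis
  proof (rule exI[of _ L], rule conjI[OF L(1)], rule exI[of _ N], intro allI impI, goal_cases)
    case (1 n d \<X> P s\<^sub>0 \<sigma> \<epsilon> \<M> V B shat shatV mhat)
    note setting = 1(2) and fin = 1(3) and models = 1(4) and V = 1(6,7,8) and B = 1(9)
      and shat = 1(10) and shatV = 1(11) and mhat = 1(12)
    let ?\<mu> = "covariate_law d \<X> P" and ?M = "PiM {1..n} (\<lambda>_. P)"
    define l where "l = ln (real n)"
    have "exp (max 256 ((4 * c)\<^sup>2)) \<le> real n" using 1(1) unfolding N_def by linarith
    then have n0: "0 < real n" by (rule less_le_trans[OF exp_gt_zero])
    have "max 256 ((4 * c)\<^sup>2) \<le> l"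
      unfolding l_def ln_ge_iff[OF n0] by fact
    then have l: "256 \<le> l" "(4 * c)\<^sup>2 \<le> l" by auto
    have ln_le: "l \<le> real n" using ln_le_minus_one[OF n0] by (simp add: l_def)
    have el: "exp l = real n" using n0 by (simp add: l_def)
    have c_le: "4 * c \<le> sqrt l" using l(2) by (rule real_le_rsqrt)
    \<comment> \<open>Through \<open>exp l \<ge> (1 + l / 4) ^ 4 \<ge> l ^ 4 / 256\<close>, where
      \<open>256 \<le> l\<close> absorbs the denominator.\<close>
    have l3: "l ^ 3 \<le> real n"
    proof -
      have "l ^ 3 * 256 \<le> l ^ 3 * l" using l by (intro mult_left_mono) auto
      then have "l ^ 3 \<le> (l / 4) ^ 4" by (simp add: power_divide power4_eq_xxxx power3_eq_cube)
      also have "\<dots> \<le> (1 + l / real 4) ^ 4" using l by (intro power_mono) auto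
      also have "\<dots> \<le> exp l" using l by (intro exp_ge_one_plus_x_over_n_power_n) auto
      finally show ?thesis by (simp add: el)
    qed
    have SA: "SA_P1 K n \<M>" "\<forall>m\<in>\<M>. \<exists>b G A \<phi>. SA_Auslb K \<X> ?\<mu> m b G A \<phi> \<and> SA_P2 K n m b A"
      "SA_P3 K n \<M>" "SA_Ab K \<X> P ?\<mu> s\<^sub>0 \<M>" "SA_An K P \<sigma>"
      using 1(5) by (auto simp: SA_def Let_def)
    have sig: "0 < sigma_min K" using SA(5) by (simp add: SA_An_def)
    have ks: "1 \<le> \<kappa> * (sigma_min K)\<^sup>2" using \<kappa>(9) sig by (simp add: divide_simps)
    have reg: "regression d \<X> P s\<^sub>0 \<sigma> \<epsilon> (A_bd K) (sigma_min K)"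
      using setting SA(4,5) by (simp add: regression_def SA_Ab_def SA_An_def)
    have Vk: "2 \<le> V" "real V \<le> \<kappa>" using V \<kappa>(8) by auto
    \<comment> \<open>Then \<open>exp (- t)\<close> is \<open>n\<close> to the power
      \<open>- alpha_M K - 4\<close>: it pays for the number of models and for the factor
      \<open>n^2\<close> of each event, and leaves \<open>1 / n^2\<close>.\<close>
    define t where "t = (alpha_M K + 4) * l"
    have t: "t \<le> \<kappa> * l" using \<kappa>(6) l by (simp add: t_def mult_right_mono)
    define p where "p = 36 * \<kappa> * (real n)\<^sup>2 * exp (- t)"
    define good where "good m R \<omega> \<longleftrightarrow> (\<forall>s sV. is_least_squares {1..n} \<omega> m s \<longrightarrow>
        (\<forall>j\<in>{1..V}. is_least_squares ({1..n} - B j) \<omega> m (sV j)) \<longrightarrow>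
       0 \<le> excess_risk P s\<^sub>0 s \<and> \<bar>excess_risk P s\<^sub>0 s - R\<bar> \<le> c * (R * (1 / sqrt l) + l ^ 3 / real n) \<and>
       \<bar>emp_mean {1..n} \<omega> (contrast s) + pen_VF n V B \<omega> sV - emp_mean {1..n} \<omega> (contrast s\<^sub>0) - R\<bar>
         \<le> c * (R * (1 / sqrt l) + l ^ 3 / real n))" for m R \<omega>
    have "\<exists>R\<ge>0. with_prob_at_least ?M (1 - p) (good m R)" if m: "m \<in> \<M>" for m
    proof -
      obtain b G A \<phi> where a: "SA_Auslb K \<X> ?\<mu> m b G A \<phi>" "SA_P2 K n m b A" using SA(2) m by blast
      interpret sa_model d \<X> P s\<^sub>0 \<sigma> \<epsilon> K n \<kappa> m b G A \<phi>
        using reg a \<kappa> ks l ln_le models m SA(4)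
        by (intro sa_model.intro sa_model_axioms.intro) (auto simp: l_def SA_Ab_def)
      have big: "4 * (427 * \<kappa> ^ 13) \<le> sqrt (ln (real n))" "(ln (real n)) ^ 3 \<le> real n" "t \<le> \<kappa> * ln (real n)"
        using c_le l3 t by (simp_all add: c_def l_def)
      note ev = model_event[OF big(1,2) Vk B big(3)]
      show ?thesis
        using ev unfolding c_def[symmetric] l_def[symmetric] p_def[symmetric] good_def[abs_def] by blast
    qed
    then obtain R where R: "\<And>m. m \<in> \<M> \<Longrightarrow> 0 \<le> R m" "\<And>m. m \<in> \<M> \<Longrightarrow> with_prob_at_least ?M (1 - p) (good m (R m))"
      by metis
    interpret P: prob_space P using setting by (simp add: regression_setting_def)
    interpret S: prob_space ?M by (rule prob_space_PiM) (rule P.prob_space_axioms)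
    have "with_prob_at_least ?M (1 - real (card \<M>) * p) (\<lambda>\<omega>. \<forall>m\<in>\<M>. good m (R m) \<omega>)"
      using fin R(2) by (rule S.with_prob_at_least_ball)
    then show ?case unfolding sample_space_def
    proof (rule with_prob_at_least_mono)
      have "real (card \<M>) * p \<le> (c_M K * real n powr alpha_M K) * p"
        using SA(1) \<kappa>(1) by (intro mult_right_mono) (auto simp: SA_P1_def p_def)
      also have "\<dots> = 36 * (\<kappa> * c_M K) * ((real n powr alpha_M K) * (real n)\<^sup>2 * exp (- t))"
        by (simp add: p_def)
      also have "(real n powr alpha_M K) * (real n)\<^sup>2 * exp (- t) = 1 / (real n)\<^sup>2"
      proof -
        have "exp (- t) = real n powr (- alpha_M K - 4)"
          using n0 by (simp add: powr_def t_def l_def algebra_simps)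
        then have "(real n powr alpha_M K) * (real n)\<^sup>2 * exp (- t) = real n powr (- 2)"
          using n0 by (simp add: powr_add[symmetric] flip: powr_numeral)
        also have "\<dots> = 1 / (real n)\<^sup>2" using n0 by (simp add: powr_minus_divide powr_numeral)
        finally show ?thesis .
      qed
      also have "36 * (\<kappa> * c_M K) * (1 / (real n)\<^sup>2) \<le> L * (1 / (real n)\<^sup>2)"
      proof (intro mult_right_mono)
        have "\<kappa> * c_M K \<le> \<kappa> * \<kappa>" using \<kappa>(1,7) by (intro mult_left_mono) auto
        then show "36 * (\<kappa> * c_M K) \<le> L" using L(4) unfolding power2_eq_square by linarith
      qed simp
      finally show "1 - L / (real n)\<^sup>2 \<le> 1 - real (card \<M>) * p" by simp
    next
      fix \<omega> assume \<omega>: "\<omega> \<in> space ?M" and good: "\<forall>m\<in>\<M>. good m (R m) \<omega>"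
      let ?x = "\<lambda>m. excess_risk P s\<^sub>0 (shat \<omega> m)"
      let ?y = "\<lambda>m. emp_mean {1..n} \<omega> (contrast (shat \<omega> m)) + pen_VF n V B \<omega> (shatV \<omega> m)"
      have \<omega>': "\<omega> \<in> space (sample_space n P)" using \<omega> by (simp add: sample_space_def)
      have g: "0 \<le> ?x m" "\<bar>?x m - R m\<bar> \<le> c * (R m * (1 / sqrt l) + l ^ 3 / real n)"
        "\<bar>?y m - emp_mean {1..n} \<omega> (contrast s\<^sub>0) - R m\<bar> \<le> c * (R m * (1 / sqrt l) + l ^ 3 / real n)"
        if m: "m \<in> \<M>" for m
        using good[rule_format, OF m, unfolded good_def, rule_format, of "shat \<omega> m" "shatV \<omega> m"]
          shat[rule_format, OF \<omega>' m] shatV[rule_format, OF \<omega>' m] by auto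
      have mh: "mhat \<omega> \<in> \<M>" and opt: "\<And>m. m \<in> \<M> \<Longrightarrow> ?y (mhat \<omega>) \<le> ?y m"
        using mhat[rule_format, OF \<omega>'] by (auto simp: is_arg_min_def not_less)
      \<comment> \<open>The collection is finite and nonempty, so the infimum is attained by an
        oracle model, with which the selected one is compared.\<close>
      have "(INF m\<in>\<M>. ?x m) = Min (?x ` \<M>)" using fin mh by (intro cInf_eq_Min) auto
      moreover have "Min (?x ` \<M>) \<in> ?x ` \<M>" using fin mh by (intro Min_in) auto
      ultimately obtain m where m: "m \<in> \<M>" "(INF m\<in>\<M>. ?x m) = ?x m" by auto
      have "c * (1 / sqrt l) \<le> 1 / 4" using c_le l by (simp add: divide_simps)
      from oracle_arithmetic[OF c0 _ this _ R(1)[OF m(1)] R(1)[OF mh] g(1)[OF m(1)] g(2)[OF m(1)] g(3)[OF m(1)]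
        g(2)[OF mh] g(3)[OF mh] opt[OF m(1)]]
      have "?x (mhat \<omega>) \<le> (1 + 16 * c * (1 / sqrt l)) * ?x m + 10 * c * (l ^ 3 / real n)" using l by simp
      also have "\<dots> \<le> (1 + L * (1 / sqrt l)) * ?x m + L * (l ^ 3 / real n)"
        using L(2,3) g(1)[OF m(1)] l by (intro add_mono mult_right_mono order_refl) auto
      finally show "?x (mhat \<omega>) \<le> (1 + L / sqrt (ln (real n))) * (INF m\<in>\<M>. ?x m) + L * (ln (real n)) ^ 3 / real n"
        by (simp add: m(2) l_def)
    qed
  qed
qed

end
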